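(* Let $c$ be a real positive definite stiffness tensor in dimension $n$, let $P_c$ be its slowness polynomial and let $\Sigma=V(P_c)\subset\mathbb{R}^n$ be the associated real slowness surface. Then the following hold. (1) If $\Sigma$ is smooth as a scheme, then it is smooth as a variety. (2) Suppose $P_c$ is squarefree. Then $\Sigma$ is smooth as a scheme if and only if it is smooth as a variety. (3) $\Sigma$ is smooth as a real manifold if and only if it is smooth as a variety. (4) Singular points of $\Sigma$ as a scheme are exactly the same as the degeneracy points of the Christoffel matrix.
   Context: A real $n$-dimensional stiffness tensor is an array $c=(c_{ijkl})_{1\le i,j,k,l\le n}$ of reals with $c_{ijkl}=c_{jikl}=c_{klij}$; it is positive definite if $\sum c_{ijkl}A_{ij}A_{kl}>0$ for every nonzero real symmetric $A$. Christoffel matrix: $(\Gamma_c(p))_{il}=\sum_{j,k}c_{ijkl}p_jp_k$. Slowness polynomial: $P_c(p)=\det(\Gamma_c(p)-\mathrm{Id})\in\mathbb{R}[p_1,\dots,p_n]$; $V(P_c)$ is its vanishing set in $\mathbb{R}^n$. For a polynomial $f$ with irreducible factorization $f=q_1^{m_1}\cdots q_k^{m_k}$ (distinct irreducibles, up to constants), $\operatorname{rad}(f)=q_1\cdots q_k$; $f$ is squarefree if not divisible by $q^2$ for any non-constant polynomial $q$. The vanishing set of $f$ is smooth as a scheme if there are no points where $f=0$ and $\nabla f=0$; it is smooth as a variety if the vanishing set of $\operatorname{rad}(f)$ is smooth as a scheme. For $\Sigma$ these notions are applied to $f=P_c$. A singular point of $\Sigma$ as a scheme is a point where $P_c=0$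 and $\nabla P_c=0$. Degeneracy points are vectors $p\in\mathbb{R}^n$ where the Christoffel matrix $\Gamma_c(p)$ has a multiple eigenvalue.
   Formalization: Part (4) is false as worded (for n ≥ 2, p = 0 is a degeneracy point but P_c(0) ≠ 0). Proved instead: singular points are exactly the p where 1 is a multiple eigenvalue of Γ_c(p), and the nonzero degeneracy points are exactly the positive multiples of singular points. *)

theory Defs
  imports
    "HOL-Analysis.Analysis"
    "HOL-Library.Poly_Mapping"
    "HOL-Computational_Algebra.Polynomial"
    "HOL-Computational_Algebra.Squarefree"
begin

text \<open>A polynomial maps each exponent vector to its coefficient. Sum, product,
  divisibility, irreducibility and squarefreeness are those of the commutative ring
  \<^typ>\<open>('n \<Rightarrow>\<^sub>0 nat) \<Rightarrow>\<^sub>0 real\<close> (the product is convolution); its units are the nonzero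
  constants.\<close>

type_synonym 'n mvpoly = "('n \<Rightarrow>\<^sub>0 nat) \<Rightarrow>\<^sub>0 real"

definition Const :: "real \<Rightarrow> 'n mvpoly" where
  "Const a = Poly_Mapping.single 0 a"

definition Var :: "'n \<Rightarrow> 'n mvpoly" where
  "Var i = Poly_Mapping.single (Poly_Mapping.single i 1) 1"

definition mveval :: "'n::finite mvpoly \<Rightarrow> real ^ 'n \<Rightarrow> real" where
  "mveval f p = (\<Sum>m\<in>Poly_Mapping.keys f.
     Poly_Mapping.lookup f m * (\<Prod>i\<in>UNIV. (p $ i) ^ Poly_Mapping.lookup m i))"

definition zero_set :: "'n::finite mvpoly \<Rightarrow> (real ^ 'n) set" where
  "zero_set f = {p. mveval f p = 0}"

text \<open>\<open>is_radical f r\<close>: \<open>r\<close> is the product of the distinct irreducible factors in some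
  irreducible factorization of \<open>f\<close>. Factors that do not divide each other are distinct
  up to constants, so \<open>r\<close> is determined up to a nonzero constant when \<open>f \<noteq> 0\<close>;
  \<open>rad f\<close> is an arbitrary choice among these.\<close>

definition is_radical :: "'n mvpoly \<Rightarrow> 'n mvpoly \<Rightarrow> bool" where
  "is_radical f r \<longleftrightarrow> (\<exists>a Q m.
     a \<noteq> 0 \<and> finite Q \<and> (\<forall>q\<in>Q. irreducible q \<and> 0 < (m q :: nat)) \<and>
     (\<forall>q\<in>Q. \<forall>q'\<in>Q. q \<noteq> q' \<longrightarrow> \<not> q dvd q') \<and>
     f = Const a * (\<Prod>q\<in>Q. q ^ m q) \<and> r = (\<Prod>q\<in>Q. q))"

definition rad :: "'n mvpoly \<Rightarrow> 'n mvpoly" where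
  "rad f = (SOME r. is_radical f r)"

definition singular_point :: "'n::finite mvpoly \<Rightarrow> real ^ 'n \<Rightarrow> bool" where
  "singular_point f p \<longleftrightarrow> mveval f p = 0 \<and> GDERIV (mveval f) p :> 0"

definition smooth_as_scheme :: "'n::finite mvpoly \<Rightarrow> bool" where
  "smooth_as_scheme f \<longleftrightarrow> \<not> (\<exists>p. singular_point f p)"

definition smooth_as_variety :: "'n::finite mvpoly \<Rightarrow> bool" where
  "smooth_as_variety f \<longleftrightarrow> smooth_as_scheme (rad f)"

text \<open>\<open>Ck_on k S f\<close> says that \<open>f\<close> is \<open>k\<close> times continuously differentiable on \<open>S\<close>. As the
  derivatives are taken in the ambient space, it is meant for open \<open>S\<close> only.\<close>

primrec Ck_on ::
  "nat \<Rightarrow> 'a::euclidean_space set \<Rightarrow> ('a \<Rightarrow> 'b::euclidean_space) \<Rightarrow> bool" where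
  "Ck_on 0 S f \<longleftrightarrow> continuous_on S f"
| "Ck_on (Suc k) S f \<longleftrightarrow> (\<forall>x\<in>S. f differentiable (at x)) \<and>
     (\<forall>v. Ck_on k S (\<lambda>x. frechet_derivative f (at x) v))"

definition smooth_on ::
  "'a::euclidean_space set \<Rightarrow> ('a \<Rightarrow> 'b::euclidean_space) \<Rightarrow> bool" where
  "smooth_on S f \<longleftrightarrow> (\<forall>k. Ck_on k S f)"

text \<open>An embedded smooth submanifold of dimension \<open>d\<close>, given by slice charts: ambient
  diffeomorphisms that locally straighten \<open>M\<close> to a \<open>d\<close>-dimensional linear subspace.\<close>

definition smooth_submanifold :: "nat \<Rightarrow> 'a::euclidean_space set \<Rightarrow> bool" where
  "smooth_submanifold d M \<longleftrightarrow> (\<forall>p\<in>M. \<exists>U V (\<phi> :: 'a \<Rightarrow> 'a) \<psi> S.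
     open U \<and> p \<in> U \<and> open V \<and> homeomorphism U V \<phi> \<psi> \<and>
     smooth_on U \<phi> \<and> smooth_on V \<psi> \<and>
     subspace S \<and> dim S = d \<and> \<phi> ` (U \<inter> M) = V \<inter> S)"

definition smooth_real_manifold :: "'a::euclidean_space set \<Rightarrow> bool" where
  "smooth_real_manifold M \<longleftrightarrow> (\<exists>d. smooth_submanifold d M)"

type_synonym 'n tensor4 = "'n \<Rightarrow> 'n \<Rightarrow> 'n \<Rightarrow> 'n \<Rightarrow> real"

definition stiffness_tensor :: "'n tensor4 \<Rightarrow> bool" where
  "stiffness_tensor c \<longleftrightarrow> (\<forall>i j k l. c i j k l = c j i k l \<and> c i j k l = c k l i j)"

definition positive_definite :: "'n::finite tensor4 \<Rightarrow> bool" where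
  "positive_definite c \<longleftrightarrow> (\<forall>A :: real ^ 'n ^ 'n. transpose A = A \<and> A \<noteq> 0 \<longrightarrow>
     (\<Sum>i\<in>UNIV. \<Sum>j\<in>UNIV. \<Sum>k\<in>UNIV. \<Sum>l\<in>UNIV. c i j k l * A $ i $ j * A $ k $ l) > 0)"

definition christoffel :: "'n::finite tensor4 \<Rightarrow> real ^ 'n \<Rightarrow> real ^ 'n ^ 'n" where
  "christoffel c p = (\<chi> i l. \<Sum>j\<in>UNIV. \<Sum>k\<in>UNIV. c i j k l * p $ j * p $ k)"

definition christoffel_poly :: "'n::finite tensor4 \<Rightarrow> 'n mvpoly ^ 'n ^ 'n" where
  "christoffel_poly c = (\<chi> i l. \<Sum>j\<in>UNIV. \<Sum>k\<in>UNIV. Const (c i j k l) * Var j * Var k)"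

definition slowness_poly :: "'n::finite tensor4 \<Rightarrow> 'n mvpoly" where
  "slowness_poly c = det (christoffel_poly c - mat 1)"

definition slowness_surface :: "'n::finite tensor4 \<Rightarrow> (real ^ 'n) set" where
  "slowness_surface c = zero_set (slowness_poly c)"

definition charpoly :: "real ^ 'n ^ 'n \<Rightarrow> real poly" where
  "charpoly A = det (mat [:0, 1:] - (\<chi> i j. [:A $ i $ j:]))"

definition multiple_eigenvalue :: "real ^ 'n ^ 'n \<Rightarrow> real \<Rightarrow> bool" where
  "multiple_eigenvalue A x \<longleftrightarrow> 2 \<le> order x (charpoly A)"

definition degeneracy_points :: "'n::finite tensor4 \<Rightarrow> (real ^ 'n) set" where
  "degeneracy_points c = {p. \<exists>x. multiple_eigenvalue (christoffel c p) x}"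

end

theory Submission
  imports Defs "HOL-Computational_Algebra.Fundamental_Theorem_Algebra"
begin


text \<open>
  Let \<open>r\<close> be the radical of \<open>P\<close>. Along a ray, \<open>P(t p) = det (t\<^sup>2 \<Gamma>(p) - 1)\<close> has degree \<open>2n\<close> and
  only real roots, so the same holds with a locally constant degree for every factor of \<open>P\<close>, and
  roots on a ray persist on neighbouring rays with their multiplicities.

  For the hard direction of (3), let \<open>\<Sigma>\<close> be a manifold and \<open>p\<close> a singular point of \<open>r\<close>. Persistence of
  roots forces the dimension \<open>n - 1\<close>, so \<open>\<Sigma> = {H = 0}\<close> near \<open>p\<close> for a function \<open>H\<close> that increases along
  a coordinate axis. It also excludes local extrema of \<open>H\<close> along rays at points of \<open>\<Sigma>\<close>, so rays
  near \<open>p\<close> meet \<open>\<Sigma>\<close> only once near \<open>p\<close>, although they carry two roots of \<open>r\<close>. Hence all these roots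
  are double, and the radial derivative of \<open>r\<close> vanishes on \<open>\<Sigma>\<close> near \<open>p\<close>. Some irreducible factor \<open>q\<close> of
  \<open>r\<close> vanishes on an open part of \<open>\<Sigma>\<close>. Since \<open>q\<close> is prime, it divides every polynomial that vanishes
  there; this gives that it divides its own radial derivative, which is impossible as \<open>q(0) \<noteq> 0\<close>.
  In the other direction, the chart replaces one coordinate by \<open>r\<close>.

  For (4), the derivative of a determinant is a sum of determinants with one row replaced, so it
  vanishes if the kernel has dimension two; for a symmetric matrix that is the case at a multiple
  eigenvalue. Conversely, the radial derivative of \<open>P\<close> at \<open>p\<close> is, up to a nonzero factor, the
  derivative of the characteristic polynomial of \<open>\<Gamma>(p)\<close> at 1.
\<close>

\<comment> \<open>For arbitrary polynomials (3) fails: \<open>x (x^2 + y^2)\<close> is its own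
  radical up to constants and singular at the origin, but its real zero set is a line. There the
  singularity comes from nonreal branches. Real-rootedness along rays excludes them here: a double
  root of the radical at a singular point becomes two real roots, counted with multiplicity, on
  every nearby ray. A smooth zero set says nothing about the multiplicity of its equation, so the
  contradiction has to be algebraic. Over the reals, vanishing on a zero set does not in general
  imply divisibility by its equation; here it does because the projection of a smooth hypersurface
  along a transversal axis contains an open set. The argument needs irreducible polynomials to be
  prime, which is proved with pseudo-division instead of fraction fields. The origin supplies the
  last step: the slowness polynomial and all its factors are nonzero there, whereas the radial
  derivative of any polynomial vanishes there.\<close>
alias lookup = Poly_Mapping.lookup
alias keys = Poly_Mapping.keys
alias single = Poly_Mapping.single

section \<open>Polynomials in finitely many variables\<close>

lemma poly_mapping_eq_sum_single:
  "f = (\<Sum>m\<in>keys f. single m (lookup f m))"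
proof (rule poly_mapping_eqI)
  fix k
  have "(\<Sum>m\<in>keys f. (lookup f m when m = k)) = lookup f k"
    by (auto simp: when_def in_keys_iff sum.delta)
  then show "lookup f k =
      lookup (\<Sum>m\<in>keys f. single m (lookup f m)) k"
    by (simp add: lookup_sum lookup_single)
qed

lemma mult_eq_sum_single:
  fixes f g :: "'n mvpoly"
  shows "f * g = (\<Sum>a\<in>keys f. \<Sum>b\<in>keys g.
    single (a + b) (lookup f a * lookup g b))"
proof -
  have "f * g = (\<Sum>m\<in>keys f. single m (lookup f m)) *
      (\<Sum>m\<in>keys g. single m (lookup g m))"
    using poly_mapping_eq_sum_single[of f] poly_mapping_eq_sum_single[of g] by simp
  also have "\<dots> = (\<Sum>a\<in>keys f. \<Sum>b\<in>keys g.
    single (a + b) (lookup f a * lookup g b))"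
    by (simp add: sum_product mult_single)
  finally show ?thesis .
qed

text \<open>With a single way of splitting the exponent, only one product of coefficients
  contributes, so nothing can cancel. It is applied to leading monomials and to multiplication by a
  power of a variable.\<close>

lemma lookup_mult_unique:
  fixes f g :: "'n mvpoly"
  assumes "a \<in> keys f" "b \<in> keys g"
    and "\<And>a' b'. a' \<in> keys f \<Longrightarrow> b' \<in> keys g \<Longrightarrow> a' + b' = a + b \<Longrightarrow> a' = a \<and> b' = b"
  shows "lookup (f * g) (a + b) = lookup f a * lookup g b"
proof -
  have "lookup (f * g) (a + b) = (\<Sum>a'\<in>keys f. \<Sum>b'\<in>keys g.
      if a' + b' = a + b then lookup f a' * lookup g b' else 0)"
    by (subst mult_eq_sum_single) (simp add: lookup_sum lookup_single when_def)
  also have "\<dots> = (\<Sum>a'\<in>keys f. \<Sum>b'\<in>keys g.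
      if a' = a \<and> b' = b then lookup f a * lookup g b else 0)"
    using assms(3) by (intro sum.cong refl) (metis (full_types))
  also have "\<dots> = (\<Sum>a'\<in>keys f. if a' = a then lookup f a * lookup g b else 0)"
    using assms(2) by (intro sum.cong refl) (simp add: sum.delta)
  also have "\<dots> = lookup f a * lookup g b"
    using assms(1) by (simp add: sum.delta)
  finally show ?thesis .
qed

lemma keys_minus_subset:
  fixes f g :: "'n mvpoly"
  shows "keys (f - g) \<subseteq> keys f \<union> keys g"
  by (auto simp: in_keys_iff lookup_minus)

lemma Const_0 [simp]: "Const 0 = 0"
  and Const_1 [simp]: "Const 1 = 1"
  and Const_mult: "Const (a * b) = Const a * Const b"
  by (simp_all add: Const_def mult_single)

lemma Const_inverse [simp]:
  assumes "a \<noteq> 0"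
  shows "Const a * Const (inverse a) = 1" "Const (inverse a) * Const a = 1"
  using assms by (simp_all add: Const_mult[symmetric])

lemma eq_Const_if_keys:
  assumes "keys f \<subseteq> {0}"
  shows "f = Const (lookup f 0)"
proof -
  have "f = (\<Sum>m\<in>{0}. single m (lookup f m))"
    by (subst poly_mapping_eq_sum_single, intro sum.mono_neutral_left)
      (use assms in \<open>auto simp: in_keys_iff\<close>)
  then show ?thesis by (simp add: Const_def)
qed

lemma Const_dvd_1: "a \<noteq> 0 \<Longrightarrow> Const a dvd 1"
  by (metis Const_inverse(1) dvd_triv_left)

lemma Var_power: "Var i ^ k = single (single i k) 1"
  by (induction k) (simp_all add: Var_def mult_single single_add[symmetric])

subsection \<open>A multiplicative size\<close>

text \<open>One prime per variable lets unique factorization of natural numbers show that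
  \<open>mono_code\<close> is injective.\<close>

definition var_prime :: "'n::finite \<Rightarrow> nat" where
  "var_prime = (SOME f. inj f \<and> (\<forall>i. prime (f i)))"

lemma inj_var_prime: "inj (var_prime :: 'n::finite \<Rightarrow> nat)"
  and prime_var_prime: "prime (var_prime (i :: 'n))"
proof -
  obtain g :: "nat \<Rightarrow> nat" where g: "inj g" "range g \<subseteq> {p. prime p}"
    using infinite_countable_subset[OF primes_infinite] by blast
  obtain h :: "'n \<Rightarrow> nat" where "inj h"
    using finite_imp_inj_to_nat_seg[of "UNIV :: 'n set"] by auto
  with g have "inj (g \<circ> h) \<and> (\<forall>i. prime ((g \<circ> h) i))"
    by (auto simp: inj_compose)
  then have "inj (var_prime :: 'n \<Rightarrow> nat) \<and> (\<forall>i. prime (var_prime (i :: 'n)))"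
    unfolding var_prime_def by (rule someI[of "\<lambda>f. inj f \<and> (\<forall>i. prime (f i))"])
  then show "inj (var_prime :: 'n \<Rightarrow> nat)" "prime (var_prime (i :: 'n))" by auto
qed

text \<open>Comparing the numbers \<open>mono_code m\<close> is a monomial order, whichever primes are used.\<close>

definition mono_code :: "('n::finite \<Rightarrow>\<^sub>0 nat) \<Rightarrow> nat" where
  "mono_code m = (\<Prod>i\<in>UNIV. var_prime i ^ lookup m i)"

lemma mono_code_add: "mono_code (a + b) = mono_code a * mono_code b"
  by (simp add: mono_code_def lookup_add power_add prod.distrib)

lemma mono_code_pos: "0 < mono_code m"
  by (simp add: mono_code_def prime_gt_0_nat[OF prime_var_prime])

lemma mono_code_0 [simp]: "mono_code 0 = 1"
  by (simp add: mono_code_def)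

lemma inj_mono_code: "mono_code a = mono_code b \<longleftrightarrow> a = b"
proof
  assume eq: "mono_code a = mono_code b"
  have *: "multiplicity (var_prime j) (mono_code m) = lookup m j"
    for j and m :: "'a \<Rightarrow>\<^sub>0 nat"
  proof -
    define f where "f = (\<lambda>p. lookup m (inv var_prime p))"
    have "mono_code m = (\<Prod>p\<in>range (var_prime :: 'a \<Rightarrow> nat). p ^ f p)"
      unfolding mono_code_def f_def
      by (subst prod.reindex) (auto simp: inj_var_prime)
    moreover have "multiplicity (var_prime j) (\<Prod>p\<in>range (var_prime :: 'a \<Rightarrow> nat). p ^ f p) = f (var_prime j)"
      by (subst multiplicity_prod_prime_powers) (auto intro: prime_var_prime)
    moreover have "f (var_prime j) = lookup m j"
      by (simp add: f_def inj_var_prime)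
    ultimately show ?thesis by simp
  qed
  show "a = b"
    by (rule poly_mapping_eqI) (metis * eq)
qed simp

text \<open>The code of the leading monomial. On nonzero polynomials it is multiplicative, and it
  exceeds 1 on nonunits, so it acts as a norm: splitting off factors terminates because it
  drops.\<close>

definition poly_size :: "'n::finite mvpoly \<Rightarrow> nat" where
  "poly_size f = Max (mono_code ` keys f)"

lemma poly_size_leading:
  assumes "f \<noteq> 0"
  obtains a where "a \<in> keys f" "mono_code a = poly_size f"
    "\<And>b. b \<in> keys f \<Longrightarrow> mono_code b \<le> poly_size f"
proof -
  have "poly_size f \<in> mono_code ` keys f"
    unfolding poly_size_def using assms by (intro Max_in) auto
  then show thesis
    using that by (auto simp: poly_size_def)
qed

lemma poly_size_eqI:
  assumes "a \<in> keys f" "\<And>b. b \<in> keys f \<Longrightarrow> mono_code b \<le> mono_code a"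
  shows "poly_size f = mono_code a"
  unfolding poly_size_def using assms by (intro Max_eqI) auto

text \<open>Each code is at most its maximum, so a pair of monomials with the maximal product is
  maximal in both entries, and the product of the leading coefficients survives.\<close>

lemma mult_nonzero_and_size:
  fixes f g :: "'n::finite mvpoly"
  assumes "f \<noteq> 0" "g \<noteq> 0"
  shows "f * g \<noteq> 0 \<and> poly_size (f * g) = poly_size f * poly_size g"
proof -
  obtain a where a: "a \<in> keys f" "mono_code a = poly_size f"
    "\<And>b. b \<in> keys f \<Longrightarrow> mono_code b \<le> poly_size f"
    using poly_size_leading[OF assms(1)] by metis
  obtain b where b: "b \<in> keys g" "mono_code b = poly_size g"
    "\<And>b. b \<in> keys g \<Longrightarrow> mono_code b \<le> poly_size g"
    using poly_size_leading[OF assms(2)] by metis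
  have "lookup (f * g) (a + b) = lookup f a * lookup g b"
  proof (rule lookup_mult_unique[OF a(1) b(1)])
    fix a' b' assume ab': "a' \<in> keys f" "b' \<in> keys g" "a' + b' = a + b"
    then have eq: "mono_code a' * mono_code b' = mono_code a * mono_code b"
      by (metis mono_code_add)
    have le: "mono_code a' \<le> mono_code a" "mono_code b' \<le> mono_code b"
      using a b ab' by auto
    have "mono_code a' = mono_code a"
    proof (rule ccontr)
      assume "mono_code a' \<noteq> mono_code a"
      then have "mono_code a' * mono_code b' < mono_code a * mono_code b"
        using le mono_code_pos[of b'] by (intro mult_less_le_imp_less) auto
      with eq show False by simp
    qed
    with ab' show "a' = a \<and> b' = b"
      by (simp add: inj_mono_code)
  qed
  then have k: "a + b \<in> keys (f * g)"
    using a b by (simp add: in_keys_iff)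
  have "poly_size (f * g) = mono_code (a + b)"
  proof (rule poly_size_eqI[OF k])
    fix c assume "c \<in> keys (f * g)"
    then obtain a' b' where "a' \<in> keys f" "b' \<in> keys g" "c = a' + b'"
      using keys_mult by blast
    then show "mono_code c \<le> mono_code (a + b)"
      using a b by (simp add: mono_code_add mult_le_mono)
  qed
  then show ?thesis
    using k a b by (auto simp: mono_code_add)
qed

lemma mvpoly_mult_eq_0_iff [simp]:
  fixes f g :: "'n::finite mvpoly"
  shows "f * g = 0 \<longleftrightarrow> f = 0 \<or> g = 0"
  using mult_nonzero_and_size by auto

lemma mvpoly_power_eq_0_iff [simp]:
  fixes f :: "'n::finite mvpoly"
  shows "f ^ k = 0 \<longleftrightarrow> f = 0 \<and> 0 < k"
  by (induction k) auto

lemma mvpoly_mult_left_cancel: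
  fixes f g h :: "'n::finite mvpoly"
  assumes "f \<noteq> 0" "f * g = f * h"
  shows "g = h"
proof -
  have "f * (g - h) = 0" using assms by (simp add: right_diff_distrib)
  then show ?thesis using assms(1) mvpoly_mult_eq_0_iff[of f "g - h"] by simp
qed

lemma poly_size_mult:
  "f \<noteq> 0 \<Longrightarrow> g \<noteq> 0 \<Longrightarrow> poly_size (f * g) = poly_size f * poly_size g"
  using mult_nonzero_and_size by blast

lemma poly_size_pos: "f \<noteq> 0 \<Longrightarrow> 0 < poly_size f"
  by (metis poly_size_leading mono_code_pos)

lemma poly_size_eq_1:
  assumes "f \<noteq> 0" "poly_size f = 1"
  obtains c where "c \<noteq> 0" "f = Const c"
proof -
  have "mono_code b = 1" if "b \<in> keys f" for b
    using that assms poly_size_leading[OF assms(1)] mono_code_pos[of b]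
    by (metis Suc_leI One_nat_def le_antisym)
  then have "b = 0" if "b \<in> keys f" for b
    using that inj_mono_code[of b 0] by simp
  then have "keys f = {0}"
    using assms(1) by (metis keys_eq_empty subset_singletonD subsetI singletonI)
  then have "f = Const (lookup f 0)"
    by (intro eq_Const_if_keys) simp
  with assms(1) that show thesis by (metis Const_0)
qed

lemma mvpoly_unit_iff:
  fixes f :: "'n::finite mvpoly"
  shows "f dvd 1 \<longleftrightarrow> (\<exists>c. c \<noteq> 0 \<and> f = Const c)"
proof
  assume "f dvd 1"
  then obtain g where g: "1 = f * g" by (auto elim: dvdE)
  then have nz: "f \<noteq> 0" "g \<noteq> 0" by (metis mvpoly_mult_eq_0_iff one_neq_zero)+
  have "poly_size (1 :: 'n mvpoly) = 1"
    using poly_size_eqI[of 0 "1 :: 'n mvpoly"] by simp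
  with g nz have "poly_size f * poly_size g = 1" by (metis poly_size_mult)
  then show "\<exists>c. c \<noteq> 0 \<and> f = Const c"
    using nz poly_size_eq_1 by (metis nat_mult_eq_1_iff)
qed (auto intro: Const_dvd_1)

lemma poly_size_nonunit:
  fixes f :: "'n::finite mvpoly"
  assumes "f \<noteq> 0" "\<not> f dvd 1"
  shows "1 < poly_size f"
  using assms poly_size_eq_1 poly_size_pos[of f] mvpoly_unit_iff
  by (metis One_nat_def Suc_lessI)

lemma irreducible_factor_exists:
  fixes f :: "'n::finite mvpoly"
  assumes "f \<noteq> 0" "\<not> f dvd 1"
  shows "\<exists>q. irreducible q \<and> q dvd f"
  using assms
proof (induction "poly_size f" arbitrary: f rule: less_induct)
  case less
  show ?case
  proof (cases "irreducible f")
    case False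
    then obtain g h where gh: "f = g * h" "\<not> g dvd 1" "\<not> h dvd 1"
      using less.prems by (auto simp: irreducible_def)
    then have nz: "g \<noteq> 0" "h \<noteq> 0" using less.prems by auto
    have "poly_size g < poly_size f"
      using gh nz poly_size_mult[OF nz] poly_size_nonunit[of h] poly_size_pos[of g] by simp
    then obtain q where "irreducible q" "q dvd g" using less.hyps nz gh by blast
    then show ?thesis using gh by auto
  qed auto
qed

subsection \<open>A distinguished variable\<close>

definition vars_in :: "'n set \<Rightarrow> 'n mvpoly \<Rightarrow> bool" where
  "vars_in V f \<longleftrightarrow> (\<forall>m\<in>keys f. \<forall>y. y \<notin> V \<longrightarrow> lookup m y = 0)"

text \<open>The strict bound covers the zero polynomial without a convention for its degree; bound 1
  means that \<open>x\<close> does not occur.\<close>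

definition deg_less :: "'n \<Rightarrow> nat \<Rightarrow> 'n mvpoly \<Rightarrow> bool" where
  "deg_less x k f \<longleftrightarrow> (\<forall>m\<in>keys f. lookup m x < k)"

lemma vars_in_0 [simp]: "vars_in V 0"
  and vars_in_Const [simp]: "vars_in V (Const c)"
  and vars_in_1 [simp]: "vars_in V 1"
  by (auto simp: vars_in_def Const_def)

lemma vars_in_UNIV [simp]: "vars_in UNIV f"
  by (simp add: vars_in_def)

lemma vars_in_mono: "vars_in V f \<Longrightarrow> V \<subseteq> W \<Longrightarrow> vars_in W f"
  by (auto simp: vars_in_def)

lemma vars_in_Var_power: "x \<in> V \<Longrightarrow> vars_in V (Var x ^ k)"
  by (auto simp: vars_in_def Var_power lookup_single when_def)

lemma vars_in_add: "vars_in V f \<Longrightarrow> vars_in V g \<Longrightarrow> vars_in V (f + g)"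
  using keys_add[of f g] by (fastforce simp: vars_in_def)

lemma vars_in_diff: "vars_in V f \<Longrightarrow> vars_in V g \<Longrightarrow> vars_in V (f - g)"
  using keys_minus_subset[of f g] by (fastforce simp: vars_in_def)

lemma vars_in_mult: "vars_in V f \<Longrightarrow> vars_in V g \<Longrightarrow> vars_in V (f * g)"
  using keys_mult[of f g] by (fastforce simp: vars_in_def lookup_add)

lemma vars_in_power: "vars_in V f \<Longrightarrow> vars_in V (f ^ k)"
  by (induction k) (auto intro: vars_in_mult)

lemmas vars_in_intros = vars_in_add vars_in_diff vars_in_mult vars_in_power

lemma deg_less_0 [simp]: "deg_less x k 0"
  by (auto simp: deg_less_def)

lemma deg_less_mono: "deg_less x k f \<Longrightarrow> k \<le> l \<Longrightarrow> deg_less x l f"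
  by (auto simp: deg_less_def)

lemma deg_less_add: "deg_less x k f \<Longrightarrow> deg_less x k g \<Longrightarrow> deg_less x k (f + g)"
  using keys_add[of f g] by (fastforce simp: deg_less_def)

lemma deg_less_diff: "deg_less x k f \<Longrightarrow> deg_less x k g \<Longrightarrow> deg_less x k (f - g)"
  using keys_minus_subset[of f g] by (fastforce simp: deg_less_def)

lemma deg_less_mult: "deg_less x k f \<Longrightarrow> deg_less x (Suc l) g \<Longrightarrow> deg_less x (k + l) (f * g)"
proof (unfold deg_less_def, intro ballI)
  fix m assume f: "\<forall>m\<in>keys f. lookup m x < k"
    and g: "\<forall>m\<in>keys g. lookup m x < Suc l"
    and "m \<in> keys (f * g)"
  then obtain a b where "a \<in> keys f" "b \<in> keys g" "m = a + b"
    using keys_mult by blast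
  with f g have "lookup a x < k" "lookup b x < Suc l" by auto
  with \<open>m = a + b\<close> show "lookup m x < k + l"
    by (simp add: lookup_add)
qed

lemma deg_less_Var_power: "deg_less x (Suc k) (Var x ^ k)"
  by (auto simp: deg_less_def Var_power)

lemma deg_less_zero_iff [simp]: "deg_less x 0 f \<longleftrightarrow> f = 0"
  by (auto simp: deg_less_def)

lemma vars_in_imp_deg_less: "vars_in V f \<Longrightarrow> x \<notin> V \<Longrightarrow> deg_less x 1 f"
  by (auto simp: vars_in_def deg_less_def)

lemma vars_in_Diff_iff: "vars_in (- {x}) f \<longleftrightarrow> deg_less x 1 f"
  by (auto simp: vars_in_def deg_less_def)

text \<open>The leading coefficient and the degree of \<open>f\<close> seen as a polynomial in
  \<open>x\<close> over the ring in the other variables.\<close>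

definition leading_term :: "'n \<Rightarrow> 'n mvpoly \<Rightarrow> 'n mvpoly \<Rightarrow> nat \<Rightarrow> bool" where
  "leading_term x f a k \<longleftrightarrow> deg_less x 1 a \<and> a \<noteq> 0 \<and> deg_less x k (f - a * Var x ^ k)"

lemma leading_term_exists:
  fixes f :: "'n::finite mvpoly"
  assumes "f \<noteq> 0"
  obtains a k where "leading_term x f a k" "\<And>V. vars_in (insert x V) f \<Longrightarrow> vars_in V a"
proof -
  define k where "k = Max ((\<lambda>m. lookup m x) ` keys f)"
  define T where "T = {m \<in> keys f. lookup m x = k}"
  define s where "s = single x k"
  \<comment> \<open>Dividing the monomials of maximal degree in \<open>x\<close> by
    \<open>x^k\<close> gives the coefficient; the truncated subtraction of exponents is exact on
    \<open>T\<close>, as \<open>ms\<close> confirms.\<close>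
  define a where "a = (\<Sum>m\<in>T. single (m - s) (lookup f m))"
  have le: "lookup m x \<le> k" if "m \<in> keys f" for m
    unfolding k_def using that by simp
  have "k \<in> (\<lambda>m. lookup m x) ` keys f"
    unfolding k_def using assms by (intro Max_in) auto
  then obtain m0 where m0: "m0 \<in> T" by (auto simp: T_def)
  have ms: "m - s + s = m" if "m \<in> T" for m
    by (rule poly_mapping_eqI)
      (use that in \<open>auto simp: T_def s_def lookup_add lookup_minus lookup_single when_def\<close>)
  have aX: "a * Var x ^ k = (\<Sum>m\<in>T. single m (lookup f m))"
    by (simp add: a_def Var_power s_def[symmetric] sum_distrib_right mult_single ms)
  have fin: "finite T" by (simp add: T_def)
  have lk: "lookup (a * Var x ^ k) m = (if m \<in> T then lookup f m else 0)" for m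
    by (simp add: aX lookup_sum lookup_single when_def fin sum.delta)
  have "a * Var x ^ k \<noteq> 0"
    using lk[of m0] m0 unfolding T_def in_keys_iff by (metis (mono_tags, lifting) lookup_zero mem_Collect_eq)
  then have a0: "a \<noteq> 0" by (metis mult_zero_left)
  have ka: "keys a \<subseteq> (\<lambda>m. m - s) ` T"
    unfolding a_def by (rule order.trans[OF keys_sum]) auto
  have free: "deg_less x 1 a"
    using ka by (auto simp: deg_less_def T_def s_def lookup_minus)
  have less: "deg_less x k (f - a * Var x ^ k)"
  proof (unfold deg_less_def, rule ballI)
    fix m assume "m \<in> keys (f - a * Var x ^ k)"
    then have "m \<in> keys f" "m \<notin> T"
      by (auto simp: in_keys_iff lookup_minus lk split: if_splits)
    then show "lookup m x < k"
      using le[of m] by (auto simp: T_def)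
  qed
  have "vars_in V a" if "vars_in (insert x V) f" for V
  proof (unfold vars_in_def, intro ballI allI impI)
    fix m y assume m: "m \<in> keys a" and y: "y \<notin> V"
    with ka obtain m' where m': "m' \<in> T" "m = m' - s" by auto
    show "lookup m y = 0"
    proof (cases "y = x")
      case True
      then show ?thesis using free m by (auto simp: deg_less_def)
    next
      case False
      then show ?thesis using that m' y by (auto simp: vars_in_def T_def lookup_minus)
    qed
  qed
  with a0 free less show thesis
    using that by (auto simp: leading_term_def)
qed

lemma not_deg_less_mult_Var_power:
  fixes a :: "'n::finite mvpoly"
  assumes "a \<noteq> 0"
  shows "\<not> deg_less x k (a * Var x ^ k)"
proof -
  obtain m where m: "m \<in> keys a" using assms by fastforce
  have "lookup (a * Var x ^ k) (m + single x k) = lookup a m * 1"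
    using lookup_mult_unique[OF m, of "single x k" "Var x ^ k"] by (simp add: Var_power)
  then have "m + single x k \<in> keys (a * Var x ^ k)"
    using m by (simp add: in_keys_iff)
  then show ?thesis
    by (force simp: deg_less_def lookup_add)
qed

lemma leading_term_deg:
  fixes f :: "'n::finite mvpoly"
  assumes "leading_term x f a k"
  shows "deg_less x (Suc k) f" "\<not> deg_less x k f"
proof -
  have eq: "f = a * Var x ^ k + (f - a * Var x ^ k)" by simp
  have "deg_less x (1 + k) (a * Var x ^ k)"
    using assms deg_less_Var_power by (intro deg_less_mult) (auto simp: leading_term_def)
  then show "deg_less x (Suc k) f"
    using assms by (subst eq, intro deg_less_add) (auto simp: leading_term_def elim: deg_less_mono)
  have eq2: "a * Var x ^ k = f - (f - a * Var x ^ k)" by simp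
  show "\<not> deg_less x k f"
    using assms not_deg_less_mult_Var_power[of a x k] eq2 deg_less_diff
    unfolding leading_term_def by metis
qed

lemma leading_term_unique:
  fixes f :: "'n::finite mvpoly"
  assumes "leading_term x f a k" "leading_term x f b l"
  shows "a = b \<and> k = l"
proof -
  have "k = l"
    using leading_term_deg[OF assms(1)] leading_term_deg[OF assms(2)]
    by (metis Suc_leI deg_less_mono linorder_neqE_nat)
  have "(a - b) * Var x ^ k = (f - b * Var x ^ k) - (f - a * Var x ^ k)"
    by (simp add: algebra_simps)
  then have "deg_less x k ((a - b) * Var x ^ k)"
    using assms \<open>k = l\<close> unfolding leading_term_def by (metis deg_less_diff)
  then have "a - b = 0" using not_deg_less_mult_Var_power by blast
  with \<open>k = l\<close> show ?thesis by simp
qed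

lemma leading_term_mult:
  fixes f g :: "'n::finite mvpoly"
  assumes "leading_term x f a k" "leading_term x g b l"
  shows "leading_term x (f * g) (a * b) (k + l)"
proof -
  have "f * g - a * b * Var x ^ (k + l) =
      (f - a * Var x ^ k) * g + (g - b * Var x ^ l) * (a * Var x ^ k)"
    by (simp add: algebra_simps power_add)
  moreover have "deg_less x (k + l) ((f - a * Var x ^ k) * g)"
    using assms leading_term_deg by (intro deg_less_mult) (auto simp: leading_term_def)
  moreover have "deg_less x (Suc k) (a * Var x ^ k)"
    using assms deg_less_mult[of x 1 a k "Var x ^ k"] deg_less_Var_power[of x k]
    by (auto simp: leading_term_def)
  then have "deg_less x (l + k) ((g - b * Var x ^ l) * (a * Var x ^ k))"
    using assms by (intro deg_less_mult) (auto simp: leading_term_def)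
  ultimately have "deg_less x (k + l) (f * g - a * b * Var x ^ (k + l))"
    by (simp add: deg_less_add add.commute)
  moreover have "deg_less x (1 + 0) (a * b)"
    using assms by (intro deg_less_mult) (auto simp: leading_term_def)
  ultimately show ?thesis
    using assms by (simp add: leading_term_def)
qed

lemma leading_term_free: "deg_less x 1 f \<Longrightarrow> f \<noteq> 0 \<Longrightarrow> leading_term x f f 0"
  by (simp add: leading_term_def)

text \<open>Leading terms multiply, so degrees in \<open>y\<close> add up, and a factor that
  contains \<open>y\<close> would make the product contain it.\<close>

lemma vars_in_factor:
  fixes g h :: "'n::finite mvpoly"
  assumes "vars_in V (g * h)" "g * h \<noteq> 0"
  shows "vars_in V g"
proof -
  have "deg_less y 1 g" if "y \<notin> V" for y
  proof -
    obtain a k where a: "leading_term y g a k" using leading_term_exists assms by (metis mult_zero_left)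
    obtain b l where b: "leading_term y h b l" using leading_term_exists assms by (metis mult_zero_right)
    have "\<not> deg_less y (k + l) (g * h)"
      using leading_term_deg(2)[OF leading_term_mult[OF a b]] .
    moreover have "deg_less y 1 (g * h)" using vars_in_imp_deg_less[OF assms(1) that] .
    ultimately have "k = 0" by (metis add_is_0 deg_less_mono less_one not_less)
    then show ?thesis using leading_term_deg(1)[OF a] by simp
  qed
  then show ?thesis by (auto simp: vars_in_def deg_less_def)
qed

lemma vars_in_factor':
  fixes g h :: "'n::finite mvpoly"
  assumes "vars_in V (g * h)" "g * h \<noteq> 0"
  shows "vars_in V h"
  using vars_in_factor[of V h g] assms by (simp add: mult.commute)

text \<open>Multiplication by the leading coefficient \<open>b\<close> replaces division by it: each
  round multiplies \<open>f\<close> by \<open>b\<close> and cancels the leading term, which avoids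
  fractions and keeps everything in the variables \<open>V\<close>.\<close>

lemma pseudo_division:
  fixes f d :: "'n::finite mvpoly"
  assumes d: "leading_term x d b k" and V: "x \<in> V" "vars_in V d" "vars_in V f" "vars_in V b"
  shows "\<exists>e s. vars_in V s \<and> deg_less x k (b ^ e * f - d * s)"
proof -
  have "\<exists>e s. vars_in V s \<and> deg_less x k (b ^ e * f - d * s)"
    if "deg_less x n f" "vars_in V f" for n f
    using that
  proof (induction n arbitrary: f rule: less_induct)
    case (less n)
    show ?case
    proof (cases "deg_less x k f")
      case True
      then show ?thesis by (intro exI[of _ 0]) (auto intro!: exI[of _ 0])
    next
      case False
      then have "f \<noteq> 0" by auto
      then obtain a l where a: "leading_term x f a l" "\<And>V. vars_in (insert x V) f \<Longrightarrow> vars_in V a"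
        by (metis leading_term_exists)
      have aV: "vars_in V a" using a(2)[of V] V less.prems by (simp add: insert_absorb)
      have "k \<le> l"
        using False leading_term_deg(1)[OF a(1)] by (metis Suc_leI deg_less_mono not_less)
      have "l < n"
        using less.prems leading_term_deg(2)[OF a(1)] by (metis deg_less_mono not_less)
      define f' where "f' = b * f - a * Var x ^ (l - k) * d"
      have Xl: "Var x ^ l = Var x ^ (l - k) * Var x ^ k"
        using \<open>k \<le> l\<close> by (simp add: power_add[symmetric])
      have "f' = (f - a * Var x ^ l) * b - (d - b * Var x ^ k) * (a * Var x ^ (l - k))"
        by (simp add: f'_def Xl algebra_simps)
      moreover have "deg_less x (l + 0) ((f - a * Var x ^ l) * b)"
        using a d by (intro deg_less_mult) (auto simp: leading_term_def)
      moreover have "deg_less x (1 + (l - k)) (a * Var x ^ (l - k))"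
        using a deg_less_Var_power by (intro deg_less_mult) (auto simp: leading_term_def)
      then have "deg_less x (k + (l - k)) ((d - b * Var x ^ k) * (a * Var x ^ (l - k)))"
        using d by (intro deg_less_mult) (auto simp: leading_term_def)
      ultimately have "deg_less x l f'"
        using \<open>k \<le> l\<close> by (simp add: deg_less_diff)
      moreover have "vars_in V f'"
        unfolding f'_def using V less.prems aV by (intro vars_in_intros vars_in_Var_power)
      ultimately obtain e s where s: "vars_in V s" "deg_less x k (b ^ e * f' - d * s)"
        using less.IH[OF \<open>l < n\<close>] by blast
      have "b ^ e * f' - d * s = b ^ Suc e * f - d * (s + b ^ e * (a * Var x ^ (l - k)))"
        by (simp add: f'_def algebra_simps)
      moreover have "vars_in V (s + b ^ e * (a * Var x ^ (l - k)))"
        using s V aV by (intro vars_in_intros vars_in_Var_power)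
      ultimately show ?thesis using s by metis
    qed
  qed
  moreover have "\<exists>n. deg_less x n f"
  proof (cases "f = 0")
    case False
    then show ?thesis using leading_term_exists[of f x] leading_term_deg(1) by metis
  qed auto
  ultimately show ?thesis using V by blast
qed

subsection \<open>Irreducible polynomials are prime\<close>

text \<open>The induction hypothesis, \<open>prime_in V p\<close>, keeps the elements within the polynomials in
  the variables \<open>V\<close>, whereas divisibility may be taken in the whole ring by \<open>vars_in_factor\<close>.\<close>

definition prime_in :: "'n set \<Rightarrow> 'n mvpoly \<Rightarrow> bool" where
  "prime_in V p \<longleftrightarrow> (\<forall>f g. vars_in V f \<longrightarrow> vars_in V g \<longrightarrow> p dvd f * g \<longrightarrow> p dvd f \<or> p dvd g)"

text \<open>Gauss's lemma. Degrees in \<open>x\<close> being additive, \<open>p\<close> divides the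
  product of the leading coefficients, hence one of them by hypothesis. Removing that leading term
  lowers one of the degree bounds \<open>i\<close>, \<open>j\<close>, whose sum is the induction
  measure.\<close>

lemma Gauss_prime_in_insert:
  fixes p :: "'n::finite mvpoly"
  assumes x: "x \<notin> V" and p: "prime_in V p" "vars_in V p" "p \<noteq> 0"
  shows "prime_in (insert x V) p"
proof -
  have "p dvd f \<or> p dvd g"
    if "vars_in (insert x V) f" "vars_in (insert x V) g" "p dvd f * g"
      "deg_less x i f" "deg_less x j g" "i + j = n" for f g i j n
    using that
  proof (induction n arbitrary: f g i j rule: less_induct)
    case (less n)
    show ?case
    proof (cases "f = 0 \<or> g = 0")
      case False
      then obtain a k where a: "leading_term x f a k" "vars_in V a"
        by (metis leading_term_exists less.prems(1))
      obtain b l where b: "leading_term x g b l" "vars_in V b"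
        using False by (metis leading_term_exists less.prems(2))
      obtain h where h: "f * g = p * h" using less.prems by (auto elim: dvdE)
      have "h \<noteq> 0" using h False by (metis mult_zero_right mvpoly_mult_eq_0_iff)
      then obtain c m where c: "leading_term x h c m" by (metis leading_term_exists)
      have "leading_term x p p 0"
        using p x vars_in_imp_deg_less by (metis leading_term_free)
      from leading_term_mult[OF this c] leading_term_mult[OF a(1) b(1)] h
      have "a * b = p * c" using leading_term_unique by metis
      then have "p dvd a \<or> p dvd b"
        using p a b by (metis dvd_triv_left prime_in_def)
      moreover have ki: "k < i" "l < j"
        using less.prems leading_term_deg(2)[OF a(1)] leading_term_deg(2)[OF b(1)]
        by (metis deg_less_mono not_less)+
      moreover have ?thesis if "p dvd a"
      proof -
        have "(f - a * Var x ^ k) * g = p * h - a * (Var x ^ k * g)"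
          by (simp add: left_diff_distrib h mult.assoc)
        then have "p dvd (f - a * Var x ^ k) * g"
          using that by (metis dvd_diff dvd_mult2 dvd_triv_left)
        moreover have "vars_in (insert x V) (f - a * Var x ^ k)"
          using less.prems a by (intro vars_in_intros vars_in_Var_power) (auto elim: vars_in_mono)
        ultimately have "p dvd (f - a * Var x ^ k) \<or> p dvd g"
          using less.IH[of "k + j" "f - a * Var x ^ k" g k j] less.prems ki a by (auto simp: leading_term_def)
        moreover have "f = (f - a * Var x ^ k) + a * Var x ^ k" by simp
        ultimately show ?thesis using that by (metis dvd_add dvd_mult2)
      qed
      moreover have ?thesis if "p dvd b"
      proof -
        have "f * (g - b * Var x ^ l) = p * h - b * (Var x ^ l * f)"
          by (simp add: right_diff_distrib h ac_simps)
        then have "p dvd f * (g - b * Var x ^ l)"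
          using that by (metis dvd_diff dvd_mult2 dvd_triv_left)
        moreover have "vars_in (insert x V) (g - b * Var x ^ l)"
          using less.prems b by (intro vars_in_intros vars_in_Var_power) (auto elim: vars_in_mono)
        ultimately have "p dvd f \<or> p dvd (g - b * Var x ^ l)"
          using less.IH[of "i + l" f "g - b * Var x ^ l" i l] less.prems ki b by (auto simp: leading_term_def)
        moreover have "g = (g - b * Var x ^ l) + b * Var x ^ l" by simp
        ultimately show ?thesis using that by (metis dvd_add dvd_mult2)
      qed
      ultimately show ?thesis by blast
    qed auto
  qed
  moreover have "\<exists>n. deg_less x n f" for f :: "'n mvpoly"
  proof (cases "f = 0")
    case False
    then show ?thesis using leading_term_exists[of f x] leading_term_deg(1) by metis
  qed auto
  ultimately show ?thesis unfolding prime_in_def by metis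
qed

lemma distribute_factor:
  fixes b :: "'n::finite mvpoly"
  assumes prime: "\<And>p. irreducible p \<Longrightarrow> vars_in V p \<Longrightarrow> prime_in W p"
    and "vars_in V b" "b \<noteq> 0" "vars_in W d" "vars_in W s" "b * f = d * s"
  shows "\<exists>b1 b2 d' s'. b = b1 * b2 \<and> d = b1 * d' \<and> s = b2 * s' \<and> f = d' * s'"
  using assms(2-)
proof (induction "poly_size b" arbitrary: b d s rule: less_induct)
  case less
  show ?case
  proof (cases "b dvd 1")
    case True
    then obtain c where c: "1 = b * c" by (auto elim: dvdE)
    have "f = c * (b * f)" using c by (metis mult.assoc mult.commute mult_1)
    then have "f = (c * d) * s" using less.prems by (simp add: mult.assoc)
    moreover have "d = b * (c * d)" using c by (metis mult.assoc mult_1)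
    ultimately show ?thesis
      by (intro exI[of _ b] exI[of _ 1] exI[of _ "c * d"] exI[of _ s]) auto
  next
    case False
    then obtain p where p: "irreducible p" "p dvd b"
      using irreducible_factor_exists less.prems by blast
    then obtain b0 where b0: "b = p * b0" by (auto elim: dvdE)
    have nz: "p \<noteq> 0" "b0 \<noteq> 0" using b0 less.prems by auto
    have V: "vars_in V p" "vars_in V b0"
      using vars_in_factor[of V p b0] vars_in_factor'[of V p b0] b0 less.prems by auto
    have size: "poly_size b0 < poly_size b"
      using b0 nz poly_size_mult[of p b0] poly_size_nonunit[of p] poly_size_pos[of b0] p
      by (auto simp: irreducible_def)
    have "p dvd d * s"
      using less.prems b0 by (metis dvd_triv_left mult.assoc)
    then have "p dvd d \<or> p dvd s"
      using prime[OF p(1) V(1)] less.prems by (auto simp: prime_in_def)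
    then show ?thesis
    proof
      assume "p dvd d"
      then obtain d0 where d0: "d = p * d0" by (auto elim: dvdE)
      have "p * (b0 * f) = p * (d0 * s)"
        using less.prems(5) unfolding b0 d0 by (simp add: mult.assoc)
      then have eq: "b0 * f = d0 * s" using nz mvpoly_mult_left_cancel by blast
      have "vars_in W d0"
        using vars_in_factor'[of W p d0] less.prems d0 by (cases "d = 0") (use nz in auto)
      then obtain b1 b2 d' s' where "b0 = b1 * b2" "d0 = b1 * d'" "s = b2 * s'" "f = d' * s'"
        using less.hyps[OF size V(2) nz(2) _ _ eq] less.prems by blast
      then show ?thesis
        by (intro exI[of _ "p * b1"] exI[of _ b2] exI[of _ d'] exI[of _ s']) (auto simp: b0 d0 mult.assoc)
    next
      assume "p dvd s"
      then obtain s0 where s0: "s = p * s0" by (auto elim: dvdE)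
      have "p * (b0 * f) = p * (d * s0)"
        using less.prems(5) unfolding b0 s0 by (simp add: mult.assoc mult.left_commute)
      then have eq: "b0 * f = d * s0" using nz mvpoly_mult_left_cancel by blast
      have "vars_in W s0"
        using vars_in_factor'[of W p s0] less.prems s0 by (cases "s = 0") (use nz in auto)
      then obtain b1 b2 d' s' where "b0 = b1 * b2" "d = b1 * d'" "s0 = b2 * s'" "f = d' * s'"
        using less.hyps[OF size V(2) nz(2) _ _ eq] less.prems by blast
      then show ?thesis
        by (intro exI[of _ b1] exI[of _ "p * b2"] exI[of _ d'] exI[of _ s'])
          (auto simp: b0 s0 mult.assoc mult.left_commute)
    qed
  qed
qed

lemma dvd_unit_cancel:
  fixes q u :: "'a::comm_semiring_1"
  assumes "u dvd 1" "q = u * d"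
  shows "q dvd d * s"
proof -
  obtain v where "1 = u * v" using assms by (auto elim: dvdE)
  then have "d * s = q * (v * s)"
    using assms by (metis mult.assoc mult.commute mult_1)
  then show ?thesis by simp
qed

text \<open>After distributing \<open>b\<close>, the part \<open>b1\<close> divides \<open>q\<close>
  and lies in \<open>V\<close>. As \<open>q\<close> is irreducible and uses a variable outside
  \<open>V\<close>, the cofactor \<open>d'\<close> is no unit, so \<open>b1\<close> is one, and
  \<open>q\<close> is associated to the factor \<open>d'\<close> of \<open>f\<close>.\<close>

lemma irreducible_dvd_cancel:
  fixes b :: "'n::finite mvpoly"
  assumes prime: "\<And>p. irreducible p \<Longrightarrow> vars_in V p \<Longrightarrow> prime_in W p"
    and "vars_in V b" "b \<noteq> 0" "vars_in W q" "vars_in W s" "b * f = q * s"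
    and q: "irreducible q" "\<not> vars_in V q"
  shows "q dvd f"
proof -
  obtain b1 b2 d' s' where *: "b = b1 * b2" "q = b1 * d'" "s = b2 * s'" "f = d' * s'"
    using distribute_factor[OF prime assms(2-6)] by blast
  from q * have "b1 dvd 1 \<or> d' dvd 1" by (auto simp: irreducible_def)
  moreover have "\<not> d' dvd 1"
  proof
    assume "d' dvd 1"
    then obtain c where "d' = Const c" by (auto simp: mvpoly_unit_iff)
    moreover have "vars_in V b1" using * assms vars_in_factor by blast
    ultimately have "vars_in V q" using * by (auto intro: vars_in_mult)
    with q show False by blast
  qed
  ultimately show ?thesis
    using * dvd_unit_cancel by metis
qed

text \<open>A Euclidean argument without fractions. In the ideal of \<open>q\<close> and
  \<open>g\<close>, an element \<open>d\<close> of minimal degree in \<open>x\<close> divides both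
  generators up to powers of its leading coefficient. By irreducibility \<open>d\<close> is, up to
  factors from \<open>V\<close>, either \<open>q\<close> or a unit; the two cases give
  \<open>q dvd g\<close> and \<open>q dvd h\<close>.\<close>

lemma irreducible_prime_in_insert:
  fixes q :: "'n::finite mvpoly"
  assumes x: "x \<notin> V" and IH: "\<And>p. irreducible p \<Longrightarrow> vars_in V p \<Longrightarrow> prime_in V p"
    and q: "irreducible q" "vars_in (insert x V) q"
  shows "prime_in (insert x V) q"
proof (cases "vars_in V q")
  case True
  then show ?thesis
    using Gauss_prime_in_insert[OF x IH[OF q(1)]] q by (auto simp: irreducible_def)
next
  case False
  let ?W = "insert x V"
  have prime: "prime_in ?W p" if "irreducible p" "vars_in V p" for p
    using Gauss_prime_in_insert[OF x IH] that by (auto simp: irreducible_def)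
  have qfactor: "q dvd f" if "vars_in V b" "b \<noteq> 0" "vars_in ?W s" "b * f = q * s" for b s f
    using irreducible_dvd_cancel[OF prime that(1,2) q(2) that(3,4) q(1) False] by simp
  show ?thesis
    unfolding prime_in_def
  proof (intro allI impI)
    fix g h assume g: "vars_in ?W g" and h: "vars_in ?W h" and dvd: "q dvd g * h"
    define I where "I = {\<alpha> * q + \<beta> * g | \<alpha> \<beta>. vars_in ?W \<alpha> \<and> vars_in ?W \<beta>}"
    have qI: "q \<in> I" unfolding I_def by (rule CollectI, rule exI[of _ 1], rule exI[of _ 0]) simp
    have gI: "g \<in> I" unfolding I_def by (rule CollectI, rule exI[of _ 0], rule exI[of _ 1]) simp
    have q0: "q \<noteq> 0" using q by (auto simp: irreducible_def)
    \<comment> \<open>Minimality of the degree in \<open>x\<close> forces every pseudo-remainder of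
      an ideal element by \<open>d\<close> to be zero, since it lies in the ideal again.\<close>
    define P where "P = (\<lambda>k. \<exists>d b. d \<in> I \<and> leading_term x d b k)"
    have "\<exists>k. P k"
      using qI q0 leading_term_exists[of q x] unfolding P_def by metis
    then obtain k where k: "P k" "\<And>l. P l \<Longrightarrow> k \<le> l"
      using exists_least_iff[of P] by (metis not_less)
    then obtain d b0 where d: "d \<in> I" "leading_term x d b0 k" unfolding P_def by blast
    have dW: "vars_in ?W d"
      using d g q unfolding I_def by (auto intro: vars_in_intros)
    have d0: "d \<noteq> 0" using d leading_term_deg(2) by fastforce
    obtain b k' where b: "leading_term x d b k'" "vars_in V b"
      using leading_term_exists[OF d0] dW by metis
    then have bk: "leading_term x d b k" using d leading_term_unique by metis
    have divide: "\<exists>e s. vars_in ?W s \<and> b ^ e * f = d * s" if f: "f \<in> I" for f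
    proof -
      have fW: "vars_in ?W f" using f g q unfolding I_def by (auto intro: vars_in_intros)
      have bW: "vars_in ?W b" using b(2) by (auto elim: vars_in_mono)
      obtain e s where s: "vars_in ?W s" "deg_less x k (b ^ e * f - d * s)"
        using pseudo_division[OF bk _ dW fW bW] by blast
      obtain \<alpha> \<beta> \<alpha>' \<beta>' where ab: "f = \<alpha> * q + \<beta> * g" "d = \<alpha>' * q + \<beta>' * g"
        "vars_in ?W \<alpha>" "vars_in ?W \<beta>" "vars_in ?W \<alpha>'" "vars_in ?W \<beta>'"
        using f d(1) unfolding I_def by blast
      have "b ^ e * f - d * s = (b ^ e * \<alpha> - \<alpha>' * s) * q + (b ^ e * \<beta> - \<beta>' * s) * g"
        by (simp add: ab(1,2) algebra_simps)
      moreover have "vars_in ?W (b ^ e * \<alpha> - \<alpha>' * s)" "vars_in ?W (b ^ e * \<beta> - \<beta>' * s)"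
        using ab s bW by (auto intro: vars_in_intros)
      ultimately have rI: "b ^ e * f - d * s \<in> I" unfolding I_def by blast
      have "b ^ e * f - d * s = 0"
      proof (rule ccontr)
        assume nz: "b ^ e * f - d * s \<noteq> 0"
        then obtain c l where c: "leading_term x (b ^ e * f - d * s) c l"
          by (metis leading_term_exists)
        then have "k \<le> l" using rI k(2) unfolding P_def by blast
        then show False using leading_term_deg(2)[OF c] deg_less_mono[OF s(2)] by simp
      qed
      then show ?thesis using s by auto
    qed
    have b0: "b ^ e \<noteq> 0" "vars_in V (b ^ e)" for e
      using b by (auto simp: leading_term_def intro: vars_in_power)
    obtain e s where e: "vars_in ?W s" "b ^ e * q = d * s" using divide[OF qI] by blast
    obtain e' s2 where e': "vars_in ?W s2" "b ^ e' * g = d * s2" using divide[OF gI] by blast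
    obtain b1 b2 d' s' where *: "b ^ e = b1 * b2" "d = b1 * d'" "s = b2 * s'" "q = d' * s'"
      using distribute_factor[OF prime b0(2,1) dW e] by blast
    have b1: "vars_in V b1" "b1 \<noteq> 0"
      using *(1) b0[of e] vars_in_factor[of V b1 b2] by auto
    from q * have "d' dvd 1 \<or> s' dvd 1" by (auto simp: irreducible_def)
    then show "q dvd g \<or> q dvd h"
    proof
      \<comment> \<open>Here \<open>d\<close> is \<open>q\<close> up to a unit and the factor
        \<open>b1\<close> in \<open>V\<close>, so \<open>q\<close> divides \<open>g\<close> times a
        power of \<open>b\<close>.\<close>
      assume "s' dvd 1"
      then obtain u where u: "1 = s' * u" by (auto elim: dvdE)
      then have "d' = q * u" using * by (metis mult.assoc mult.right_neutral)
      then have "b ^ e' * g = q * (u * b1 * s2)"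
        using e' * by (simp add: algebra_simps)
      moreover have "vars_in ?W (u * b1 * s2)"
      proof -
        have "u dvd 1" using u by (metis dvd_triv_right)
        then have "vars_in ?W u" by (auto simp: mvpoly_unit_iff)
        then show ?thesis using b1 e' by (auto intro!: vars_in_mult elim: vars_in_mono)
      qed
      ultimately have "q dvd g" using qfactor[OF b0(2,1)] by blast
      then show ?thesis ..
    next
      \<comment> \<open>Here \<open>d\<close> lies in \<open>V\<close>. It is a Bezout combination
        of \<open>q\<close> and \<open>g\<close>, and its product with \<open>h\<close> is a
        multiple of \<open>q\<close>.\<close>
      assume "d' dvd 1"
      then obtain c where c: "d' = Const c" "c \<noteq> 0" by (auto simp: mvpoly_unit_iff)
      have dV: "vars_in V d" using * c b1 by (auto intro: vars_in_mult)
      obtain \<alpha> \<beta> where ab: "d = \<alpha> * q + \<beta> * g" "vars_in ?W \<alpha>" "vars_in ?W \<beta>"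
        using d unfolding I_def by blast
      obtain w where w: "g * h = q * w" using dvd by (auto elim: dvdE)
      have "d * h = q * (\<alpha> * h + \<beta> * w)"
      proof -
        have "d * h = \<alpha> * q * h + \<beta> * (g * h)" by (simp add: ab(1) algebra_simps)
        also have "\<dots> = q * (\<alpha> * h + \<beta> * w)" by (simp add: w algebra_simps)
        finally show ?thesis .
      qed
      moreover have "vars_in ?W w"
      proof (cases "w = 0")
        case False
        then have "q * w \<noteq> 0" using q0 by simp
        moreover have "vars_in ?W (q * w)" using g h w vars_in_mult by metis
        ultimately show ?thesis using vars_in_factor' by blast
      qed simp
      then have "vars_in ?W (\<alpha> * h + \<beta> * w)" using ab h by (auto intro: vars_in_intros)
      ultimately have "q dvd h" using qfactor[OF dV d0] by blast
      then show ?thesis ..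
    qed
  qed
qed

theorem irreducible_imp_prime_elem_mvpoly:
  fixes q :: "'n::finite mvpoly"
  assumes "irreducible q"
  shows "prime_elem q"
proof -
  have "finite (V :: 'n set) \<Longrightarrow> irreducible q \<Longrightarrow> vars_in V q \<Longrightarrow> prime_in V q" for V and q :: "'n mvpoly"
  proof (induction V arbitrary: q rule: finite_induct)
    \<comment> \<open>Without variables there are only constants, none of which is
      irreducible.\<close>
    case empty
    have "keys q \<subseteq> {0}"
      using empty by (auto simp: vars_in_def intro: poly_mapping_eqI)
    then have "q = Const (lookup q 0)" by (rule eq_Const_if_keys)
    then have "q = 0 \<or> q dvd 1" by (metis Const_0 Const_dvd_1)
    with empty show ?case by (auto simp: irreducible_def)
  next
    case (insert x V)
    then show ?case using irreducible_prime_in_insert by blast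
  qed
  from this[of UNIV q] assms show ?thesis
    by (auto simp: prime_in_def prime_elem_def irreducible_def)
qed


section \<open>Factorization into irreducibles and existence of the radical\<close>

lemma irreducible_dvd_imp_associated:
  fixes q q' :: "'n::finite mvpoly"
  assumes "irreducible q" "irreducible q'" "q dvd q' \<or> q' dvd q"
  obtains u where "u \<noteq> 0" "q = Const u * q'"
  using assms(3)
proof
  assume "q dvd q'"
  then obtain w where w: "q' = q * w" by (auto elim: dvdE)
  then have "w dvd 1" using assms by (auto simp: irreducible_def)
  then obtain c where c: "c \<noteq> 0" "w = Const c" by (auto simp: mvpoly_unit_iff)
  have "Const (inverse c) * q' = (Const (inverse c) * Const c) * q"
    by (simp only: w c mult.commute mult.left_commute)
  then have "q = Const (inverse c) * q'" using c by simp
  then show thesis using that c by (metis inverse_zero_imp_zero)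
next
  assume "q' dvd q"
  then obtain w where w: "q = q' * w" by (auto elim: dvdE)
  then have "w dvd 1" using assms by (auto simp: irreducible_def)
  then obtain c where "c \<noteq> 0" "w = Const c" by (auto simp: mvpoly_unit_iff)
  then show thesis using that w by (simp add: mult.commute)
qed

text \<open>A new factor \<open>q\<close> associated to some \<open>q'\<close> in \<open>Q\<close>
  raises the exponent of \<open>q'\<close> and contributes a constant to \<open>a\<close>; otherwise
  it joins \<open>Q\<close>. So distinct members of \<open>Q\<close> never divide each
  other.\<close>

lemma is_radical_exists:
  fixes f :: "'n::finite mvpoly"
  assumes "f \<noteq> 0"
  shows "\<exists>r. is_radical f r"
proof -
  have "\<exists>a Q m.
     a \<noteq> 0 \<and> finite Q \<and> (\<forall>q\<in>Q. irreducible q \<and> 0 < (m q :: nat)) \<and>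
     (\<forall>q\<in>Q. \<forall>q'\<in>Q. q \<noteq> q' \<longrightarrow> \<not> q dvd q') \<and>
     f = Const a * (\<Prod>q\<in>Q. q ^ m q)"
    using assms
  proof (induction "poly_size f" arbitrary: f rule: less_induct)
    case less
    show ?case
    proof (cases "f dvd 1")
      case True
      then obtain c where "c \<noteq> 0" "f = Const c" by (auto simp: mvpoly_unit_iff)
      then show ?thesis by (intro exI[of _ c] exI[of _ "{}"]) auto
    next
      case False
      then obtain q where q: "irreducible q" "q dvd f"
        using irreducible_factor_exists less.prems by blast
      then obtain g where g: "f = q * g" by (auto elim: dvdE)
      have nz: "q \<noteq> 0" "g \<noteq> 0" using g less.prems by auto
      have "poly_size g < poly_size f"
        using g nz poly_size_mult[of q g] poly_size_nonunit[of q] poly_size_pos[of g] q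
        by (auto simp: irreducible_def)
      then obtain a Q m where
        *: "a \<noteq> 0" "finite Q" "\<forall>q\<in>Q. irreducible q \<and> 0 < (m q :: nat)"
          "\<forall>q\<in>Q. \<forall>q'\<in>Q. q \<noteq> q' \<longrightarrow> \<not> q dvd q'" "g = Const a * (\<Prod>q\<in>Q. q ^ m q)"
        using less.hyps[OF _ nz(2)] by metis
      show ?thesis
      proof (cases "\<exists>q'\<in>Q. q dvd q' \<or> q' dvd q")
        case True
        then obtain q' where q': "q' \<in> Q" "q dvd q' \<or> q' dvd q" by blast
        then have "irreducible q'" using *(3) by blast
        then obtain u where u: "u \<noteq> 0" "q = Const u * q'"
          by (rule irreducible_dvd_imp_associated[OF q(1) _ q'(2)])
        define m' where "m' = m(q' := Suc (m q'))"
        have "(\<Prod>q\<in>Q. q ^ m' q) = q' * (\<Prod>q\<in>Q. q ^ m q)"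
        proof -
          have "(\<Prod>q\<in>Q - {q'}. q ^ m' q) = (\<Prod>q\<in>Q - {q'}. q ^ m q)"
            by (intro prod.cong) (auto simp: m'_def)
          then show ?thesis
            using *(2) q'(1) by (simp add: prod.remove[of Q q'] m'_def mult.assoc)
        qed
        then have "f = Const (u * a) * (\<Prod>q\<in>Q. q ^ m' q)"
          by (simp add: g u(2) *(5) Const_mult algebra_simps)
        then show ?thesis
          using * u by (intro exI[of _ "u * a"] exI[of _ Q] exI[of _ m']) (auto simp: m'_def)
      next
        case False
        then have qQ: "q \<notin> Q" by auto
        define m' where "m' = m(q := 1)"
        have "(\<Prod>q\<in>Q. q ^ m' q) = (\<Prod>q\<in>Q. q ^ m q)"
          using qQ by (intro prod.cong) (auto simp: m'_def)
        then have "f = Const a * (\<Prod>q\<in>insert q Q. q ^ m' q)"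
          using *(2) qQ by (simp add: g *(5) m'_def algebra_simps)
        then show ?thesis
          using * q False
          by (intro exI[of _ a] exI[of _ "insert q Q"] exI[of _ m']) (auto simp: m'_def)
      qed
    qed
  qed
  then show ?thesis unfolding is_radical_def by blast
qed

lemma is_radical_rad: "f \<noteq> 0 \<Longrightarrow> is_radical f (rad f)" for f :: "'n::finite mvpoly"
  unfolding rad_def using is_radical_exists by (rule someI_ex)

subsection \<open>Evaluation\<close>

definition mono_eval :: "('n::finite \<Rightarrow>\<^sub>0 nat) \<Rightarrow> real ^ 'n \<Rightarrow> real" where
  "mono_eval m p = (\<Prod>i\<in>UNIV. (p $ i) ^ lookup m i)"

lemma mono_eval_add: "mono_eval (a + b) p = mono_eval a p * mono_eval b p"
  by (simp add: mono_eval_def lookup_add power_add prod.distrib)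

lemma mono_eval_0 [simp]: "mono_eval 0 p = 1"
  by (simp add: mono_eval_def)

lemma mveval_superset:
  assumes "finite A" "keys f \<subseteq> A"
  shows "mveval f p = (\<Sum>m\<in>A. lookup f m * mono_eval m p)"
  unfolding mveval_def mono_eval_def
  by (rule sum.mono_neutral_left) (use assms in \<open>auto simp: in_keys_iff\<close>)

lemma mveval_0 [simp]: "mveval 0 p = 0"
  by (simp add: mveval_def)

lemma mveval_single: "mveval (single m c) p = c * mono_eval m p"
  by (simp add: mveval_def mono_eval_def)

lemma mveval_add [simp]: "mveval (f + g) p = mveval f p + mveval g p"
proof -
  let ?A = "keys f \<union> keys g"
  have "mveval h p = (\<Sum>m\<in>?A. lookup h m * mono_eval m p)"
    if "h \<in> {f, g, f + g}" for h
    by (rule mveval_superset) (use that keys_add[of f g] in auto)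
  then show ?thesis by (simp add: lookup_add algebra_simps sum.distrib)
qed

lemma mveval_sum [simp]: "mveval (\<Sum>i\<in>I. f i) p = (\<Sum>i\<in>I. mveval (f i) p)"
  by (induction I rule: infinite_finite_induct) auto

lemma mveval_mult [simp]: "mveval (f * g) p = mveval f p * mveval g p"
proof -
  have "mveval (f * g) p = (\<Sum>a\<in>keys f. \<Sum>b\<in>keys g.
      (lookup f a * mono_eval a p) * (lookup g b * mono_eval b p))"
    by (subst mult_eq_sum_single) (simp add: mveval_single mono_eval_add algebra_simps)
  also have "\<dots> = mveval f p * mveval g p"
    by (simp add: sum_product mveval_def mono_eval_def)
  finally show ?thesis .
qed

lemma mveval_Const [simp]: "mveval (Const c) p = c"
  by (simp add: Const_def mveval_single)

lemma mveval_1 [simp]: "mveval 1 p = 1"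
  using mveval_Const[of 1 p] by simp

lemma mveval_diff [simp]: "mveval (f - g) p = mveval f p - mveval g p"
  using mveval_add[of "f - g" g p] by simp

lemma mveval_Var [simp]: "mveval (Var i) p = p $ i"
proof -
  have "mono_eval (single i 1) p = (\<Prod>j\<in>UNIV. if j = i then p $ i else 1)"
    unfolding mono_eval_def by (intro prod.cong) (auto simp: lookup_single when_def)
  then show ?thesis by (simp add: Var_def mveval_single)
qed

lemma mveval_power [simp]: "mveval (f ^ k) p = mveval f p ^ k"
  by (induction k) auto

lemma mveval_prod [simp]: "mveval (\<Prod>i\<in>I. f i) p = (\<Prod>i\<in>I. mveval (f i) p)"
  by (induction I rule: infinite_finite_induct) auto

text \<open>At the point whose coordinates are the k-th powers of the primes of the variables, a
  monomial \<open>m\<close> takes the value \<open>mono_code m ^ k\<close>. For large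
  \<open>k\<close> the leading monomial dominates, so its coefficient would have to be 0.\<close>

lemma mveval_inject_0:
  fixes f :: "'n::finite mvpoly"
  assumes "\<And>p. mveval f p = 0"
  shows "f = 0"
proof (rule ccontr)
  assume "f \<noteq> 0"
  then obtain a where a: "a \<in> keys f"
    "\<And>b. b \<in> keys f \<Longrightarrow> mono_code b \<le> mono_code a"
    using poly_size_leading by metis
  define P where "P = (\<lambda>k::nat. (\<chi> i::'n. real (var_prime i) ^ k))"
  have mono: "mono_eval m (P k) = real (mono_code m) ^ k" for m k
    by (simp add: mono_eval_def P_def mono_code_def prod_power_distrib power_mult[symmetric] mult.commute)
  have "(\<lambda>k. \<Sum>m\<in>keys f. lookup f m * (real (mono_code m) / real (mono_code a)) ^ k)
      \<longlonglongrightarrow> (\<Sum>m\<in>keys f. lookup f m * (if m = a then 1 else 0))"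
  proof (intro tendsto_sum tendsto_mult tendsto_const)
    fix m assume m: "m \<in> keys f"
    show "(\<lambda>k. (real (mono_code m) / real (mono_code a)) ^ k) \<longlonglongrightarrow> (if m = a then 1 else 0)"
    proof (cases "m = a")
      case False
      then have "mono_code m < mono_code a"
        using a(2)[OF m] inj_mono_code[of m a] by simp
      then show ?thesis
        using False by (auto intro!: LIMSEQ_realpow_zero)
    qed (use mono_code_pos[of a] in auto)
  qed
  moreover have "(\<Sum>m\<in>keys f. lookup f m * (real (mono_code m) / real (mono_code a)) ^ k) = 0" for k
  proof -
    have "(\<Sum>m\<in>keys f. lookup f m * (real (mono_code m) / real (mono_code a)) ^ k)
      = mveval f (P k) / real (mono_code a) ^ k"
      by (subst mveval_superset[OF _ order_refl])
        (auto simp: mono sum_divide_distrib power_divide)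
    then show ?thesis using assms by simp
  qed
  ultimately have "(\<lambda>k::nat. 0) \<longlonglongrightarrow> lookup f a"
    using a(1) by (simp add: if_distrib sum.delta cong: if_cong)
  then have "lookup f a = 0" by (simp add: LIMSEQ_const_iff)
  with a(1) show False by (simp add: in_keys_iff)
qed

definition line_poly :: "real ^ 'n \<Rightarrow> real ^ 'n \<Rightarrow> 'n::finite mvpoly \<Rightarrow> real poly" where
  "line_poly p v f = (\<Sum>m\<in>keys f.
     smult (lookup f m) (\<Prod>i\<in>UNIV. [:p $ i, v $ i:] ^ lookup m i))"

lemma poly_line_poly [simp]: "poly (line_poly p v f) t = mveval f (p + t *\<^sub>R v)"
  by (simp add: line_poly_def mveval_def poly_sum poly_prod poly_power mult.commute)

lemma line_poly_mult: "line_poly p v (f * g) = line_poly p v f * line_poly p v g"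
  by (subst poly_eq_poly_eq_iff[symmetric], rule ext) simp

text \<open>On the line from \<open>p\<close> to an arbitrary point the polynomial has infinitely
  many zeros near \<open>p\<close>, hence vanishes identically.\<close>

lemma mveval_vanish_open:
  fixes f :: "'n::finite mvpoly"
  assumes "open S" "p \<in> S" and van: "\<And>x. x \<in> S \<Longrightarrow> mveval f x = 0"
  shows "f = 0"
proof (rule mveval_inject_0)
  fix q
  let ?P = "line_poly p (q - p) f"
  have "(\<lambda>t::real. p + t *\<^sub>R (q - p)) \<midarrow>0\<rightarrow> p + 0 *\<^sub>R (q - p)"
    by (intro tendsto_intros)
  then have "eventually (\<lambda>t::real. p + t *\<^sub>R (q - p) \<in> S) (at 0)"
    using assms by (intro topological_tendstoD) auto
  then obtain e where e: "e > 0" "\<And>t::real. t \<noteq> 0 \<Longrightarrow> dist t 0 < e \<Longrightarrow> p + t *\<^sub>R (q - p) \<in> S"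
    unfolding eventually_at by auto
  have "{0<..<e} \<subseteq> {t. poly ?P t = 0}"
    using e van by auto
  then have "infinite {t. poly ?P t = 0}"
    using e by (meson finite_subset infinite_Ioo)
  then have "?P = 0" using poly_roots_finite by blast
  then have "poly ?P 1 = 0" by simp
  then show "mveval f q = 0" by simp
qed

lemma has_derivative_mveval_exists: "\<exists>D. (mveval f has_derivative D) (at p within S)"
proof -
  have "\<exists>D. ((\<lambda>p. mono_eval m p) has_derivative D) (at p within S)" for m
    unfolding mono_eval_def
    by (rule exI, rule has_derivative_prod, rule has_derivative_power, rule bounded_linear_imp_has_derivative,
        rule bounded_linear_vec_nth)
  then obtain D where D: "((\<lambda>p. mono_eval m p) has_derivative D m) (at p within S)" for m
    by metis
  have "mveval f = (\<lambda>p. \<Sum>m\<in>keys f. lookup f m * mono_eval m p)"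
    by (rule ext) (rule mveval_superset, auto)
  moreover have "((\<lambda>p. \<Sum>m\<in>keys f. lookup f m * mono_eval m p) has_derivative
      (\<lambda>h. \<Sum>m\<in>keys f. lookup f m * D m h)) (at p within S)"
    by (intro has_derivative_sum has_derivative_mult_right D)
  ultimately show ?thesis by metis
qed

text \<open>Differentiability is known already, so the derivative in the direction \<open>v\<close>
  can be read off from the restriction to the line \<open>p + t v\<close>.\<close>

lemma has_derivative_mveval:
  "(mveval f has_derivative (\<lambda>v. poly (pderiv (line_poly p v f)) 0)) (at p)"
proof -
  obtain D where D: "(mveval f has_derivative D) (at p)"
    using has_derivative_mveval_exists by blast
  have "D v = poly (pderiv (line_poly p v f)) 0" for v
  proof -
    have "((\<lambda>t::real. p + t *\<^sub>R v) has_derivative (\<lambda>t. t *\<^sub>R v)) (at 0)"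
      by (auto intro!: derivative_eq_intros)
    from has_derivative_compose[OF this, of "mveval f" D] D
    have "((\<lambda>t. mveval f (p + t *\<^sub>R v)) has_derivative (\<lambda>t. D (t *\<^sub>R v))) (at 0)"
      by simp
    moreover have "D (t *\<^sub>R v) = D v * t" for t
      using D by (simp add: linear_cmul has_derivative_linear)
    ultimately have "((\<lambda>t. poly (line_poly p v f) t) has_field_derivative D v) (at 0)"
      by (simp add: has_field_derivative_def)
    then show ?thesis using poly_DERIV DERIV_unique by blast
  qed
  then have "D = (\<lambda>v. poly (pderiv (line_poly p v f)) 0)" by blast
  with D show ?thesis by simp
qed

lemma singular_point_iff:
  "singular_point f p \<longleftrightarrow> mveval f p = 0 \<and> (\<forall>v. poly (pderiv (line_poly p v f)) 0 = 0)"
proof -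
  have "GDERIV (mveval f) p :> 0 \<longleftrightarrow> (mveval f has_derivative (\<lambda>v. 0)) (at p)"
    by (simp add: gderiv_def)
  also have "\<dots> \<longleftrightarrow> (\<forall>v. poly (pderiv (line_poly p v f)) 0 = 0)"
  proof
    assume "(mveval f has_derivative (\<lambda>v. 0)) (at p)"
    from has_derivative_unique[OF has_derivative_mveval this]
    show "\<forall>v. poly (pderiv (line_poly p v f)) 0 = 0" by meson
  next
    assume "\<forall>v. poly (pderiv (line_poly p v f)) 0 = 0"
    then show "(mveval f has_derivative (\<lambda>v. 0)) (at p)"
      using has_derivative_mveval[of f p] by simp
  qed
  finally show ?thesis by (simp add: singular_point_def)
qed

lemma continuous_on_mveval [continuous_intros]:
  assumes "continuous_on S h"
  shows "continuous_on S (\<lambda>x. mveval f (h x))"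
proof -
  have "continuous_on UNIV (mveval f)"
    using has_derivative_mveval_exists has_derivative_continuous_on by metis
  then show ?thesis using assms continuous_on_compose2 by blast
qed

subsection \<open>Restriction to lines through the origin\<close>

definition mono_degree :: "('n::finite \<Rightarrow>\<^sub>0 nat) \<Rightarrow> nat" where
  "mono_degree m = (\<Sum>i\<in>UNIV. lookup m i)"

lemma mono_degree_eq_0_iff: "mono_degree m = 0 \<longleftrightarrow> m = 0"
  by (auto simp: mono_degree_def intro: poly_mapping_eqI)

lemma ray_poly_eq:
  "line_poly 0 p f = (\<Sum>m\<in>keys f. monom (lookup f m * mono_eval m p) (mono_degree m))"
proof -
  have "(\<Prod>i\<in>I. [:0, p $ i:] ^ lookup m i) =
      monom (\<Prod>i\<in>I. (p $ i) ^ lookup m i) (\<Sum>i\<in>I. lookup m i)" for m I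
  proof (induction I rule: infinite_finite_induct)
    case (insert i I)
    have "[:0, p $ i:] = monom (p $ i) 1" by (simp add: monom_altdef)
    with insert show ?case by (simp add: monom_power mult_monom)
  qed (auto simp: monom_0)
  then show ?thesis
    by (simp add: line_poly_def mono_eval_def mono_degree_def smult_monom)
qed

lemma continuous_on_coeff_ray_poly: "continuous_on S (\<lambda>p. coeff (line_poly 0 p f) k)"
proof -
  have "continuous_on S (\<lambda>p. if mono_degree m = k then c * (\<Prod>i\<in>UNIV. p $ i ^ lookup m i) else 0)"
    for m c by (cases "mono_degree m = k") (auto intro!: continuous_intros)
  then show ?thesis
    unfolding ray_poly_eq coeff_sum mono_eval_def coeff_monom by (intro continuous_on_sum)
qed

text \<open>Euler's operator, the sum of \<open>x_i\<close> times the partial derivative in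
  \<open>x_i\<close>. Its value at \<open>p\<close> is the derivative of \<open>f (t p)\<close> at
  \<open>t = 1\<close>.\<close>

definition euler_op :: "'n::finite mvpoly \<Rightarrow> 'n mvpoly" where
  "euler_op f = (\<Sum>m\<in>keys f.
     single m (of_nat (mono_degree m) * lookup f m))"

lemma lookup_euler_op:
  "lookup (euler_op f) m = of_nat (mono_degree m) * lookup f m"
  by (auto simp: euler_op_def lookup_sum lookup_single when_def in_keys_iff sum.delta)

lemma mveval_euler_op: "mveval (euler_op f) p = poly (pderiv (line_poly 0 p f)) 1"
proof -
  have "pderiv (\<Sum>i\<in>I. g i) = (\<Sum>i\<in>I. pderiv (g i))"
    for I :: "('a \<Rightarrow>\<^sub>0 nat) set" and g :: "_ \<Rightarrow> real poly"
    by (induction I rule: infinite_finite_induct) (auto simp: pderiv_add)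
  then show ?thesis
    by (simp add: euler_op_def ray_poly_eq mveval_single pderiv_monom poly_sum poly_monom mult.assoc)
qed

lemma mveval_euler_op_eq_deriv: "mveval (euler_op f) p = poly (pderiv (line_poly p p f)) 0"
proof -
  have "((\<lambda>t. poly (line_poly 0 p f) (1 + t)) has_field_derivative mveval (euler_op f) p) (at 0)"
    unfolding mveval_euler_op
    using DERIV_shift[of "poly (line_poly 0 p f)" "poly (pderiv (line_poly 0 p f)) 1" 0 1] poly_DERIV
    by (simp add: add.commute)
  moreover have "poly (line_poly 0 p f) (1 + t) = poly (line_poly p p f) t" for t
    by (simp add: scaleR_left_distrib)
  ultimately show ?thesis using poly_DERIV DERIV_unique by (metis (no_types, lifting) ext)
qed

lemma lookup_0_eq_mveval: "lookup f 0 = mveval f 0"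
proof -
  have *: "mono_eval m 0 = (if m = 0 then 1 else 0)" for m :: "'a \<Rightarrow>\<^sub>0 nat"
  proof (cases "m = 0")
    case False
    then obtain i where "lookup m i \<noteq> 0" by (metis lookup_zero poly_mapping_eqI)
    then show ?thesis using False by (auto simp: mono_eval_def intro!: bexI[of _ i])
  qed auto
  have "mveval f 0 = (\<Sum>m\<in>keys f. lookup f m * mono_eval m 0)"
    by (rule mveval_superset) auto
  then show ?thesis by (auto simp: * if_distrib sum.delta in_keys_iff cong: if_cong split: if_splits)
qed

text \<open>The operator creates no new monomials, so the quotient by \<open>q\<close> would have
  size 1 and be a nonzero constant. Evaluation at the origin contradicts this: there
  \<open>euler_op q\<close> vanishes and \<open>q\<close> does not.\<close>

lemma irreducible_not_dvd_euler_op: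
  fixes q :: "'n::finite mvpoly"
  assumes q: "irreducible q" "mveval q 0 \<noteq> 0"
  shows "\<not> q dvd euler_op q"
proof
  assume "q dvd euler_op q"
  then obtain h where h: "euler_op q = q * h" by (auto elim: dvdE)
  have q0: "q \<noteq> 0" using q by auto
  have ne: "euler_op q \<noteq> 0"
  proof
    assume "euler_op q = 0"
    then have "keys q \<subseteq> {0}"
      using lookup_euler_op[of q] by (auto simp: in_keys_iff mono_degree_eq_0_iff)
    then have "q = Const (lookup q 0)" by (rule eq_Const_if_keys)
    with q q0 show False by (metis Const_0 Const_dvd_1 irreducible_def)
  qed
  then have h0: "h \<noteq> 0" using h by auto
  obtain a where a: "a \<in> keys (euler_op q)" "mono_code a = poly_size (euler_op q)"
    using poly_size_leading[OF ne] by metis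
  have "a \<in> keys q" using a(1) by (auto simp: in_keys_iff lookup_euler_op)
  then have "poly_size (euler_op q) \<le> poly_size q"
    unfolding a(2)[symmetric] by (metis poly_size_leading[OF q0])
  then have "poly_size h = 1"
    using h poly_size_mult[OF q0 h0] poly_size_pos[OF q0] poly_size_pos[OF h0] by simp
  then obtain c where c: "h = Const c" "c \<noteq> 0" using poly_size_eq_1[OF h0] by metis
  have "mveval (euler_op q) 0 = 0"
    using lookup_euler_op[of q 0] by (simp add: lookup_0_eq_mveval[symmetric] mono_degree_def)
  then show False using q c h by simp
qed

subsection \<open>Polynomials vanishing on a hypersurface\<close>

text \<open>The hypothesis \<open>thick\<close> says that the projection of \<open>N\<close> along the \<open>x\<close>-axis is Zariski dense.\<close>

lemma prime_dvd_if_vanish: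
  fixes q g :: "'n::finite mvpoly"
  assumes q: "prime_elem q"
    and thick: "\<And>h. deg_less x 1 h \<Longrightarrow> \<forall>p\<in>N. mveval h p = 0 \<Longrightarrow> h = 0"
    and qN: "\<forall>p\<in>N. mveval q p = 0" and gN: "\<forall>p\<in>N. mveval g p = 0"
  shows "q dvd g"
proof -
  define J where "J = {f. \<forall>p\<in>N. mveval f p = 0}"
  have q0: "q \<noteq> 0" using q by auto
  \<comment> \<open>Minimal degree in \<open>x\<close> among the polynomials that vanish on
    \<open>N\<close>: pseudo-division of any of them by such a \<open>d\<close> leaves no
    remainder.\<close>
  define P where "P = (\<lambda>k. \<exists>d b. d \<in> J \<and> leading_term x d b k)"
  have "q \<in> J" using qN by (simp add: J_def)
  obtain b l where "leading_term x q b l" using leading_term_exists[OF q0, of x] by metis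
  with \<open>q \<in> J\<close> have "\<exists>k. P k" unfolding P_def by blast
  then obtain k where k: "P k" "\<And>l. P l \<Longrightarrow> k \<le> l"
    using exists_least_iff[of P] by (metis not_less)
  then obtain d b where d: "d \<in> J" "leading_term x d b k" unfolding P_def by blast
  have d0: "d \<noteq> 0" using leading_term_deg(2)[OF d(2)] by auto
  have kpos: "k \<noteq> 0"
  proof
    assume "k = 0"
    then have "deg_less x 1 d" using leading_term_deg(1)[OF d(2)] by simp
    then show False using thick d d0 unfolding J_def by auto
  qed
  have divide: "\<exists>e s. b ^ e * f = d * s" if "f \<in> J" for f
  proof -
    obtain e s where s: "deg_less x k (b ^ e * f - d * s)"
      using pseudo_division[OF d(2) UNIV_I vars_in_UNIV vars_in_UNIV vars_in_UNIV] by blast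
    have "b ^ e * f - d * s \<in> J" using that d(1) by (auto simp: J_def)
    moreover have False if "b ^ e * f - d * s \<noteq> 0" "b ^ e * f - d * s \<in> J"
    proof -
      obtain c l where c: "leading_term x (b ^ e * f - d * s) c l"
        using \<open>b ^ e * f - d * s \<noteq> 0\<close> by (metis leading_term_exists)
      then have "k \<le> l" using that k(2) unfolding P_def by blast
      then show False using leading_term_deg(2)[OF c] deg_less_mono[OF s] by simp
    qed
    ultimately have "b ^ e * f - d * s = 0" by blast
    then show ?thesis by auto
  qed
  obtain e s where s: "b ^ e * q = d * s" using divide[OF \<open>q \<in> J\<close>] by blast
  have "g \<in> J" using gN by (simp add: J_def)
  then obtain e' s' where s': "b ^ e' * g = d * s'" using divide by blast
  have bfree: "deg_less x 1 (b ^ n)" for n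
    using d(2) vars_in_power[of "- {x}" b n] by (simp add: vars_in_Diff_iff leading_term_def)
  have b0: "b ^ n \<noteq> 0" for n using d(2) by (simp add: leading_term_def)
  \<comment> \<open>The leading coefficient \<open>b\<close> is free of \<open>x\<close>; a divisor
    of its power is so too, and \<open>thick\<close> would make \<open>q\<close> zero.\<close>
  have qb: "\<not> q dvd b ^ n" for n
  proof
    assume "q dvd b ^ n"
    then obtain h where h: "b ^ n = q * h" by (auto elim: dvdE)
    have "vars_in (- {x}) (q * h)" using h bfree[of n] by (simp add: vars_in_Diff_iff)
    then have "vars_in (- {x}) q" using vars_in_factor h b0[of n] by metis
    then have "q = 0" using thick[of q] qN by (simp add: vars_in_Diff_iff)
    with q0 show False ..
  qed
  have "q dvd d * s" using s by (metis dvd_triv_right)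
  then have "q dvd d \<or> q dvd s" using q by (rule prime_elem_dvd_multD[rotated])
  then show ?thesis
  proof
    assume "q dvd d"
    then have "q dvd b ^ e' * g" using s' by simp
    then show ?thesis using q qb prime_elem_dvd_multD by blast
  next
    \<comment> \<open>Cancelling \<open>q\<close> leaves \<open>d\<close> as a divisor of a power of
      \<open>b\<close>, so \<open>d\<close> would be free of \<open>x\<close> and zero by
      \<open>thick\<close>.\<close>
    assume "q dvd s"
    then obtain w where "s = q * w" by (auto elim: dvdE)
    then have "q * b ^ e = q * (d * w)" using s by (simp add: ac_simps)
    then have bd: "b ^ e = d * w" using mvpoly_mult_left_cancel[OF q0] by blast
    then have "vars_in (- {x}) (d * w)" using bfree[of e] by (simp add: vars_in_Diff_iff)
    then have "vars_in (- {x}) d" using vars_in_factor bd b0[of e] by metis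
    then have "d = 0" using thick[of d] d(1) by (simp add: vars_in_Diff_iff J_def)
    with d0 show ?thesis by blast
  qed
qed


section \<open>Determinants\<close>

text \<open>Used with evaluation maps, at points, at real numbers and at complex numbers.\<close>

lemma det_hom:
  fixes h :: "'a::comm_ring_1 \<Rightarrow> 'b::comm_ring_1" and M :: "'a ^ 'n ^ 'n"
  assumes add: "\<And>x y. h (x + y) = h x + h y" and mult: "\<And>x y. h (x * y) = h x * h y"
    and one: "h 1 = 1"
  shows "h (det M) = det (\<chi> i j. h (M $ i $ j))"
proof -
  have zero: "h 0 = 0" using add[of 0 0] by simp
  have neg: "h (- x) = - h x" for x using add[of x "- x"] zero by (simp add: eq_neg_iff_add_eq_0 add.commute)
  have sum: "h (sum f I) = (\<Sum>i\<in>I. h (f i))" for f :: "_ \<Rightarrow> 'a" and I :: "('n \<Rightarrow> 'n) set"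
    by (induction I rule: infinite_finite_induct) (auto simp: zero add)
  have prod: "h (prod f I) = (\<Prod>i\<in>I. h (f i))" for f :: "_ \<Rightarrow> 'a" and I :: "'n set"
    by (induction I rule: infinite_finite_induct) (auto simp: one mult)
  have "h (of_int (sign p)) = of_int (sign p)" for p :: "'n \<Rightarrow> 'n"
    by (cases p rule: sign_cases) (auto simp: one neg)
  then show ?thesis by (simp add: det_def sum prod mult)
qed

lemma det_eq_0_iff_kernel:
  fixes A :: "'a::field ^ 'n ^ 'n"
  shows "det A = 0 \<longleftrightarrow> (\<exists>v. v \<noteq> 0 \<and> A *v v = 0)"
proof -
  have "det A \<noteq> 0 \<longleftrightarrow> (\<exists>B. B ** A = mat 1)"
    by (metis invertible_det_nz invertible_left_inverse)
  then show ?thesis using matrix_left_invertible_ker[of A] by blast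
qed

lemma has_derivative_det:
  fixes M :: "'a::real_normed_vector \<Rightarrow> real ^ 'n ^ 'n"
  assumes "\<And>i j. ((\<lambda>x. M x $ i $ j) has_derivative D i j) (at p)"
  shows "((\<lambda>x. det (M x)) has_derivative
    (\<lambda>h. \<Sum>k\<in>UNIV. det (\<chi> i. if i = k then (\<chi> j. D k j h) else M p $ i))) (at p)"
proof -
  have "((\<lambda>x. det (M x)) has_derivative
    (\<lambda>h. \<Sum>\<pi> | \<pi> permutes (UNIV :: 'n set). of_int (sign \<pi>) *
        (\<Sum>k\<in>UNIV. D k (\<pi> k) h * (\<Prod>i\<in>UNIV - {k}. M p $ i $ \<pi> i)))) (at p)"
    unfolding det_def by (intro has_derivative_sum has_derivative_mult_right has_derivative_prod assms)
  moreover have "(\<Sum>\<pi> | \<pi> permutes (UNIV :: 'n set). of_int (sign \<pi>) *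
        (\<Sum>k\<in>UNIV. D k (\<pi> k) h * (\<Prod>i\<in>UNIV - {k}. M p $ i $ \<pi> i))) =
      (\<Sum>k\<in>UNIV. det (\<chi> i. if i = k then (\<chi> j. D k j h) else M p $ i))" for h
  proof -
    have "(\<Prod>i\<in>UNIV. (\<chi> i. if i = k then (\<chi> j. D k j h) else M p $ i) $ i $ \<pi> i) =
        D k (\<pi> k) h * (\<Prod>i\<in>UNIV - {k}. M p $ i $ \<pi> i)" for k \<pi>
      by (subst prod.remove[of _ k]) (auto intro!: prod.cong)
    then show ?thesis
      unfolding det_def by (subst sum.swap) (simp add: sum_distrib_left)
  qed
  ultimately show ?thesis by simp
qed

lemma det_scaleR_matrix: "det (r *\<^sub>R A) = r ^ CARD('n) * det A" for A :: "real ^ 'n ^ 'n"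
proof -
  have "r *\<^sub>R A = (\<chi> i. r *s A $ i)" by (simp add: vec_eq_iff)
  then show ?thesis using det_rows_mul[of "\<lambda>_. r" "\<lambda>i. A $ i"] by simp
qed

text \<open>A kernel of dimension at least two meets the hyperplane orthogonal to the new row
  \<open>w\<close> in a nonzero vector, which the modified matrix kills.\<close>

lemma det_replace_row_eq_0:
  fixes M :: "real ^ 'n ^ 'n"
  assumes "M *v u = 0" "M *v v = 0" "u \<noteq> 0" "v \<noteq> 0" "u \<bullet> v = 0"
  shows "det (\<chi> i. if i = k then w else M $ i) = 0"
proof -
  obtain z where z: "z \<noteq> 0" "M *v z = 0" "w \<bullet> z = 0"
  proof (cases "w \<bullet> u = 0")
    case True
    then show thesis using that[of u] assms by simp
  next
    case False
    define z where "z = (w \<bullet> v) *\<^sub>R u - (w \<bullet> u) *\<^sub>R v"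
    have "v \<bullet> z = - (w \<bullet> u) * (v \<bullet> v)"
      using assms by (simp add: z_def inner_diff_right inner_commute)
    then have "z \<noteq> 0" using False assms by auto
    moreover have "M *v z = 0"
      using assms by (simp add: z_def matrix_vector_mult_diff_distrib matrix_vector_mult_scaleR)
    moreover have "w \<bullet> z = 0" by (simp add: z_def inner_diff_right)
    ultimately show thesis using that by blast
  qed
  have "(\<chi> i. if i = k then w else M $ i) *v z = 0"
    using z(2,3) by (simp add: vec_eq_iff matrix_vector_mul_component)
  then show ?thesis using z(1) det_eq_0_iff_kernel by blast
qed

section \<open>Characteristic polynomials and multiple eigenvalues\<close>

lemma poly_charpoly: "poly (charpoly A) t = det (mat t - A)"
proof -
  have "poly (charpoly A) t = det (\<chi> i j. poly ((mat [:0, 1:] - (\<chi> i j. [:A $ i $ j:])) $ i $ j) t)"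
    unfolding charpoly_def by (rule det_hom) auto
  also have "(\<chi> i j. poly ((mat [:0, 1:] - (\<chi> i j. [:A $ i $ j:])) $ i $ j) t) = mat t - A"
    by (simp add: vec_eq_iff mat_def)
  finally show ?thesis .
qed

lemma mat_mult_vec: "mat t *v v = t *\<^sub>R v" for v :: "real ^ 'n"
  by (simp add: vec_eq_iff matrix_vector_mult_def mat_def if_distrib if_distribR sum.delta cong: if_cong)

text \<open>An eigenvalue is at most the operator norm, so a number above the norm is not a
  root.\<close>

lemma charpoly_neq_0: "charpoly A \<noteq> 0" for A :: "real ^ 'n ^ 'n"
proof
  assume "charpoly A = 0"
  define t where "t = onorm ((*v) A) + 1"
  have "det (mat t - A) = 0" using poly_charpoly[of A t] \<open>charpoly A = 0\<close> by simp
  then obtain v where v: "v \<noteq> 0" "(mat t - A) *v v = 0"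
    using det_eq_0_iff_kernel by blast
  then have eq: "A *v v = t *\<^sub>R v"
    by (simp add: matrix_vector_mult_diff_rdistrib mat_mult_vec)
  have "norm (A *v v) \<le> onorm ((*v) A) * norm v"
    by (rule onorm) (rule matrix_vector_mul_bounded_linear)
  moreover have "0 \<le> onorm ((*v) A)"
    by (rule onorm_pos_le) (rule matrix_vector_mul_bounded_linear)
  ultimately have "t * norm v \<le> (t - 1) * norm v"
    by (simp add: eq t_def)
  then show False using v by (simp add: algebra_simps)
qed

lemma order_ge_2_iff:
  fixes P :: "real poly"
  assumes "P \<noteq> 0"
  shows "2 \<le> order x P \<longleftrightarrow> poly P x = 0 \<and> poly (pderiv P) x = 0"
proof (cases "poly P x = 0")
  case True
  then have *: "order x P = Suc (order x (pderiv P))" using assms order_pderiv by blast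
  have "pderiv P \<noteq> 0"
    using True assms pderiv_iszero[of P] by auto
  then show ?thesis using * True order_gt_0_iff[of "pderiv P" x] by auto
next
  case False
  then show ?thesis using order_root[of P x] by auto
qed

lemma eigenspace_dim_2_imp_deriv_0:
  fixes A :: "real ^ 'n ^ 'n"
  assumes "u \<noteq> 0" "v \<noteq> 0" "u \<bullet> v = 0" "A *v u = x *\<^sub>R u" "A *v v = x *\<^sub>R v"
  shows "poly (charpoly A) x = 0 \<and> poly (pderiv (charpoly A)) x = 0"
proof
  have ker: "(mat x - A) *v u = 0" "(mat x - A) *v v = 0"
    using assms by (simp_all add: matrix_vector_mult_diff_rdistrib mat_mult_vec)
  then show "poly (charpoly A) x = 0"
    using assms det_eq_0_iff_kernel poly_charpoly by metis
  have "((\<lambda>t. (mat t - A) $ i $ j) has_derivative (\<lambda>h. if i = j then h else 0)) (at x)" for i j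
    by (cases "i = j") (auto simp: mat_def intro!: derivative_eq_intros)
  from has_derivative_det[OF this]
  have "((\<lambda>t. det (mat t - A)) has_derivative (\<lambda>h. 0)) (at x)"
    by (simp add: det_replace_row_eq_0[OF ker assms(1-3)])
  then have "(poly (charpoly A) has_field_derivative 0) (at x)"
    by (simp add: has_field_derivative_def poly_charpoly[symmetric] lambda_zero)
  then show "poly (pderiv (charpoly A)) x = 0" using poly_DERIV DERIV_unique by blast
qed

text \<open>Deflation: in an orthonormal basis starting with an eigenvector of \<open>x\<close>, the characteristic
  polynomial is \<open>t - x\<close> times a determinant that is continuous in \<open>t\<close>.\<close>

lemma symmetric_deriv_0_imp_eigenspace_dim_2:
  fixes A :: "real ^ 'n ^ 'n"
  assumes sym: "transpose A = A" and "poly (charpoly A) x = 0" "poly (pderiv (charpoly A)) x = 0"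
  obtains u v where "u \<noteq> 0" "v \<noteq> 0" "u \<bullet> v = 0" "A *v u = x *\<^sub>R u" "A *v v = x *\<^sub>R v"
proof -
  have "det (mat x - A) = 0" using assms(2) by (simp add: poly_charpoly)
  then obtain u0 where u0: "u0 \<noteq> 0" "(mat x - A) *v u0 = 0"
    using det_eq_0_iff_kernel by blast
  define u where "u = u0 /\<^sub>R norm u0"
  have "A *v u0 = x *\<^sub>R u0"
    using u0 by (simp add: matrix_vector_mult_diff_rdistrib mat_mult_vec)
  then have u: "norm u = 1" "A *v u = x *\<^sub>R u"
    using u0 by (simp_all add: u_def matrix_vector_mult_scaleR)
  \<comment> \<open>Any index will do; it marks the basis vector that \<open>Q\<close> sends to the
    eigenvector \<open>u\<close>.\<close>
  define k :: 'n where "k = undefined"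
  obtain Q :: "real ^ 'n ^ 'n" where Q: "orthogonal_matrix Q" "Q *v axis k 1 = u"
    using orthogonal_matrix_exists_basis[OF u(1)] by metis
  have QQ: "transpose Q ** Q = mat 1" "Q ** transpose Q = mat 1"
    using Q(1) by (auto simp: orthogonal_matrix_def)
  define B where "B = transpose Q ** A ** Q"
  have symB: "B $ i $ j = B $ j $ i" for i j
  proof -
    have "transpose B = B"
      by (simp add: B_def matrix_transpose_mul sym matrix_mul_assoc)
    then show ?thesis by (metis transpose_def vec_lambda_beta)
  qed
  have "B *v axis k 1 = transpose Q *v (A *v (Q *v axis k 1))"
    by (simp add: B_def matrix_vector_mul_assoc matrix_mul_assoc)
  also have "\<dots> = x *\<^sub>R (transpose Q *v (Q *v axis k 1))"
    by (simp add: Q u matrix_vector_mult_scaleR)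
  also have "\<dots> = x *\<^sub>R axis k 1"
    by (simp add: matrix_vector_mul_assoc QQ)
  finally have Bk: "B *v axis k 1 = x *\<^sub>R axis k 1" .
  have Bkj: "B $ k $ j = (if j = k then x else 0)" for j
  proof -
    have "B $ j $ k = (B *v axis k 1) $ j"
      by (simp add: matrix_vector_mult_basis column_def)
    then show ?thesis using symB[of k j] unfolding Bk by (simp add: axis_def)
  qed
  have conj: "transpose Q ** (mat t - A) ** Q = mat t - B" for t
  proof -
    have "(transpose Q ** (mat t - A) ** Q) *v w = (mat t - B) *v w" for w
    proof -
      have "(transpose Q ** (mat t - A) ** Q) *v w = transpose Q *v ((mat t - A) *v (Q *v w))"
        by (simp add: matrix_vector_mul_assoc matrix_mul_assoc)
      also have "\<dots> = t *\<^sub>R (transpose Q *v (Q *v w)) - transpose Q *v (A *v (Q *v w))"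
        by (simp add: matrix_vector_mult_diff_rdistrib mat_mult_vec matrix_vector_mult_diff_distrib
            matrix_vector_mult_scaleR)
      also have "\<dots> = (mat t - B) *v w"
        by (simp add: matrix_vector_mul_assoc QQ B_def matrix_mul_assoc
            matrix_vector_mult_diff_rdistrib mat_mult_vec)
      finally show ?thesis .
    qed
    then show ?thesis by (simp add: matrix_eq)
  qed
  have detQ: "det (transpose Q) * det Q = 1"
    using QQ(1) by (metis det_I det_mul)
  have char: "poly (charpoly A) t = det (mat t - B)" for t
    using detQ by (simp add: poly_charpoly conj[symmetric] det_mul)
  \<comment> \<open>Row \<open>k\<close> of \<open>mat t - B\<close> is \<open>t - x\<close> times a
    unit vector; \<open>C t\<close> keeps the unit vector, so the factor comes out of the
    determinant.\<close>
  define C where "C = (\<lambda>t. (\<chi> i. if i = k then axis k 1 else (mat t - B) $ i))"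
  have detC: "det (mat t - B) = (t - x) * det (C t)" for t
  proof -
    have "mat t - B = (\<chi> i. if i = k then (t - x) *s axis k 1 else (mat t - B) $ i)"
      by (auto simp: vec_eq_iff mat_def Bkj axis_def)
    then have "det (mat t - B) = det (\<chi> i. if i = k then (t - x) *s axis k 1 else (mat t - B) $ i)"
      by simp
    then show ?thesis
      unfolding C_def by (subst (asm) det_row_mul)
  qed
  have contC: "isCont (\<lambda>t. det (C t)) x"
  proof -
    have "isCont (\<lambda>t. C t $ i $ j) x" for i j
      by (cases "i = k"; cases "i = j") (auto simp: C_def mat_def)
    then show ?thesis
      unfolding det_def by (intro continuous_sum continuous_mult continuous_const continuous_prod)
  qed
  \<comment> \<open>The factor \<open>t - x\<close> vanishes at \<open>x\<close>, so continuity of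
    the other factor is enough to differentiate the product there.\<close>
  have "((\<lambda>t. (t - x) * det (C t)) has_field_derivative det (C x)) (at x)"
  proof (unfold DERIV_def)
    have "((\<lambda>h. det (C (x + h))) \<longlongrightarrow> det (C x)) (at 0)"
      using contC[unfolded isCont_iff] .
    then show "((\<lambda>h. ((x + h - x) * det (C (x + h)) - (x - x) * det (C x)) / h) \<longlongrightarrow> det (C x)) (at 0)"
      by (rule Lim_transform_eventually) (auto simp: eventually_at_filter)
  qed
  moreover have "poly (charpoly A) = (\<lambda>t. (t - x) * det (C t))"
    by (rule ext) (simp add: char detC)
  ultimately have "(poly (charpoly A) has_field_derivative det (C x)) (at x)" by simp
  then have "det (C x) = 0" using assms(3) poly_DERIV DERIV_unique by metis
  then obtain w where w: "w \<noteq> 0" "C x *v w = 0"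
    using det_eq_0_iff_kernel by blast
  \<comment> \<open>This coordinate is the component of \<open>Q *v w\<close> along
    \<open>u\<close>; its vanishing yields a second eigenvector orthogonal to
    \<open>u\<close>.\<close>
  have wk: "w $ k = 0"
  proof -
    have "(C x *v w) $ k = axis k 1 \<bullet> w" by (simp add: matrix_vector_mul_component C_def)
    then show ?thesis using w by (simp add: inner_axis')
  qed
  have "(mat x - B) *v w = 0"
  proof (subst vec_eq_iff, rule allI)
    fix i
    show "((mat x - B) *v w) $ i = 0 $ i"
    proof (cases "i = k")
      case True
      have "(mat x - B) $ k = 0" by (auto simp: vec_eq_iff mat_def Bkj)
      then show ?thesis using True by (simp add: matrix_vector_mul_component)
    next
      case False
      then have "((mat x - B) *v w) $ i = (C x *v w) $ i"
        by (simp add: matrix_vector_mul_component C_def)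
      then show ?thesis using w by simp
    qed
  qed
  then have Bw: "B *v w = x *\<^sub>R w"
    by (simp add: matrix_vector_mult_diff_rdistrib mat_mult_vec)
  define v where "v = Q *v w"
  have Qv: "transpose Q *v v = w" by (simp add: v_def matrix_vector_mul_assoc QQ)
  have "v \<noteq> 0" using w Qv by auto
  moreover have "u \<bullet> v = 0"
  proof -
    have "u \<bullet> v = axis k 1 \<bullet> (transpose Q *v v)"
      by (metis Q(2) dot_lmul_matrix transpose_matrix_vector vector_transpose_matrix transpose_transpose)
    then show ?thesis using wk unfolding Qv by (simp add: inner_axis')
  qed
  moreover have "A *v v = x *\<^sub>R v"
  proof -
    have "A *v v = Q *v (B *v w)"
      by (simp add: v_def B_def matrix_vector_mul_assoc matrix_mul_assoc QQ)
    then show ?thesis by (simp add: Bw v_def matrix_vector_mult_scaleR)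
  qed
  moreover have "u \<noteq> 0" using u by auto
  ultimately show thesis using that u by blast
qed

lemma multiple_eigenvalue_iff:
  fixes A :: "real ^ 'n ^ 'n"
  assumes "transpose A = A"
  shows "multiple_eigenvalue A x \<longleftrightarrow>
    (\<exists>u v. u \<noteq> 0 \<and> v \<noteq> 0 \<and> u \<bullet> v = 0 \<and> A *v u = x *\<^sub>R u \<and> A *v v = x *\<^sub>R v)"
  unfolding multiple_eigenvalue_def order_ge_2_iff[OF charpoly_neq_0]
  using eigenspace_dim_2_imp_deriv_0 symmetric_deriv_0_imp_eigenspace_dim_2[OF assms] by metis

section \<open>The Christoffel matrix\<close>

lemma mveval_slowness_poly: "mveval (slowness_poly c) p = det (christoffel c p - mat 1)"
proof -
  have "mveval (slowness_poly c) p = det (\<chi> i j. mveval ((christoffel_poly c - mat 1) $ i $ j) p)"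
    unfolding slowness_poly_def by (rule det_hom) auto
  also have "(\<chi> i j. mveval ((christoffel_poly c - mat 1) $ i $ j) p) = christoffel c p - mat 1"
    by (simp add: vec_eq_iff christoffel_poly_def christoffel_def mat_def)
  finally show ?thesis .
qed

lemma christoffel_scaleR: "christoffel c (t *\<^sub>R p) = t\<^sup>2 *\<^sub>R christoffel c p"
  by (simp add: vec_eq_iff christoffel_def sum_distrib_left power2_eq_square algebra_simps)

lemma slowness_poly_0: "mveval (slowness_poly c) 0 \<noteq> 0"
proof -
  have "christoffel c 0 - mat 1 = - mat 1"
    by (simp add: vec_eq_iff christoffel_def)
  moreover have "v = 0" if "(- mat 1) *v v = 0" for v :: "real ^ 'a"
    using that by (simp add: vec_eq_iff matrix_vector_mult_def mat_def if_distrib if_distribR sum.delta cong: if_cong)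
  ultimately show ?thesis
    unfolding mveval_slowness_poly by (metis det_eq_0_iff_kernel)
qed

lemma slowness_poly_neq_0: "slowness_poly c \<noteq> 0"
  using slowness_poly_0[of c] by auto

lemma stiffness_tensor_symmetries:
  assumes "stiffness_tensor c"
  shows "c i j k l = c j i k l" "c i j k l = c k l i j" "c i j k l = c i j l k"
  using assms unfolding stiffness_tensor_def by metis+

lemma transpose_christoffel:
  assumes "stiffness_tensor c"
  shows "transpose (christoffel c p) = christoffel c p"
proof -
  have "c l j k i = c i k j l" for i j k l
    using stiffness_tensor_symmetries[OF assms] by metis
  then have "(\<Sum>j\<in>UNIV. \<Sum>k\<in>UNIV. c l j k i * p $ j * p $ k) =
      (\<Sum>j\<in>UNIV. \<Sum>k\<in>UNIV. c i j k l * p $ j * p $ k)" for i l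
    by (subst sum.swap) (simp add: algebra_simps)
  then show ?thesis by (simp add: vec_eq_iff christoffel_def transpose_def)
qed

lemma christoffel_quadratic_form:
  "u \<bullet> (christoffel c p *v u) =
    (\<Sum>i\<in>UNIV. \<Sum>j\<in>UNIV. \<Sum>k\<in>UNIV. \<Sum>l\<in>UNIV. c i j k l * (u $ i * p $ j) * (p $ k * u $ l))"
proof -
  have "u \<bullet> (christoffel c p *v u) =
    (\<Sum>i\<in>UNIV. \<Sum>l\<in>UNIV. \<Sum>j\<in>UNIV. \<Sum>k\<in>UNIV. c i j k l * (u $ i * p $ j) * (p $ k * u $ l))"
    by (simp add: inner_vec_def christoffel_def matrix_vector_mult_def sum_distrib_left sum_distrib_right algebra_simps)
  also have "\<dots> = (\<Sum>i\<in>UNIV. \<Sum>j\<in>UNIV. \<Sum>l\<in>UNIV. \<Sum>k\<in>UNIV. c i j k l * (u $ i * p $ j) * (p $ k * u $ l))"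
    by (rule sum.cong[OF refl], rule sum.swap)
  also have "\<dots> = (\<Sum>i\<in>UNIV. \<Sum>j\<in>UNIV. \<Sum>k\<in>UNIV. \<Sum>l\<in>UNIV. c i j k l * (u $ i * p $ j) * (p $ k * u $ l))"
    by (rule sum.cong[OF refl], rule sum.cong[OF refl], rule sum.swap)
  finally show ?thesis .
qed

text \<open>By the symmetries of \<open>c\<close>, its value at the rank-one matrix \<open>u p\<^sup>T\<close> is its value at the
  symmetric part of that matrix.\<close>

lemma christoffel_pos_def:
  assumes c: "stiffness_tensor c" "positive_definite c" and "u \<noteq> 0" "p \<noteq> 0"
  shows "0 < u \<bullet> (christoffel c p *v u)"
proof -
  define A :: "real ^ 'a ^ 'a" where "A = (\<chi> i j. (u $ i * p $ j + u $ j * p $ i) / 2)"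
  have "A \<noteq> 0"
  proof
    assume "A = 0"
    then have z: "u $ i * p $ j + u $ j * p $ i = 0" for i j
      by (auto simp: A_def vec_eq_iff)
    obtain a where a: "u $ a \<noteq> 0" using \<open>u \<noteq> 0\<close> by (auto simp: vec_eq_iff)
    then have "p $ a = 0" using z[of a a] by simp
    then have "p $ j = 0" for j using z[of a j] a by simp
    with \<open>p \<noteq> 0\<close> show False by (simp add: vec_eq_iff)
  qed
  moreover have "transpose A = A" by (simp add: A_def transpose_def vec_eq_iff algebra_simps)
  ultimately have pos: "0 < (\<Sum>i\<in>UNIV. \<Sum>j\<in>UNIV. \<Sum>k\<in>UNIV. \<Sum>l\<in>UNIV. c i j k l * A $ i $ j * A $ k $ l)"
    using c by (auto simp: positive_definite_def)
  let ?S = "\<lambda>f g. \<Sum>i\<in>UNIV. \<Sum>j\<in>UNIV. \<Sum>k\<in>UNIV. \<Sum>l\<in>UNIV. c i j k l * f i j * g k l"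
  define U where "U = (\<lambda>i j. u $ i * p $ j)"
  define U' where "U' = (\<lambda>i j. U j i)"
  have sw1: "?S U' g = ?S U g" for g
  proof -
    have "?S U' g = (\<Sum>j\<in>UNIV. \<Sum>i\<in>UNIV. \<Sum>k\<in>UNIV. \<Sum>l\<in>UNIV. c i j k l * U' i j * g k l)"
      by (rule sum.swap)
    also have "\<dots> = ?S U g"
      unfolding U'_def using stiffness_tensor_symmetries(1)[OF c(1)] by (intro sum.cong refl) metis
    finally show ?thesis .
  qed
  have sw2: "?S f U' = ?S f U" for f
  proof -
    have "(\<Sum>k\<in>UNIV. \<Sum>l\<in>UNIV. c i j k l * f i j * U' k l) = (\<Sum>k\<in>UNIV. \<Sum>l\<in>UNIV. c i j k l * f i j * U k l)" for i j
    proof -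
      have "(\<Sum>k\<in>UNIV. \<Sum>l\<in>UNIV. c i j k l * f i j * U' k l) = (\<Sum>l\<in>UNIV. \<Sum>k\<in>UNIV. c i j k l * f i j * U' k l)"
        by (rule sum.swap)
      also have "\<dots> = (\<Sum>k\<in>UNIV. \<Sum>l\<in>UNIV. c i j k l * f i j * U k l)"
        unfolding U'_def using stiffness_tensor_symmetries(3)[OF c(1)] by (intro sum.cong refl) metis
      finally show ?thesis .
    qed
    then show ?thesis by simp
  qed
  have A: "A $ i $ j = U i j / 2 + U' i j / 2" for i j
    by (simp add: A_def U_def U'_def add_divide_distrib)
  have "c i j k l * A $ i $ j * A $ k $ l = c i j k l * U i j * U k l / 4 + c i j k l * U i j * U' k l / 4
      + c i j k l * U' i j * U k l / 4 + c i j k l * U' i j * U' k l / 4" for i j k l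
    unfolding A by (simp add: field_simps)
  then have "(\<Sum>i\<in>UNIV. \<Sum>j\<in>UNIV. \<Sum>k\<in>UNIV. \<Sum>l\<in>UNIV. c i j k l * A $ i $ j * A $ k $ l) =
      ?S U U / 4 + ?S U U' / 4 + ?S U' U / 4 + ?S U' U' / 4"
    by (simp only: sum.distrib sum_divide_distrib)
  also have "\<dots> = ?S U U" by (simp only: sw1 sw2)
  also have "\<dots> = ?S U U'" by (simp only: sw2)
  also have "\<dots> = u \<bullet> (christoffel c p *v u)"
    by (simp add: christoffel_quadratic_form U_def U'_def algebra_simps)
  finally show ?thesis using pos by simp
qed

subsection \<open>Singular points and degeneracy\<close>

lemma mveval_slowness_poly_eq_0_iff:
  "mveval (slowness_poly c) p = 0 \<longleftrightarrow> (\<exists>v. v \<noteq> 0 \<and> christoffel c p *v v = v)"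
  unfolding mveval_slowness_poly det_eq_0_iff_kernel
  by (simp add: matrix_vector_mult_diff_rdistrib)

text \<open>By homogeneity of degree 2, \<open>s - \<Gamma>(p)\<close> is \<open>- s\<close> times
  \<open>\<Gamma>(p / sqrt s) - 1\<close>. So a positive eigenvalue \<open>s\<close> corresponds to
  the root \<open>1 / sqrt s\<close> of the ray polynomial.\<close>

lemma charpoly_ray:
  fixes p :: "real ^ 'n"
  assumes "s > 0"
  shows "poly (charpoly (christoffel c p)) s =
    (- s) ^ CARD('n) * poly (line_poly 0 p (slowness_poly c)) (inverse (sqrt s))"
proof -
  have "mat s - christoffel c p = (- s) *\<^sub>R (christoffel c (inverse (sqrt s) *\<^sub>R p) - mat 1)"
    using assms by (simp add: christoffel_scaleR vec_eq_iff mat_def power_inverse algebra_simps)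
  then show ?thesis
    by (simp only: poly_charpoly det_scaleR_matrix mveval_slowness_poly poly_line_poly add_0)
qed

lemma singular_imp_multiple_eigenvalue:
  fixes c :: "'n::finite tensor4"
  assumes "singular_point (slowness_poly c) p"
  shows "multiple_eigenvalue (christoffel c p) 1"
proof -
  let ?L = "line_poly 0 p (slowness_poly c)"
  have L: "poly ?L 1 = 0" "poly (pderiv ?L) 1 = 0"
    using assms mveval_euler_op_eq_deriv[of "slowness_poly c" p]
    by (simp_all add: singular_point_iff mveval_euler_op)
  \<comment> \<open>The identity of \<open>charpoly_ray\<close> is differentiated at
    \<open>s = 1\<close>: both terms of the product rule contain a vanishing factor.\<close>
  have "((\<lambda>s::real. inverse (sqrt s)) has_field_derivative - (1 / 2)) (at 1)"
    by (auto intro!: derivative_eq_intros)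
  then have d: "((\<lambda>s. poly ?L (inverse (sqrt s))) has_field_derivative poly (pderiv ?L) 1 * (- (1 / 2))) (at 1)"
    using DERIV_chain2[of "poly ?L" _ "\<lambda>s. inverse (sqrt s)" 1] poly_DERIV[of ?L] by fastforce
  have "((\<lambda>s::real. (- s) ^ CARD('n)) has_field_derivative of_nat CARD('n) * (- 1) ^ (CARD('n) - 1) * (- 1)) (at 1)"
    by (auto intro!: derivative_eq_intros)
  from DERIV_mult[OF this d]
  have "((\<lambda>s. (- s) ^ CARD('n) * poly ?L (inverse (sqrt s))) has_field_derivative 0) (at 1)"
    by (simp only: L inverse_1 real_sqrt_one) simp
  moreover have "\<forall>\<^sub>F s in nhds 1. poly (charpoly (christoffel c p)) s = (- s) ^ CARD('n) * poly ?L (inverse (sqrt s))"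
    using eventually_nhds_in_open[of "{0<..}" "1::real"] by (auto elim!: eventually_mono simp del: poly_line_poly simp: charpoly_ray)
  ultimately have "(poly (charpoly (christoffel c p)) has_field_derivative 0) (at 1)"
    by (subst DERIV_cong_ev[OF refl _ refl]) 
  then have "poly (pderiv (charpoly (christoffel c p))) 1 = 0"
    using poly_DERIV DERIV_unique by blast
  moreover have "poly (charpoly (christoffel c p)) 1 = 0"
    using charpoly_ray[of 1 c p] L by simp
  ultimately show ?thesis
    by (simp add: multiple_eigenvalue_def order_ge_2_iff[OF charpoly_neq_0])
qed

lemma multiple_eigenvalue_imp_singular:
  fixes c :: "'n::finite tensor4"
  assumes "stiffness_tensor c" "multiple_eigenvalue (christoffel c p) 1"
  shows "singular_point (slowness_poly c) p"
proof -
  obtain u v where uv: "u \<noteq> 0" "v \<noteq> 0" "u \<bullet> v = 0" "christoffel c p *v u = u" "christoffel c p *v v = v"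
    using assms(2) multiple_eigenvalue_iff[OF transpose_christoffel[OF assms(1)]] by auto
  have "\<exists>D. ((\<lambda>p. (christoffel c p - mat 1) $ i $ j) has_derivative D) (at p)" for i j
  proof -
    have "(\<lambda>p. (christoffel c p - mat 1) $ i $ j) = mveval ((christoffel_poly c - mat 1) $ i $ j)"
      by (rule ext) (simp add: christoffel_poly_def christoffel_def mat_def)
    then show ?thesis using has_derivative_mveval_exists by metis
  qed
  then obtain D where D: "((\<lambda>p. (christoffel c p - mat 1) $ i $ j) has_derivative D i j) (at p)" for i j
    by metis
  have ker: "(christoffel c p - mat 1) *v u = 0" "(christoffel c p - mat 1) *v v = 0"
    using uv by (simp_all add: matrix_vector_mult_diff_rdistrib)
  have "(mveval (slowness_poly c) has_derivative (\<lambda>h. 0)) (at p)"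
    using has_derivative_det[OF D]
    by (simp add: det_replace_row_eq_0[OF ker uv(1-3)] mveval_slowness_poly[abs_def])
  then show ?thesis
    using uv mveval_slowness_poly_eq_0_iff by (auto simp: singular_point_def gderiv_def)
qed

lemma singular_point_slowness_iff:
  "stiffness_tensor c \<Longrightarrow> singular_point (slowness_poly c) p \<longleftrightarrow> multiple_eigenvalue (christoffel c p) 1"
  using singular_imp_multiple_eigenvalue multiple_eigenvalue_imp_singular by blast

lemma multiple_eigenvalue_scale:
  assumes "stiffness_tensor c" "multiple_eigenvalue (christoffel c p) x"
  shows "multiple_eigenvalue (christoffel c (t *\<^sub>R p)) (t\<^sup>2 * x)"
proof -
  have *: "christoffel c (t *\<^sub>R p) *v w = (t\<^sup>2 * x) *\<^sub>R w" if "christoffel c p *v w = x *\<^sub>R w" for w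
    using that by (simp add: christoffel_scaleR scaleR_matrix_vector_assoc[symmetric])
  show ?thesis
    using assms(2) * unfolding multiple_eigenvalue_iff[OF transpose_christoffel[OF assms(1)]] by blast
qed

text \<open>A multiple eigenvalue \<open>x\<close> at \<open>q \<noteq> 0\<close> is positive, and
  division of \<open>q\<close> by \<open>sqrt x\<close> moves it to 1. The origin is left out: its
  Christoffel matrix is 0, which is degenerate from dimension 2 on, but no positive multiple of a
  singular point is 0.\<close>

lemma degeneracy_points_eq:
  assumes c: "stiffness_tensor c" "positive_definite c"
  shows "degeneracy_points c - {0} = {t *\<^sub>R p | t p. 0 < t \<and> singular_point (slowness_poly c) p}"
proof (intro equalityI subsetI)
  fix q assume "q \<in> degeneracy_points c - {0}"
  then obtain x where q: "q \<noteq> 0" and x: "multiple_eigenvalue (christoffel c q) x"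
    by (auto simp: degeneracy_points_def)
  then obtain u where u: "u \<noteq> 0" "christoffel c q *v u = x *\<^sub>R u"
    using multiple_eigenvalue_iff[OF transpose_christoffel[OF c(1)]] by metis
  have "0 < x * (u \<bullet> u)" using christoffel_pos_def[OF c u(1) q] u by simp
  then have "x > 0" using u by (metis inner_ge_zero mult_nonpos_nonneg not_le)
  have "multiple_eigenvalue (christoffel c (inverse (sqrt x) *\<^sub>R q)) 1"
    using multiple_eigenvalue_scale[OF c(1) x, of "inverse (sqrt x)"] \<open>x > 0\<close> by (simp add: power_inverse)
  then have "singular_point (slowness_poly c) (inverse (sqrt x) *\<^sub>R q)"
    using singular_point_slowness_iff[OF c(1)] by blast
  moreover have "q = sqrt x *\<^sub>R (inverse (sqrt x) *\<^sub>R q)" "0 < sqrt x" using \<open>x > 0\<close> by auto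
  ultimately show "q \<in> {t *\<^sub>R p | t p. 0 < t \<and> singular_point (slowness_poly c) p}" by blast
next
  fix q assume "q \<in> {t *\<^sub>R p | t p. 0 < t \<and> singular_point (slowness_poly c) p}"
  then obtain t p where q: "q = t *\<^sub>R p" "0 < t" "singular_point (slowness_poly c) p" by blast
  then have "multiple_eigenvalue (christoffel c q) (t\<^sup>2 * 1)"
    using singular_point_slowness_iff[OF c(1)] multiple_eigenvalue_scale[OF c(1)] by blast
  moreover have "p \<noteq> 0" using q slowness_poly_0[of c] by (auto simp: singular_point_def)
  ultimately show "q \<in> degeneracy_points c - {0}"
    using q by (auto simp: degeneracy_points_def)
qed


section \<open>Continuously differentiable functions\<close>

lemma Ck_on_cong:
  assumes "open S" "\<And>x. x \<in> S \<Longrightarrow> f x = g x" "Ck_on k S f"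
  shows "Ck_on k S g"
  using assms(2,3)
proof (induction k arbitrary: f g)
  case 0
  then show ?case using continuous_on_cong[of S S f g] by simp
next
  case (Suc k)
  have D: "(g has_derivative frechet_derivative f (at x)) (at x)" if "x \<in> S" for x
    by (rule has_derivative_transform_within_open[where f = f, OF _ \<open>open S\<close> that])
      (use Suc.prems that in \<open>auto simp: frechet_derivative_works[symmetric]\<close>)
  then have "frechet_derivative f (at x) v = frechet_derivative g (at x) v" if "x \<in> S" for x v
    using that frechet_derivative_at by metis
  then have "Ck_on k S (\<lambda>x. frechet_derivative g (at x) v)" for v
    by (rule Suc.IH) (use Suc.prems in auto)
  with D show ?case by (auto simp: differentiable_def)
qed

text \<open>\<open>Ck_on\<close> refers to \<open>frechet_derivative\<close>; this rule admits any
  explicit formula \<open>D\<close> for the derivative.\<close>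

lemma Ck_on_SucI:
  assumes "open S" "\<And>x. x \<in> S \<Longrightarrow> (f has_derivative D x) (at x)" "\<And>v. Ck_on k S (\<lambda>x. D x v)"
  shows "Ck_on (Suc k) S f"
proof -
  have "Ck_on k S (\<lambda>x. frechet_derivative f (at x) v)" for v
    by (rule Ck_on_cong[OF assms(1) _ assms(3)[of v]]) (metis assms(2) frechet_derivative_at)
  then show ?thesis using assms(2) by (auto simp: differentiable_def)
qed

lemma Ck_on_Suc_has_derivative:
  "Ck_on (Suc k) S f \<Longrightarrow> x \<in> S \<Longrightarrow> (f has_derivative frechet_derivative f (at x)) (at x)"
  by (simp add: frechet_derivative_works[symmetric])

lemma Ck_on_Suc_imp: "Ck_on (Suc k) S f \<Longrightarrow> Ck_on k S f"
proof (induction k arbitrary: f)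
  case 0
  then show ?case
    by (auto intro!: continuous_at_imp_continuous_on differentiable_imp_continuous_within)
next
  case (Suc k)
  then show ?case using Ck_on.simps(2) by blast
qed

lemma Ck_on_subset: "Ck_on k S f \<Longrightarrow> T \<subseteq> S \<Longrightarrow> Ck_on k T f"
  by (induction k arbitrary: f) (auto intro: continuous_on_subset)

lemma Ck_on_const: "open S \<Longrightarrow> Ck_on k S (\<lambda>_. c)"
  by (induction k arbitrary: c) (auto intro!: Ck_on_SucI[where D = "\<lambda>_ _. 0"])

lemma Ck_on_bounded_linear:
  assumes "open S" "bounded_linear f"
  shows "Ck_on k S f"
proof (cases k)
  case 0
  then show ?thesis using assms by (simp add: linear_continuous_on)
next
  case (Suc j)
  have "Ck_on (Suc j) S f"
    using assms by (intro Ck_on_SucI[where D = "\<lambda>_. f"] Ck_on_const bounded_linear_imp_has_derivative)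
  then show ?thesis using Suc by simp
qed

lemma Ck_on_add:
  assumes "open S"
  shows "Ck_on k S f \<Longrightarrow> Ck_on k S g \<Longrightarrow> Ck_on k S (\<lambda>x. f x + g x)"
proof (induction k arbitrary: f g)
  case 0
  then show ?case by (simp add: continuous_on_add)
next
  case (Suc k)
  show ?case
  proof (rule Ck_on_SucI[OF assms])
    fix x assume "x \<in> S"
    then show "((\<lambda>x. f x + g x) has_derivative
        (\<lambda>v. frechet_derivative f (at x) v + frechet_derivative g (at x) v)) (at x)"
      using Suc.prems by (intro has_derivative_add Ck_on_Suc_has_derivative)
  qed (use Suc in auto)
qed

lemma Ck_on_scaleR:
  fixes f :: "'a::euclidean_space \<Rightarrow> real" and g :: "'a \<Rightarrow> 'b::euclidean_space"
  assumes "open S"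
  shows "Ck_on k S f \<Longrightarrow> Ck_on k S g \<Longrightarrow> Ck_on k S (\<lambda>x. f x *\<^sub>R g x)"
proof (induction k arbitrary: f g)
  case 0
  then show ?case by (simp add: continuous_on_scaleR)
next
  case (Suc k)
  show ?case
  proof (rule Ck_on_SucI[OF assms])
    fix x assume "x \<in> S"
    then show "((\<lambda>x. f x *\<^sub>R g x) has_derivative
        (\<lambda>v. f x *\<^sub>R frechet_derivative g (at x) v + frechet_derivative f (at x) v *\<^sub>R g x)) (at x)"
      using Suc.prems by (intro has_derivative_scaleR Ck_on_Suc_has_derivative)
  next
    fix v
    show "Ck_on k S (\<lambda>x. f x *\<^sub>R frechet_derivative g (at x) v + frechet_derivative f (at x) v *\<^sub>R g x)"
      using Suc.prems Suc.prems[THEN Ck_on_Suc_imp] by (intro Ck_on_add[OF assms] Suc.IH) auto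
  qed
qed

lemma Ck_on_mult:
  fixes f g :: "'a::euclidean_space \<Rightarrow> real"
  assumes "open S" "Ck_on k S f" "Ck_on k S g"
  shows "Ck_on k S (\<lambda>x. f x * g x)"
  using Ck_on_scaleR[OF assms] by simp

lemma Ck_on_sum:
  assumes "open S" "\<And>i. i \<in> I \<Longrightarrow> Ck_on k S (f i)"
  shows "Ck_on k S (\<lambda>x. \<Sum>i\<in>I. f i x)"
  using assms(2) by (induction I rule: infinite_finite_induct) (auto intro: Ck_on_const Ck_on_add assms(1))

lemma Ck_on_prod:
  fixes f :: "'i \<Rightarrow> 'a::euclidean_space \<Rightarrow> real"
  assumes "open S" "\<And>i. i \<in> I \<Longrightarrow> Ck_on k S (f i)"
  shows "Ck_on k S (\<lambda>x. \<Prod>i\<in>I. f i x)"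
  using assms(2) by (induction I rule: infinite_finite_induct) (auto intro: Ck_on_const Ck_on_mult assms(1))

lemma Ck_on_power:
  fixes f :: "'a::euclidean_space \<Rightarrow> real"
  assumes "open S" "Ck_on k S f"
  shows "Ck_on k S (\<lambda>x. f x ^ m)"
  by (induction m) (auto intro: Ck_on_const Ck_on_mult assms)

lemma Ck_on_inverse:
  fixes f :: "'a::euclidean_space \<Rightarrow> real"
  assumes "open S" "\<And>x. x \<in> S \<Longrightarrow> f x \<noteq> 0"
  shows "Ck_on k S f \<Longrightarrow> Ck_on k S (\<lambda>x. inverse (f x))"
proof (induction k)
  case 0
  then show ?case using assms by (simp add: continuous_on_inverse)
next
  case (Suc k)
  have inv: "Ck_on k S (\<lambda>x. inverse (f x))" using Suc Ck_on_Suc_imp by blast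
  show ?case
  proof (rule Ck_on_SucI[OF assms(1)])
    fix x assume "x \<in> S"
    then show "((\<lambda>x. inverse (f x)) has_derivative
        (\<lambda>v. (- 1) * frechet_derivative f (at x) v * (inverse (f x) * inverse (f x)))) (at x)"
      using Deriv.has_derivative_inverse[OF assms(2) Ck_on_Suc_has_derivative[OF Suc.prems], of x]
      by (simp add: algebra_simps)
  next
    fix v
    show "Ck_on k S (\<lambda>x. (- 1) * frechet_derivative f (at x) v * (inverse (f x) * inverse (f x)))"
      using Suc.prems inv by (intro Ck_on_mult Ck_on_const assms(1)) auto
  qed
qed

lemma Ck_on_bounded_linear_compose:
  assumes h: "bounded_linear h" and S: "open S"
  shows "Ck_on k S f \<Longrightarrow> Ck_on k S (\<lambda>x. h (f x))"
proof (induction k arbitrary: f)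
  case 0
  then show ?case using h by (simp add: bounded_linear.continuous_on)
next
  case (Suc k)
  show ?case
  proof (rule Ck_on_SucI[OF S])
    fix x assume "x \<in> S"
    then show "((\<lambda>x. h (f x)) has_derivative (\<lambda>v. h (frechet_derivative f (at x) v))) (at x)"
      using Suc.prems by (intro bounded_linear.has_derivative[OF h] Ck_on_Suc_has_derivative)
  qed (use Suc in auto)
qed

lemma Ck_on_compose:
  fixes f :: "'a::euclidean_space \<Rightarrow> 'b::euclidean_space" and g :: "'b \<Rightarrow> 'c::euclidean_space"
  assumes "open S" "open T" "f ` S \<subseteq> T"
  shows "Ck_on k S f \<Longrightarrow> Ck_on k T g \<Longrightarrow> Ck_on k S (\<lambda>x. g (f x))"
proof (induction k arbitrary: g)
  case 0
  then show ?case using assms(3) by (auto intro: continuous_on_compose2)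
next
  case (Suc k)
  let ?Df = "\<lambda>x. frechet_derivative f (at x)" and ?Dg = "\<lambda>y. frechet_derivative g (at y)"
  show ?case
  proof (rule Ck_on_SucI[OF assms(1)])
    fix x assume x: "x \<in> S"
    then have "f x \<in> T" using assms by auto
    have dg: "(g has_derivative ?Dg (f x)) (at (f x))"
      using Suc.prems(2) \<open>f x \<in> T\<close> by (rule Ck_on_Suc_has_derivative)
    have comp: "((\<lambda>x. g (f x)) has_derivative (\<lambda>v. ?Dg (f x) (?Df x v))) (at x)"
      using has_derivative_compose[OF Ck_on_Suc_has_derivative[OF Suc.prems(1) x] dg] .
    \<comment> \<open>In the chain rule \<open>x\<close> occurs both in the linear map and in its
      argument. Expansion in a basis gives a sum of products with fixed directions for
      \<open>g\<close>, to which the induction hypothesis applies.\<close>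
    have "?Dg (f x) w = (\<Sum>b\<in>Basis. (w \<bullet> b) *\<^sub>R ?Dg (f x) b)" for w
    proof -
      have "?Dg (f x) w = ?Dg (f x) (\<Sum>b\<in>Basis. (w \<bullet> b) *\<^sub>R b)" by (simp add: euclidean_representation)
      then show ?thesis
        using has_derivative_linear[OF dg] by (simp add: linear_sum linear_cmul del: euclidean_representation)
    qed
    then have "(\<lambda>v. ?Dg (f x) (?Df x v)) = (\<lambda>v. \<Sum>b\<in>Basis. (?Df x v \<bullet> b) *\<^sub>R ?Dg (f x) b)"
      by (intro ext)
    with comp show "((\<lambda>x. g (f x)) has_derivative
        (\<lambda>v. \<Sum>b\<in>Basis. (?Df x v \<bullet> b) *\<^sub>R ?Dg (f x) b)) (at x)"
      by (simp only:)
  next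
    fix v
    have fk: "Ck_on k S f" using Suc.prems Ck_on_Suc_imp by blast
    have "Ck_on k S (\<lambda>x. ?Dg (f x) b)" for b
      using Suc.prems by (intro Suc.IH[OF fk]) auto
    moreover have "Ck_on k S (\<lambda>x. ?Df x v \<bullet> b)" for b
      using Suc.prems by (intro Ck_on_bounded_linear_compose[OF bounded_linear_inner_left] assms(1)) auto
    ultimately show "Ck_on k S (\<lambda>x. \<Sum>b\<in>Basis. (?Df x v \<bullet> b) *\<^sub>R ?Dg (f x) b)"
      by (intro Ck_on_sum Ck_on_scaleR assms(1))
  qed
qed

lemma Ck_on_mveval: "Ck_on k UNIV (mveval f)"
proof -
  have "mveval f = (\<lambda>p. \<Sum>m\<in>keys f. lookup f m * mono_eval m p)"
    by (rule ext) (rule mveval_superset, auto)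
  moreover have "Ck_on k UNIV (\<lambda>p. \<Sum>m\<in>keys f. lookup f m * mono_eval m p)"
    unfolding mono_eval_def
    by (intro Ck_on_sum Ck_on_mult Ck_on_const Ck_on_prod Ck_on_power open_UNIV
        Ck_on_bounded_linear[OF _ bounded_linear_vec_nth])
  ultimately show ?thesis by simp
qed

lemma Ck_on_deriv_mveval: "Ck_on k UNIV (\<lambda>x. poly (pderiv (line_poly x v f)) 0)"
proof -
  have "(\<lambda>x. poly (pderiv (line_poly x v f)) 0) = (\<lambda>x. frechet_derivative (mveval f) (at x) v)"
    by (rule ext) (simp only: frechet_derivative_at[OF has_derivative_mveval, symmetric])
  then show ?thesis using Ck_on_mveval[of "Suc k" f] by simp
qed

subsection \<open>Charts of a regular zero set\<close>

lemma linear_nonzero_axis: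
  fixes f :: "real ^ 'n \<Rightarrow> real"
  assumes "linear f" "f v \<noteq> 0"
  obtains k where "f (axis k 1) \<noteq> 0"
proof -
  have "f v = f (\<Sum>i\<in>UNIV. v $ i *\<^sub>R axis i 1)"
    using basis_expansion[of v] by (simp add: scalar_mult_eq_scaleR)
  also have "\<dots> = (\<Sum>i\<in>UNIV. v $ i * f (axis i 1))"
    using assms(1) by (simp add: linear_sum linear_cmul)
  finally show thesis using assms(2) that by (metis (no_types, lifting) mult_zero_right sum.neutral)
qed

text \<open>The chart \<open>x \<mapsto> x + (r x - x\<^sub>k) e\<^sub>k\<close> replaces a coordinate by the polynomial, and its
  inverse has the derivative \<open>w \<mapsto> w + ((w\<^sub>k - D w) / D e\<^sub>k) e\<^sub>k\<close>.\<close>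

lemma regular_zero_set_chart:
  fixes r :: "'n::finite mvpoly"
  assumes p: "mveval r p = 0" "\<not> singular_point r p" and M: "\<And>x. x \<in> M \<longleftrightarrow> mveval r x = 0"
  shows "\<exists>U V (\<phi> :: real ^ 'n \<Rightarrow> real ^ 'n) \<psi> S.
     open U \<and> p \<in> U \<and> open V \<and> homeomorphism U V \<phi> \<psi> \<and>
     smooth_on U \<phi> \<and> smooth_on V \<psi> \<and>
     subspace S \<and> dim S = CARD('n) - 1 \<and> \<phi> ` (U \<inter> M) = V \<inter> S"
proof -
  define D where "D = (\<lambda>x v. poly (pderiv (line_poly x v r)) 0)"
  have D: "(mveval r has_derivative D x) (at x)" for x
    unfolding D_def by (rule has_derivative_mveval)
  have linD: "linear (D x)" for x using D has_derivative_linear by blast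
  have CkD: "Ck_on k UNIV (\<lambda>x. D x v)" for k v
    unfolding D_def by (rule Ck_on_deriv_mveval)
  have contD: "continuous_on UNIV (\<lambda>x. D x v)" for v
    using CkD[of 0 v] by simp
  obtain v where "D p v \<noteq> 0"
    using p unfolding singular_point_iff D_def by blast
  then obtain k where k: "D p (axis k 1) \<noteq> 0" using linear_nonzero_axis[OF linD] by metis
  define e :: "real ^ 'n" where "e = axis k 1"
  have ek: "e $ k = 1" by (simp add: e_def axis_def)
  define \<phi> where "\<phi> = (\<lambda>x. x + (mveval r x - x $ k) *\<^sub>R e)"
  define \<phi>' where "\<phi>' = (\<lambda>x v. v + (D x v - v $ k) *\<^sub>R e)"
  define G where "G = (\<lambda>w x. w + ((w $ k - D x w) * inverse (D x e)) *\<^sub>R e)"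
  define W where "W = {x. D x e \<noteq> 0}"
  have "open W" unfolding W_def using contD by (intro open_Collect_neq continuous_on_const)
  have "p \<in> W" using k by (simp add: W_def e_def)
  have d\<phi>: "(\<phi> has_derivative \<phi>' x) (at x)" for x
    unfolding \<phi>_def \<phi>'_def
    by (intro has_derivative_add has_derivative_ident has_derivative_scaleR_left has_derivative_diff D
        bounded_linear_imp_has_derivative bounded_linear_vec_nth)
  then have bl: "bounded_linear (\<phi>' x)" for x using has_derivative_bounded_linear by blast
  have \<phi>'G: "\<phi>' x (G w x) = w" if "x \<in> W" for x w
  proof -
    define a where "a = (w $ k - D x w) * inverse (D x e)"
    have "a * D x e = w $ k - D x w" using that by (simp add: a_def W_def)
    moreover have "D x (w + a *\<^sub>R e) = D x w + a * D x e"
      using linD[of x] by (simp add: linear_add linear_cmul)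
    moreover have "G w x = w + a *\<^sub>R e" by (simp add: G_def a_def)
    ultimately show ?thesis
      by (simp add: \<phi>'_def ek algebra_simps)
  qed
  have G\<phi>': "G (\<phi>' x v) x = v" if "x \<in> W" for x v
  proof -
    define b where "b = D x v - v $ k"
    have "D x (v + b *\<^sub>R e) = D x v + b * D x e"
      using linD[of x] by (simp add: linear_add linear_cmul)
    moreover have "(v + b *\<^sub>R e) $ k = D x v" by (simp add: b_def ek)
    moreover have "\<phi>' x v = v + b *\<^sub>R e" by (simp add: \<phi>'_def b_def)
    ultimately show ?thesis using that by (simp add: G_def W_def)
  qed
  have linG: "bounded_linear (\<lambda>w. G w p)"
  proof (rule linear_conv_bounded_linear[THEN iffD1], rule linearI)
    show "G (u + v) p = G u p + G v p" for u v
      using linD[of p] by (simp add: G_def linear_add algebra_simps)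
    show "G (t *\<^sub>R v) p = t *\<^sub>R G v p" for t v
      using linD[of p] by (simp add: G_def linear_cmul algebra_simps)
  qed
  obtain U V \<psi> \<psi>' where U: "open U" "U \<subseteq> W" "p \<in> U" "open V" "homeomorphism U V \<phi> \<psi>"
    and d\<psi>: "\<And>y. y \<in> V \<Longrightarrow> (\<psi> has_derivative \<psi>' y) (at y)"
    and inv: "\<And>y. y \<in> V \<Longrightarrow> \<psi>' y = inv (blinfun_apply (Blinfun (\<phi>' (\<psi> y))))"
  proof (rule inverse_function_theorem[of W \<phi> "\<lambda>x. Blinfun (\<phi>' x)" p "Blinfun (\<lambda>w. G w p)"])
    show "continuous_on W (\<lambda>x. Blinfun (\<phi>' x))"
    proof (rule continuous_on_blinfun_componentwise)
      fix i :: "real ^ 'n"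
      have "continuous_on W (\<lambda>x. \<phi>' x i)"
        unfolding \<phi>'_def by (intro continuous_intros continuous_on_subset[OF contD]) auto
      then show "continuous_on W (\<lambda>x. blinfun_apply (Blinfun (\<phi>' x)) i)"
        by (simp add: bounded_linear_Blinfun_apply bl)
    qed
    show "Blinfun (\<lambda>w. G w p) o\<^sub>L Blinfun (\<phi>' p) = id_blinfun"
      by (rule blinfun_eqI) (simp add: bounded_linear_Blinfun_apply bl linG G\<phi>' \<open>p \<in> W\<close>)
  qed (use \<open>open W\<close> \<open>p \<in> W\<close> d\<phi> bl in \<open>auto simp: bounded_linear_Blinfun_apply\<close>)
  have \<psi>U: "\<psi> y \<in> U" if "y \<in> V" for y using U(5) that by (auto simp: homeomorphism_def)
  have \<psi>': "\<psi>' y w = G w (\<psi> y)" if "y \<in> V" for y w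
  proof -
    have W: "\<psi> y \<in> W" using \<psi>U[OF that] U by blast
    have "inj (\<phi>' (\<psi> y))" using G\<phi>'[OF W] by (metis injI)
    then have "inv (\<phi>' (\<psi> y)) w = G w (\<psi> y)" using \<phi>'G[OF W] by (rule inv_f_eq)
    then show ?thesis using inv[OF that] by (simp add: bounded_linear_Blinfun_apply bl)
  qed
  have "smooth_on U \<phi>"
    unfolding smooth_on_def
  proof
    fix j
    have "Ck_on j UNIV \<phi>"
      unfolding \<phi>_def diff_conv_add_uminus
      by (intro Ck_on_add Ck_on_scaleR Ck_on_const Ck_on_mveval Ck_on_bounded_linear open_UNIV
          bounded_linear_ident bounded_linear_minus bounded_linear_vec_nth)
    then show "Ck_on j U \<phi>" by (rule Ck_on_subset) simp
  qed
  moreover have "smooth_on V \<psi>"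
    unfolding smooth_on_def
  proof
    fix j
    \<comment> \<open>Bootstrapping: the derivative of \<open>\<psi>\<close> in the direction
      \<open>w\<close> is \<open>G w\<close> composed with \<open>\<psi>\<close>, and
      \<open>G w\<close> is smooth on \<open>U\<close>, so each order of differentiability yields
      the next.\<close>
    show "Ck_on j V \<psi>"
    proof (induction j)
      case 0
      then show ?case using U(5) by (simp add: homeomorphism_def)
    next
      case (Suc j)
      show ?case
      proof (rule Ck_on_SucI[OF \<open>open V\<close> d\<psi>])
        fix w
        have CkDU: "Ck_on j U (\<lambda>x. D x v)" for v by (rule Ck_on_subset[OF CkD]) simp
        have "Ck_on j U (\<lambda>x. G w x)"
          unfolding G_def diff_conv_add_uminus
          using U by (intro Ck_on_add Ck_on_scaleR Ck_on_mult Ck_on_inverse Ck_on_const CkDU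
            Ck_on_bounded_linear_compose[OF bounded_linear_minus[OF bounded_linear_ident]])
            (auto simp: W_def)
        then have "Ck_on j V (\<lambda>y. G w (\<psi> y))"
          using Ck_on_compose[OF \<open>open V\<close> \<open>open U\<close> _ Suc.IH] \<psi>U by blast
        then show "Ck_on j V (\<lambda>y. \<psi>' y w)"
          by (rule Ck_on_cong[OF \<open>open V\<close>, rotated]) (simp add: \<psi>')
      qed
    qed
  qed
  moreover have "\<phi> ` (U \<inter> M) = V \<inter> {y. e \<bullet> y = 0}"
  proof -
    have "e \<bullet> y = y $ k" for y by (simp add: e_def inner_axis')
    then have "e \<bullet> \<phi> x = mveval r x" for x by (simp add: \<phi>_def ek)
    then show ?thesis
      using U(5) M unfolding homeomorphism_def by (auto simp: image_iff)
  qed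
  moreover have "dim {y. e \<bullet> y = 0} = CARD('n) - 1"
  proof -
    have "e \<noteq> 0" using ek by auto
    then show ?thesis using dim_hyperplane[of e] by simp
  qed
  moreover have "subspace {y. e \<bullet> y = 0}" by (rule subspace_hyperplane)
  ultimately show ?thesis using U by blast
qed


section \<open>Real-rooted polynomials\<close>

text \<open>This excludes the zero polynomial, which has nonreal zeros.\<close>

definition real_rooted :: "real poly \<Rightarrow> bool" where
  "real_rooted P \<longleftrightarrow> (\<forall>z. poly (map_poly complex_of_real P) z = 0 \<longrightarrow> z \<in> \<real>)"

lemma map_poly_of_real_mult:
  "map_poly complex_of_real (P * Q) = map_poly complex_of_real P * map_poly complex_of_real Q"
  by (rule poly_eqI) (simp add: coeff_map_poly coeff_mult)

lemma map_poly_of_real_add: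
  "map_poly complex_of_real (P + Q) = map_poly complex_of_real P + map_poly complex_of_real Q"
  by (rule poly_eqI) (simp add: coeff_map_poly)

lemma poly_map_poly_of_real: "poly (map_poly complex_of_real P) (of_real t) = of_real (poly P t)"
  by (induction P) (auto simp: map_poly_pCons)

lemma real_rooted_mult: "real_rooted (P * Q) \<longleftrightarrow> real_rooted P \<and> real_rooted Q"
  by (auto simp: real_rooted_def map_poly_of_real_mult)

lemma real_rooted_factor:
  assumes "real_rooted P" "degree P = Suc n"
  obtains t Q where "P = [:- t, 1:] * Q" "real_rooted Q" "degree Q = n" "lead_coeff Q = lead_coeff P"
proof -
  have "degree (map_poly complex_of_real P) = Suc n"
    using assms(2) by (subst degree_map_poly) auto
  then have "\<not> constant (poly (map_poly complex_of_real P))"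
    by (simp add: constant_degree)
  then obtain z where z: "poly (map_poly complex_of_real P) z = 0"
    using fundamental_theorem_of_algebra by blast
  then obtain t where "z = of_real t" using assms(1) by (auto simp: real_rooted_def elim: Reals_cases)
  then have "poly P t = 0" using z by (simp add: poly_map_poly_of_real)
  then obtain Q where Q: "P = [:- t, 1:] * Q" by (auto simp: poly_eq_0_iff_dvd elim: dvdE)
  have "Q \<noteq> 0" using Q assms(2) by auto
  then have "degree P = Suc (degree Q)" unfolding Q by (subst degree_mult_eq) auto
  moreover have "lead_coeff P = lead_coeff Q" unfolding Q by (subst lead_coeff_mult) simp
  moreover have "real_rooted Q" using assms(1) unfolding Q real_rooted_mult by blast
  ultimately show thesis using that Q assms(2) by simp
qed

text \<open>With roots \<open>t_i\<close>, the value at 1 is the leading coefficient times the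
  product of the \<open>1 - t_i\<close>, and the logarithmic derivative is the sum of their
  inverses; each \<open>1 - t_i\<close> has absolute value at least \<open>\<delta>\<close>. The
  induction splits off one root at a time.\<close>

lemma real_rooted_roots_far:
  fixes \<delta> :: real
  assumes "real_rooted P" "degree P = n" "\<delta> > 0" "\<And>t. poly P t = 0 \<Longrightarrow> \<delta> \<le> \<bar>t - 1\<bar>"
  shows "\<bar>lead_coeff P\<bar> * \<delta> ^ n \<le> \<bar>poly P 1\<bar> \<and> \<bar>poly (pderiv P) 1\<bar> \<le> \<bar>poly P 1\<bar> * (n / \<delta>)"
  using assms(1,2,4)
proof (induction n arbitrary: P)
  case 0
  then obtain a where "P = [:a:]" by (metis degree_eq_zeroE)
  then show ?case by simp
next
  case (Suc n)
  obtain t Q where Q: "P = [:- t, 1:] * Q" "real_rooted Q" "degree Q = n" "lead_coeff Q = lead_coeff P"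
    using real_rooted_factor[OF Suc.prems(1,2)] by metis
  have "\<delta> \<le> \<bar>s - 1\<bar>" if "poly Q s = 0" for s using that Suc.prems(3) Q(1) by simp
  then have IH: "\<bar>lead_coeff P\<bar> * \<delta> ^ n \<le> \<bar>poly Q 1\<bar>" "\<bar>poly (pderiv Q) 1\<bar> \<le> \<bar>poly Q 1\<bar> * (n / \<delta>)"
    using Suc.IH[OF Q(2,3)] Q(4) by auto
  have t: "\<delta> \<le> \<bar>1 - t\<bar>" using Suc.prems(3)[of t] Q(1) by simp
  have P1: "poly P 1 = (1 - t) * poly Q 1" by (simp add: Q(1) algebra_simps)
  have P1': "poly (pderiv P) 1 = poly Q 1 + (1 - t) * poly (pderiv Q) 1"
    by (simp only: Q(1) pderiv_mult) (simp add: pderiv_pCons algebra_simps)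
  have "\<bar>lead_coeff P\<bar> * \<delta> ^ Suc n \<le> \<bar>poly P 1\<bar>"
    using mult_mono[OF t IH(1)] \<open>\<delta> > 0\<close> by (simp add: P1 abs_mult ac_simps)
  moreover have "\<bar>poly (pderiv P) 1\<bar> \<le> \<bar>poly P 1\<bar> * (Suc n / \<delta>)"
  proof -
    have P1abs: "\<bar>poly P 1\<bar> = \<bar>1 - t\<bar> * \<bar>poly Q 1\<bar>" by (simp add: P1 abs_mult)
    have "\<bar>poly (pderiv P) 1\<bar> \<le> \<bar>poly Q 1\<bar> + \<bar>1 - t\<bar> * \<bar>poly (pderiv Q) 1\<bar>"
      unfolding P1' by (metis abs_triangle_ineq abs_mult)
    moreover have "\<bar>1 - t\<bar> * \<bar>poly (pderiv Q) 1\<bar> \<le> \<bar>1 - t\<bar> * (\<bar>poly Q 1\<bar> * (n / \<delta>))"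
      by (intro mult_left_mono IH) simp
    moreover have "\<bar>poly Q 1\<bar> \<le> \<bar>poly P 1\<bar> * (1 / \<delta>)"
      unfolding P1abs using mult_right_mono[OF t, of "\<bar>poly Q 1\<bar>"] \<open>\<delta> > 0\<close>
      by (simp add: pos_le_divide_eq mult.commute)
    ultimately have "\<bar>poly (pderiv P) 1\<bar> \<le> \<bar>poly P 1\<bar> * (1 / \<delta>) + \<bar>poly P 1\<bar> * (n / \<delta>)"
      unfolding P1abs by (simp only: mult.assoc)
    also have "\<dots> = \<bar>poly P 1\<bar> * (Suc n / \<delta>)"
      by (simp add: add_divide_distrib distrib_left)
    finally show ?thesis .
  qed
  ultimately show ?case by blast
qed

lemma real_rooted_near_root:
  fixes \<delta> :: real
  assumes "real_rooted P" "\<delta> > 0" "\<bar>poly P 1\<bar> < \<bar>lead_coeff P\<bar> * \<delta> ^ degree P"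
  obtains t where "\<bar>t - 1\<bar> < \<delta>" "poly P t = 0"
  using real_rooted_roots_far[OF assms(1) refl assms(2)] assms(3) by (metis not_less)

lemma real_rooted_two_near_roots:
  fixes \<delta> :: real
  assumes P: "real_rooted P" "degree P = Suc n" and "\<delta> > 0"
    and "\<bar>poly P 1\<bar> < \<bar>lead_coeff P\<bar> * (\<delta> / (2 * real (Suc n))) ^ Suc n"
    and "\<bar>poly (pderiv P) 1\<bar> < \<bar>lead_coeff P\<bar> * \<delta> ^ n / 2"
  obtains t1 t2 where "\<bar>t1 - 1\<bar> < \<delta>" "\<bar>t2 - 1\<bar> < \<delta>" "poly P t1 = 0" "poly P t2 = 0"
    "t1 = t2 \<Longrightarrow> poly (pderiv P) t1 = 0"
proof -
  \<comment> \<open>Small enough that \<open>(1 - t1) * Q'(1)\<close> is at most half of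
    \<open>Q(1)\<close> in absolute value if \<open>Q\<close>, the cofactor of the root
    \<open>t1\<close>, has no root within \<open>\<delta>\<close> of 1. Then the derivative of
    \<open>P\<close> at 1 would be too large.\<close>
  define \<delta>' where "\<delta>' = \<delta> / (2 * real (Suc n))"
  have \<delta>': "0 < \<delta>'" using \<open>\<delta> > 0\<close> by (simp add: \<delta>'_def)
  have le: "\<delta>' * Suc n = \<delta> / 2" 
  proof -
    have "\<delta> / (2 * x) * x = \<delta> / 2" if "x \<noteq> 0" for x :: real using that by (simp add: field_simps)
    then show ?thesis unfolding \<delta>'_def by (metis nat.distinct(1) of_nat_eq_0_iff)
  qed
  have "\<delta>' \<le> \<delta>' * Suc n" using \<delta>' by (simp add: algebra_simps)
  then have "\<delta>' < \<delta>" using le \<open>\<delta> > 0\<close> by simp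
  obtain t1 where t1: "\<bar>t1 - 1\<bar> < \<delta>'" "poly P t1 = 0"
    using real_rooted_near_root[OF P(1) \<delta>'] assms(4) P(2) unfolding \<delta>'_def by metis
  then obtain Q where Q: "P = [:- t1, 1:] * Q" by (auto simp: poly_eq_0_iff_dvd elim: dvdE)
  have "Q \<noteq> 0" using Q P(2) by auto
  then have "degree P = Suc (degree Q)" unfolding Q by (subst degree_mult_eq) auto
  then have dQ: "degree Q = n" using P by simp
  have lQ: "lead_coeff P = lead_coeff Q" unfolding Q by (subst lead_coeff_mult) simp
  have rQ: "real_rooted Q" using P Q real_rooted_mult by blast
  have dP: "poly (pderiv P) s = poly Q s + (s - t1) * poly (pderiv Q) s" for s
    by (simp only: Q pderiv_mult) (simp add: pderiv_pCons algebra_simps)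
  have "\<exists>t2. \<bar>t2 - 1\<bar> < \<delta> \<and> poly Q t2 = 0"
  proof (rule ccontr)
    assume "\<not> ?thesis"
    then have far: "\<bar>lead_coeff P\<bar> * \<delta> ^ n \<le> \<bar>poly Q 1\<bar>" "\<bar>poly (pderiv Q) 1\<bar> \<le> \<bar>poly Q 1\<bar> * (n / \<delta>)"
      using real_rooted_roots_far[OF rQ dQ \<open>\<delta> > 0\<close>] lQ by (auto simp: not_less)
    have "\<bar>(1 - t1) * poly (pderiv Q) 1\<bar> \<le> \<delta>' * (\<bar>poly Q 1\<bar> * (n / \<delta>))"
      unfolding abs_mult using t1 far \<delta>' by (intro mult_mono) auto
    also have "\<dots> \<le> \<delta>' * (\<bar>poly Q 1\<bar> * (Suc n / \<delta>))"
      using \<delta>' \<open>\<delta> > 0\<close> by (intro mult_left_mono divide_right_mono) auto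
    also have "\<dots> = (\<delta>' * Suc n) * (\<bar>poly Q 1\<bar> / \<delta>)" by simp
    also have "\<dots> = \<bar>poly Q 1\<bar> / 2" unfolding le using \<open>\<delta> > 0\<close> by simp
    finally have "\<bar>poly Q 1\<bar> / 2 \<le> \<bar>poly (pderiv P) 1\<bar>" unfolding dP by linarith
    with far(1) assms(5) show False by simp
  qed
  then obtain t2 where t2: "\<bar>t2 - 1\<bar> < \<delta>" "poly Q t2 = 0" by blast
  then have "poly P t2 = 0" by (simp add: Q)
  then show thesis
    by (rule that[of t1 t2, rotated 3]) (use t1 t2 \<open>\<delta>' < \<delta>\<close> in \<open>auto simp: dP\<close>)
qed

subsection \<open>Rays and the slowness surface\<close>

lemma ray_poly_slowness:
  "line_poly 0 p (slowness_poly c) =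
    det (\<chi> i j. [:- (if i = j then 1 else 0), 0, christoffel c p $ i $ j:])"
proof (subst poly_eq_poly_eq_iff[symmetric], rule ext)
  fix t
  have "poly (det (\<chi> i j. [:- (if i = j then 1 else 0), 0, christoffel c p $ i $ j:])) t =
      det (\<chi> i j. poly ((\<chi> i j. [:- (if i = j then 1 else 0), 0, christoffel c p $ i $ j:]) $ i $ j) t)"
    by (rule det_hom) auto
  also have "(\<chi> i j. poly ((\<chi> i j. [:- (if i = j then 1 else 0), 0, christoffel c p $ i $ j:]) $ i $ j) t) =
      t\<^sup>2 *\<^sub>R christoffel c p - mat 1"
    by (simp add: vec_eq_iff mat_def power2_eq_square)
  finally show "poly (line_poly 0 p (slowness_poly c)) t =
      poly (det (\<chi> i j. [:- (if i = j then 1 else 0), 0, christoffel c p $ i $ j:])) t"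
    by (simp add: mveval_slowness_poly christoffel_scaleR)
qed

text \<open>A complex zero \<open>z\<close> gives \<open>w \<noteq> 0\<close> with \<open>z\<^sup>2 \<Gamma> w = w\<close>; pairing with \<open>w\<close> shows that
  \<open>z\<^sup>2\<close> is real and positive.\<close>

lemma real_rooted_ray_slowness:
  fixes c :: "'n::finite tensor4"
  assumes c: "stiffness_tensor c" "positive_definite c" and p: "p \<noteq> 0"
  shows "real_rooted (line_poly 0 p (slowness_poly c))"
  unfolding real_rooted_def
proof (intro allI impI)
  fix z assume z: "poly (map_poly complex_of_real (line_poly 0 p (slowness_poly c))) z = 0"
  define a where "a = (\<lambda>i j. christoffel c p $ i $ j)"
  have sym: "a i j = a j i" for i j
    using transpose_christoffel[OF c(1), of p] unfolding a_def transpose_def by (metis vec_lambda_beta)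
  let ?h = "\<lambda>P. poly (map_poly complex_of_real P) z"
  let ?M = "\<chi> i j. ?h ((\<chi> i j. [:- (if i = j then 1 else 0), 0, a i j:]) $ i $ j) :: complex ^ 'n ^ 'n"
  have "?h (line_poly 0 p (slowness_poly c)) = det ?M"
    unfolding ray_poly_slowness a_def
    by (rule det_hom) (auto simp: map_poly_of_real_add map_poly_of_real_mult)
  then have "det ?M = 0" using z by simp
  then obtain w where w: "w \<noteq> 0" "?M *v w = 0" using det_eq_0_iff_kernel by blast
  have eig: "z\<^sup>2 * (\<Sum>j\<in>UNIV. of_real (a i j) * w $ j) = w $ i" for i
  proof -
    have "0 = (\<Sum>j\<in>UNIV. ?h [:- (if i = j then 1 else 0), 0, a i j:] * w $ j)"
      using w(2) by (simp add: vec_eq_iff matrix_vector_mult_def)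
    also have "\<dots> = (\<Sum>j\<in>UNIV. z\<^sup>2 * (of_real (a i j) * w $ j) - (if i = j then w $ j else 0))"
      by (intro sum.cong refl) (auto simp: map_poly_pCons power2_eq_square algebra_simps)
    also have "\<dots> = z\<^sup>2 * (\<Sum>j\<in>UNIV. of_real (a i j) * w $ j) - w $ i"
      by (simp add: sum_subtractf sum_distrib_left)
    finally show ?thesis by simp
  qed
  \<comment> \<open>By symmetry of the Christoffel matrix, the Hermitian form at \<open>w\<close> is
    the sum of the real quadratic forms at its real part \<open>x\<close> and its imaginary part
    \<open>y\<close>.\<close>
  define x y :: "real ^ 'n" where "x = (\<chi> i. Re (w $ i))" and "y = (\<chi> i. Im (w $ i))"
  define S where "S = (\<Sum>i\<in>UNIV. cnj (w $ i) * (\<Sum>j\<in>UNIV. of_real (a i j) * w $ j))"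
  define T where "T = x \<bullet> (christoffel c p *v x) + y \<bullet> (christoffel c p *v y)"
  have "S = of_real T"
  proof (rule complex_eqI)
    have "Re S = (\<Sum>i\<in>UNIV. \<Sum>j\<in>UNIV. a i j * (x $ i * x $ j) + a i j * (y $ i * y $ j))"
      by (simp add: S_def x_def y_def sum_distrib_left algebra_simps)
    also have "\<dots> = T"
      by (simp add: T_def inner_vec_def matrix_vector_mult_def a_def sum_distrib_left sum.distrib algebra_simps)
    finally show "Re S = Re (of_real T)" by simp
    have "Im S = (\<Sum>i\<in>UNIV. \<Sum>j\<in>UNIV. a i j * (x $ i * y $ j)) - (\<Sum>i\<in>UNIV. \<Sum>j\<in>UNIV. a i j * (y $ i * x $ j))"
      by (simp add: S_def x_def y_def sum_distrib_left sum_subtractf[symmetric] algebra_simps)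
    also have "(\<Sum>i\<in>UNIV. \<Sum>j\<in>UNIV. a i j * (y $ i * x $ j)) = (\<Sum>j\<in>UNIV. \<Sum>i\<in>UNIV. a i j * (y $ i * x $ j))"
      by (rule sum.swap)
    also have "\<dots> = (\<Sum>i\<in>UNIV. \<Sum>j\<in>UNIV. a i j * (x $ i * y $ j))"
      by (intro sum.cong refl) (metis mult.commute sym)
    finally show "Im S = Im (of_real T)" by simp
  qed
  have "z\<^sup>2 * S = (\<Sum>i\<in>UNIV. cnj (w $ i) * (z\<^sup>2 * (\<Sum>j\<in>UNIV. of_real (a i j) * w $ j)))"
    by (simp add: S_def sum_distrib_left algebra_simps)
  also have "\<dots> = (\<Sum>i\<in>UNIV. cnj (w $ i) * w $ i)" by (simp only: eig)
  also have "\<dots> = of_real (\<Sum>i\<in>UNIV. (cmod (w $ i))\<^sup>2)"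
    by (simp add: complex_norm_square mult.commute del: of_real_power)
  finally have zS: "z\<^sup>2 * of_real T = of_real (\<Sum>i\<in>UNIV. (cmod (w $ i))\<^sup>2)"
    using \<open>S = of_real T\<close> by simp
  have "x \<noteq> 0 \<or> y \<noteq> 0"
    using w(1) by (auto simp: x_def y_def vec_eq_iff complex_eq_iff)
  then have "T > 0"
    using christoffel_pos_def[OF c _ p, of x] christoffel_pos_def[OF c _ p, of y]
    by (cases "x = 0"; cases "y = 0") (auto simp: T_def)
  then have "z\<^sup>2 = of_real ((\<Sum>i\<in>UNIV. (cmod (w $ i))\<^sup>2) / T)"
    using zS by (simp add: field_simps)
  then obtain s where s: "z\<^sup>2 = of_real s" "s \<ge> 0"
    using \<open>T > 0\<close> by (blast intro: divide_nonneg_pos sum_nonneg zero_le_power2)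
  then have "Re z = 0 \<or> Im z = 0" "(Re z)\<^sup>2 - (Im z)\<^sup>2 = s"
    by (auto simp: complex_eq_iff power2_eq_square)
  moreover from this(2) have "(Im z)\<^sup>2 \<le> (Re z)\<^sup>2" using s(2) by linarith
  ultimately have "Im z = 0" by auto
  then show "z \<in> \<real>" by (simp add: complex_is_Real_iff)
qed

text \<open>Reversal of coefficients: with \<open>u = 1/t\<close>,
  \<open>det (t^2 \<Gamma> - 1)\<close> equals \<open>t^(2n) det (\<Gamma> - u^2)\<close>, and the
  last determinant is a polynomial \<open>R\<close> in \<open>u\<close> with nonzero constant term
  \<open>det \<Gamma>\<close>.\<close>

lemma degree_ray_slowness:
  fixes c :: "'n::finite tensor4"
  assumes c: "stiffness_tensor c" "positive_definite c" and p: "p \<noteq> 0"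
  shows "degree (line_poly 0 p (slowness_poly c)) = 2 * CARD('n)"
proof -
  let ?L = "line_poly 0 p (slowness_poly c)" and ?n = "CARD('n)"
  define R where "R = det (\<chi> i j. [:christoffel c p $ i $ j, 0, - (if i = j then 1 else 0):])"
  have R: "poly R u = det (christoffel c p - mat (u\<^sup>2))" for u
  proof -
    have "poly R u = det (\<chi> i j. poly ((\<chi> i j. [:christoffel c p $ i $ j, 0, - (if i = j then 1 else 0):]) $ i $ j) u)"
      unfolding R_def by (rule det_hom) auto
    also have "(\<chi> i j. poly ((\<chi> i j. [:christoffel c p $ i $ j, 0, - (if i = j then 1 else 0):]) $ i $ j) u) =
        christoffel c p - mat (u\<^sup>2)"
      by (simp add: vec_eq_iff mat_def power2_eq_square)
    finally show ?thesis .
  qed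
  have "poly R 0 \<noteq> 0"
  proof
    assume "poly R 0 = 0"
    then obtain v where v: "v \<noteq> 0" "(christoffel c p - mat (0\<^sup>2)) *v v = 0"
      unfolding R using det_eq_0_iff_kernel by blast
    then have "christoffel c p *v v = 0"
      by (simp add: matrix_vector_mult_diff_rdistrib mat_mult_vec)
    then show False using christoffel_pos_def[OF c v(1) p] by simp
  qed
  then have R0: "coeff R 0 \<noteq> 0" "R \<noteq> 0" by (auto simp: poly_0_coeff_0)
  \<comment> \<open>A power of \<open>t\<close> clears the denominators in \<open>R (1/t)\<close>;
    agreement at all \<open>t \<noteq> 0\<close> then makes the two polynomials equal.\<close>
  have "poly (monom 1 (degree R) * ?L) t = poly (monom 1 (2 * ?n) * reflect_poly R) t" if "t \<noteq> 0" for t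
  proof -
    have "t\<^sup>2 *\<^sub>R christoffel c p - mat 1 = t\<^sup>2 *\<^sub>R (christoffel c p - mat ((inverse t)\<^sup>2))"
      using that by (simp add: vec_eq_iff mat_def power_inverse algebra_simps)
    then have "poly ?L t = t ^ (2 * ?n) * poly R (inverse t)"
      by (simp add: mveval_slowness_poly christoffel_scaleR det_scaleR_matrix R power_mult del: power_inverse)
    then show ?thesis using that by (simp add: poly_monom poly_reflect_poly_nz del: poly_line_poly)
  qed
  then have "- {0} \<subseteq> {t. poly (monom 1 (degree R) * ?L - monom 1 (2 * ?n) * reflect_poly R) t = 0}"
    by auto
  moreover have "infinite (- {0 :: real})" by (simp add: infinite_UNIV_char_0 Compl_eq_Diff_UNIV)
  ultimately have "infinite {t. poly (monom 1 (degree R) * ?L - monom 1 (2 * ?n) * reflect_poly R) t = 0}"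
    using finite_subset by blast
  then have eq: "monom 1 (degree R) * ?L = monom 1 (2 * ?n) * reflect_poly R"
    by (metis eq_iff_diff_eq_0 poly_roots_finite)
  have "?L \<noteq> 0"
    using slowness_poly_0[of c] by (metis poly_line_poly poly_0 add_0 scaleR_zero_left)
  then have "degree R + degree ?L = 2 * ?n + degree (reflect_poly R)"
    using arg_cong[OF eq, of degree] R0 by (simp add: degree_mult_eq degree_monom_eq monom_eq_0_iff)
  then show ?thesis using R0 by (simp add: degree_reflect_poly_eq)
qed

text \<open>On a ray the degrees of the two factors add up to \<open>2 n\<close>. Neither can drop
  near \<open>p\<close>, because its leading coefficient at \<open>p\<close> stays nonzero by
  continuity; so neither can grow. Half of that coefficient is the bound \<open>a\<close>.\<close>

lemma slowness_factor_ray: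
  fixes c :: "'n::finite tensor4"
  assumes c: "stiffness_tensor c" "positive_definite c" and gh: "slowness_poly c = g * h" and p: "p \<noteq> 0"
  shows "\<exists>a>0. \<forall>\<^sub>F q in nhds p. real_rooted (line_poly 0 q g) \<and>
    degree (line_poly 0 q g) = degree (line_poly 0 p g) \<and> a \<le> \<bar>lead_coeff (line_poly 0 q g)\<bar>"
proof -
  have line: "line_poly 0 q (slowness_poly c) = line_poly 0 q g * line_poly 0 q h" for q
    by (simp add: gh line_poly_mult)
  have nz: "line_poly 0 q g \<noteq> 0 \<and> line_poly 0 q h \<noteq> 0" for q
    using slowness_poly_0[of c] line[of q]
    by (metis mult_eq_0_iff poly_line_poly poly_0 add_0 scaleR_zero_left)
  have deg: "degree (line_poly 0 q g) + degree (line_poly 0 q h) = 2 * CARD('n)" if "q \<noteq> 0" for q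
    using degree_ray_slowness[OF c that] nz[of q] by (simp add: line degree_mult_eq)
  define l where "l = \<bar>lead_coeff (line_poly 0 p g)\<bar>"
  have lower: "\<forall>\<^sub>F q in nhds p. \<bar>lead_coeff (line_poly 0 p f)\<bar> / 2 < \<bar>coeff (line_poly 0 q f) (degree (line_poly 0 p f))\<bar>"
    if "line_poly 0 p f \<noteq> 0" for f
  proof -
    have "isCont (\<lambda>q. \<bar>coeff (line_poly 0 q f) (degree (line_poly 0 p f))\<bar>) p"
      using continuous_on_coeff_ray_poly[of UNIV f] by (auto simp: continuous_on_eq_continuous_at intro!: continuous_intros)
    then show ?thesis
      using that
      by (intro order_tendstoD(1)[OF tendsto_at_iff_tendsto_nhds[THEN iffD1, OF isCont_def[THEN iffD1]]]) auto
  qed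
  have "\<forall>\<^sub>F q in nhds p. q \<noteq> 0"
    using p t1_space_nhds by blast
  then have "\<forall>\<^sub>F q in nhds p. real_rooted (line_poly 0 q g) \<and>
    degree (line_poly 0 q g) = degree (line_poly 0 p g) \<and> l / 2 \<le> \<bar>lead_coeff (line_poly 0 q g)\<bar>"
    using lower[OF conjunct1[OF nz]] lower[OF conjunct2[OF nz]]
  proof eventually_elim
    case (elim q)
    have "degree (line_poly 0 p g) \<le> degree (line_poly 0 q g)"
      using elim nz[of p] by (intro le_degree) auto
    moreover have "degree (line_poly 0 p h) \<le> degree (line_poly 0 q h)"
      using elim nz[of p] by (intro le_degree) auto
    ultimately have "degree (line_poly 0 q g) = degree (line_poly 0 p g)"
      using deg[OF p] deg[OF elim(1)] by linarith
    moreover have "real_rooted (line_poly 0 q g)"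
      using real_rooted_ray_slowness[OF c elim(1)] by (simp add: line real_rooted_mult)
    ultimately show ?case using elim by (simp add: l_def)
  qed
  moreover have "l / 2 > 0" using nz[of p] by (simp add: l_def)
  ultimately show ?thesis by blast
qed

section \<open>Persistence of roots on neighbouring rays\<close>

lemma eventually_mveval_less:
  assumes "mveval f p = 0" "0 < e"
  shows "\<forall>\<^sub>F q in nhds p. \<bar>mveval f q\<bar> < e"
proof -
  have "isCont (\<lambda>q. \<bar>mveval f q\<bar>) p"
    using continuous_on_mveval[of UNIV "\<lambda>x. x" f]
    by (auto simp: continuous_on_eq_continuous_at intro!: continuous_intros)
  then show ?thesis
    using assms
    by (intro order_tendstoD(2)[OF tendsto_at_iff_tendsto_nhds[THEN iffD1, OF isCont_def[THEN iffD1]]]) auto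
qed

text \<open>Near \<open>p\<close> the value at \<open>t = 1\<close> is small while the leading
  coefficient stays away from 0; a real-rooted polynomial is that small only close to a
  root.\<close>

lemma ray_root_persists:
  fixes c :: "'n::finite tensor4"
  assumes c: "stiffness_tensor c" "positive_definite c" and gh: "slowness_poly c = g * h"
    and p: "mveval g p = 0" and e: "e > 0"
  shows "\<forall>\<^sub>F q in nhds p. \<exists>t. \<bar>t - 1\<bar> < e \<and> mveval g (t *\<^sub>R q) = 0"
proof -
  have "p \<noteq> 0" using p gh slowness_poly_0[of c] by auto
  from slowness_factor_ray[OF c gh this] obtain a where a: "a > 0"
    "\<forall>\<^sub>F q in nhds p. real_rooted (line_poly 0 q g) \<and>
      degree (line_poly 0 q g) = degree (line_poly 0 p g) \<and> a \<le> \<bar>lead_coeff (line_poly 0 q g)\<bar>"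
    by blast
  let ?d = "degree (line_poly 0 p g)"
  have "\<forall>\<^sub>F q in nhds p. \<bar>mveval g q\<bar> < a * e ^ ?d"
    using p a e by (intro eventually_mveval_less) auto
  with a(2) show ?thesis
  proof eventually_elim
    case (elim q)
    have "a * e ^ ?d \<le> \<bar>lead_coeff (line_poly 0 q g)\<bar> * e ^ ?d"
      using elim e by (intro mult_right_mono) auto
    then have "\<bar>poly (line_poly 0 q g) 1\<bar> < \<bar>lead_coeff (line_poly 0 q g)\<bar> * e ^ degree (line_poly 0 q g)"
      using elim by simp
    then obtain t where "\<bar>t - 1\<bar> < e" "poly (line_poly 0 q g) t = 0"
      using elim e by (auto elim: real_rooted_near_root)
    then show ?case by auto
  qed
qed

text \<open>Value and derivative at \<open>t = 1\<close> are both small near \<open>p\<close>, which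
  forces two roots close to 1. The last conjunct records that they form a double root if they
  coincide.\<close>

lemma double_ray_root_persists:
  fixes c :: "'n::finite tensor4"
  assumes c: "stiffness_tensor c" "positive_definite c" and gh: "slowness_poly c = g * h"
    and p: "mveval g p = 0" "mveval (euler_op g) p = 0" and e: "e > 0"
  shows "\<forall>\<^sub>F q in nhds p. \<exists>t1 t2. \<bar>t1 - 1\<bar> < e \<and> \<bar>t2 - 1\<bar> < e \<and>
    mveval g (t1 *\<^sub>R q) = 0 \<and> mveval g (t2 *\<^sub>R q) = 0 \<and>
    (t1 = t2 \<longrightarrow> poly (pderiv (line_poly 0 q g)) t1 = 0)"
proof -
  have "p \<noteq> 0" using p gh slowness_poly_0[of c] by auto
  from slowness_factor_ray[OF c gh this] obtain a where a: "a > 0"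
    "\<forall>\<^sub>F q in nhds p. real_rooted (line_poly 0 q g) \<and>
      degree (line_poly 0 q g) = degree (line_poly 0 p g) \<and> a \<le> \<bar>lead_coeff (line_poly 0 q g)\<bar>"
    by blast
  have "degree (line_poly 0 p g) \<noteq> 0"
  proof
    assume "degree (line_poly 0 p g) = 0"
    then obtain b where b: "line_poly 0 p g = [:b:]" by (metis degree_eq_zeroE)
    then have "poly (line_poly 0 p g) 0 = poly (line_poly 0 p g) 1" by simp
    then have "mveval g 0 = 0" using p by simp
    then show False using gh slowness_poly_0[of c] by simp
  qed
  then obtain n where n: "degree (line_poly 0 p g) = Suc n" by (metis not0_implies_Suc)
  have "\<forall>\<^sub>F q in nhds p. \<bar>mveval g q\<bar> < a * (e / (2 * real (Suc n))) ^ Suc n"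
    using p a e by (intro eventually_mveval_less) auto
  moreover have "\<forall>\<^sub>F q in nhds p. \<bar>mveval (euler_op g) q\<bar> < a * e ^ n / 2"
    using p a e by (intro eventually_mveval_less) auto
  ultimately show ?thesis using a(2)
  proof eventually_elim
    case (elim q)
    let ?P = "line_poly 0 q g"
    have "a * (e / (2 * real (Suc n))) ^ Suc n \<le> \<bar>lead_coeff ?P\<bar> * (e / (2 * real (Suc n))) ^ Suc n"
      using elim e by (intro mult_right_mono) auto
    then have 1: "\<bar>poly ?P 1\<bar> < \<bar>lead_coeff ?P\<bar> * (e / (2 * real (Suc n))) ^ Suc n"
      using elim by simp
    have "a * e ^ n / 2 \<le> \<bar>lead_coeff ?P\<bar> * e ^ n / 2"
      using elim e by (intro mult_right_mono divide_right_mono) auto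
    then have 2: "\<bar>poly (pderiv ?P) 1\<bar> < \<bar>lead_coeff ?P\<bar> * e ^ n / 2"
      using elim unfolding mveval_euler_op by simp
    have "degree ?P = Suc n" "real_rooted ?P" using elim n by auto
    from real_rooted_two_near_roots[OF this(2,1) e 1 2]
    obtain t1 t2 where "\<bar>t1 - 1\<bar> < e" "\<bar>t2 - 1\<bar> < e" "poly ?P t1 = 0" "poly ?P t2 = 0"
      "t1 = t2 \<Longrightarrow> poly (pderiv ?P) t1 = 0" by metis
    then show ?case by (intro exI[of _ t1] exI[of _ t2]) auto
  qed
qed


section \<open>Smooth hypersurfaces\<close>

text \<open>The chart straightens \<open>M\<close> to a hyperplane orthogonal to some
  \<open>a\<close>, so \<open>a \<bullet> \<phi>\<close> defines \<open>M\<close>. Its differential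
  at \<open>p\<close> is nonzero on some coordinate axis, and the sign \<open>\<sigma>\<close> makes
  it increase along that axis.\<close>

lemma hypersurface_defining_function:
  fixes M :: "(real ^ 'n) set"
  assumes M: "smooth_submanifold (CARD('n) - 1) M" and p: "p \<in> M"
  obtains k R H where "0 < R" "continuous_on (ball p R) H" "\<And>x. x \<in> ball p R \<Longrightarrow> x \<in> M \<longleftrightarrow> H x = 0"
    "\<And>x s. 0 < s \<Longrightarrow> x \<in> ball p R \<Longrightarrow> x + s *\<^sub>R axis k 1 \<in> ball p R \<Longrightarrow> H x < (H (x + s *\<^sub>R axis k 1) :: real)"
proof -
  obtain U V \<phi> \<psi> and S :: "(real ^ 'n) set" where ch: "open U" "p \<in> U" "open V" "homeomorphism U V \<phi> \<psi>"
    "smooth_on U \<phi>" "smooth_on V \<psi>" "subspace S" "dim S = CARD('n) - 1" "\<phi> ` (U \<inter> M) = V \<inter> S"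
    using M[unfolded smooth_submanifold_def, rule_format, OF p] by (elim exE conjE) (rule that)
  have "dim S = DIM(real ^ 'n) - 1" using ch by simp
  then obtain a where a: "a \<noteq> 0" "span S = {x. a \<bullet> x = 0}" by (rule lowdim_eq_hyperplane)
  then have S: "S = {x. a \<bullet> x = 0}" using ch by (metis span_eq_iff)
  have C1: "Ck_on (Suc 0) U \<phi>" "Ck_on (Suc 0) V \<psi>" using ch by (auto simp: smooth_on_def simp del: Ck_on.simps)
  define D where "D = (\<lambda>x. frechet_derivative \<phi> (at x))"
  have D: "(\<phi> has_derivative D x) (at x)" if "x \<in> U" for x
    unfolding D_def using C1(1) that by (rule Ck_on_Suc_has_derivative)
  have contD: "continuous_on U (\<lambda>x. D x v)" for v
    using C1(1) by (simp add: D_def)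
  have memM: "x \<in> M \<longleftrightarrow> a \<bullet> \<phi> x = 0" if "x \<in> U" for x
  proof -
    have "x \<in> M \<longleftrightarrow> \<phi> x \<in> \<phi> ` (U \<inter> M)"
      using that ch(4) unfolding homeomorphism_def by (auto simp: image_iff) metis
    also have "\<dots> \<longleftrightarrow> a \<bullet> \<phi> x = 0"
      using that ch(4) unfolding ch(9) S homeomorphism_def by auto
    finally show ?thesis .
  qed
  \<comment> \<open>The inverse chart makes \<open>D p\<close> invertible; a preimage of
    \<open>a\<close> shows that the differential of \<open>a \<bullet> \<phi>\<close> at
    \<open>p\<close> is nonzero.\<close>
  obtain w where w: "D p w = a"
  proof -
    have "\<phi> p \<in> V" using ch by (auto simp: homeomorphism_def)
    then have "(\<psi> has_derivative frechet_derivative \<psi> (at (\<phi> p))) (at (\<phi> p))"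
      using C1(2) by (intro Ck_on_Suc_has_derivative)
    from has_derivative_compose[OF D[OF ch(2)] this]
    have "((\<lambda>x. \<psi> (\<phi> x)) has_derivative (\<lambda>v. frechet_derivative \<psi> (at (\<phi> p)) (D p v))) (at p)" .
    then have "((\<lambda>x. x) has_derivative (\<lambda>v. frechet_derivative \<psi> (at (\<phi> p)) (D p v))) (at p)"
      by (rule has_derivative_transform_within_open[OF _ ch(1,2)]) (use ch in \<open>auto simp: homeomorphism_def\<close>)
    then have "(\<lambda>v. frechet_derivative \<psi> (at (\<phi> p)) (D p v)) = (\<lambda>v. v)"
      using has_derivative_unique has_derivative_ident by blast
    then have "inj (D p)" by (metis injI)
    then have "surj (D p)"
      using D[OF ch(2)] has_derivative_linear linear_injective_imp_surjective by blast
    then show thesis using that by (metis surjD)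
  qed
  have lin: "linear (\<lambda>v. a \<bullet> D x v)" if "x \<in> U" for x
    using has_derivative_linear[OF D[OF that]] by (intro linearI) (simp_all add: linear_add linear_cmul inner_add_right)
  have "a \<bullet> D p w \<noteq> 0" using w a by simp
  then obtain k where k: "a \<bullet> D p (axis k 1) \<noteq> 0" using linear_nonzero_axis[OF lin[OF ch(2)]] by metis
  define \<sigma> where "\<sigma> = sgn (a \<bullet> D p (axis k 1))"
  define H where "H = (\<lambda>x. \<sigma> * (a \<bullet> \<phi> x))"
  define H' where "H' = (\<lambda>x. \<sigma> * (a \<bullet> D x (axis k 1)))"
  have \<sigma>: "\<sigma> \<noteq> 0" using k by (simp add: \<sigma>_def sgn_zero_iff)
  have "H' p > 0" using k by (simp add: H'_def \<sigma>_def sgn_mult_self_eq abs_sgn[symmetric] mult.commute[of "sgn _"])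
  have contH': "continuous_on U H'"
    unfolding H'_def by (intro continuous_intros contD)
  then have "open {x \<in> U. H' x > 0}"
  proof -
    have "open (U \<inter> H' -` {0<..})"
      by (rule continuous_open_preimage[OF contH' ch(1)]) simp
    then show ?thesis by (simp add: vimage_def Int_def)
  qed
  then obtain R where R: "R > 0" "ball p R \<subseteq> {x \<in> U. H' x > 0}"
    using \<open>H' p > 0\<close> ch(2) by (metis (mono_tags, lifting) mem_Collect_eq openE)
  show thesis
  proof (rule that[of R H k])
    have "continuous_on U \<phi>" using ch(4) by (simp add: homeomorphism_def)
    then show "continuous_on (ball p R) H"
      unfolding H_def using R by (intro continuous_intros) (auto elim: continuous_on_subset)
    show "x \<in> M \<longleftrightarrow> H x = 0" if "x \<in> ball p R" for x
    proof -
      have "x \<in> U" using that R by auto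
      then show ?thesis using memM \<sigma> by (simp add: H_def)
    qed
    show "H x < H (x + s *\<^sub>R axis k 1)"
      if "0 < s" "x \<in> ball p R" "x + s *\<^sub>R axis k 1 \<in> ball p R" for x s
    proof -
      have in_ball: "x + \<tau> *\<^sub>R axis k 1 \<in> ball p R" if "0 \<le> \<tau>" "\<tau> \<le> s" for \<tau>
      proof -
        have eq: "x + \<tau> *\<^sub>R axis k 1 = (1 - \<tau> / s) *\<^sub>R x + (\<tau> / s) *\<^sub>R (x + s *\<^sub>R axis k 1)"
          using \<open>0 < s\<close> by (simp add: algebra_simps)
        show ?thesis
          unfolding eq
          by (rule convexD[OF convex_ball]) (use that \<open>0 < s\<close> \<open>x \<in> _\<close> \<open>x + _ \<in> _\<close> in auto)
      qed
      have "H (x + 0 *\<^sub>R axis k 1) < H (x + s *\<^sub>R axis k 1)"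
      proof (rule DERIV_pos_imp_increasing[OF \<open>0 < s\<close>])
        fix \<tau> assume \<tau>: "0 \<le> \<tau>" "\<tau> \<le> s"
        let ?y = "x + \<tau> *\<^sub>R axis k 1"
        have y: "?y \<in> U" "H' ?y > 0" using in_ball[OF \<tau>] R by auto
        have l: "((\<lambda>\<tau>. x + \<tau> *\<^sub>R axis k 1) has_derivative (\<lambda>h. h *\<^sub>R axis k 1)) (at \<tau>)"
          by (auto intro!: derivative_eq_intros)
        have "((\<lambda>\<tau>. H (x + \<tau> *\<^sub>R axis k 1)) has_derivative (\<lambda>h. \<sigma> * (a \<bullet> D ?y (h *\<^sub>R axis k 1)))) (at \<tau>)"
          unfolding H_def
          by (intro has_derivative_mult_right has_derivative_inner_right has_derivative_compose[OF l D[OF y(1)]])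
        moreover have "\<sigma> * (a \<bullet> D ?y (h *\<^sub>R axis k 1)) = H' ?y * h" for h
          using linear_cmul[OF lin[OF y(1)], of h "axis k 1"] by (simp add: H'_def)
        ultimately have "((\<lambda>\<tau>. H (x + \<tau> *\<^sub>R axis k 1)) has_field_derivative H' ?y) (at \<tau>)"
          by (simp add: has_field_derivative_def)
        then show "\<exists>y. ((\<lambda>\<tau>. H (x + \<tau> *\<^sub>R axis k 1)) has_real_derivative y) (at \<tau>) \<and> 0 < y"
          using y by blast
      qed
      then show ?thesis by simp
    qed
  qed (rule R)
qed

lemma mveval_shift_free:
  assumes "deg_less k 1 h"
  shows "mveval h (x + s *\<^sub>R axis k 1) = mveval h x"
proof -
  have "mono_eval m (x + s *\<^sub>R axis k 1) = mono_eval m x" if "m \<in> keys h" for m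
    unfolding mono_eval_def
  proof (intro prod.cong refl)
    fix i
    have "lookup m k = 0" using assms that by (auto simp: deg_less_def)
    then show "(x + s *\<^sub>R axis k 1) $ i ^ lookup m i = x $ i ^ lookup m i"
      by (cases "i = k") (auto simp: axis_def)
  qed
  then show ?thesis by (simp add: mveval_superset[OF _ order_refl])
qed

text \<open>Near \<open>y\<close> every line parallel to the axis passes from \<open>H < 0\<close>
  to \<open>H > 0\<close>, so it meets \<open>M\<close> inside \<open>B\<close>. As \<open>h\<close>
  is constant on such lines, it vanishes on a neighbourhood of \<open>y\<close>.\<close>

lemma hypersurface_thick:
  fixes H :: "real ^ 'n \<Rightarrow> real"
  assumes H: "continuous_on (ball p R) H" "\<And>x. x \<in> ball p R \<Longrightarrow> x \<in> M \<longleftrightarrow> H x = 0"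
    "\<And>x s. 0 < s \<Longrightarrow> x \<in> ball p R \<Longrightarrow> x + s *\<^sub>R axis k 1 \<in> ball p R \<Longrightarrow> H x < H (x + s *\<^sub>R axis k 1)"
    and B: "open B" "B \<subseteq> ball p R" "y \<in> B" "y \<in> M"
    and h: "deg_less k 1 h" "\<forall>x\<in>B \<inter> M. mveval h x = 0"
  shows "h = 0"
proof -
  let ?e = "axis k 1 :: real ^ 'n"
  obtain e where e: "e > 0" "ball y e \<subseteq> B" using B by (meson openE)
  \<comment> \<open>With a third of the radius, moving the base point and then shifting along the
    axis stays inside \<open>ball y e\<close>.\<close>
  define \<delta> where "\<delta> = e / 3"
  have \<delta>: "\<delta> > 0" using e by (simp add: \<delta>_def)
  have near: "q + s *\<^sub>R ?e \<in> B" if "dist q y < \<delta>" "\<bar>s\<bar> \<le> \<delta>" for q s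
  proof -
    have "dist y (q + s *\<^sub>R ?e) \<le> dist y q + dist q (q + s *\<^sub>R ?e)" by (rule dist_triangle)
    also have "dist q (q + s *\<^sub>R ?e) = \<bar>s\<bar>" by (simp add: dist_norm)
    finally have "dist y (q + s *\<^sub>R ?e) < e"
      using that by (simp add: dist_commute \<delta>_def)
    then show ?thesis using e by auto
  qed
  have Hy: "H y = 0" using H(2)[of y] B by auto
  have "y - \<delta> *\<^sub>R ?e \<in> ball p R" "y \<in> ball p R" "y + \<delta> *\<^sub>R ?e \<in> ball p R"
    using near[of y \<delta>] near[of y "- \<delta>"] B \<delta> by auto
  then have neg: "H (y - \<delta> *\<^sub>R ?e) < 0" and pos: "0 < H (y + \<delta> *\<^sub>R ?e)"
    using H(3)[of \<delta> "y - \<delta> *\<^sub>R ?e"] H(3)[of \<delta> y] \<delta> Hy by auto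
  have contB: "continuous_on B H" using H(1) B(2) continuous_on_subset by blast
  have isC: "isCont (\<lambda>q. H (q + s *\<^sub>R ?e)) y" if "\<bar>s\<bar> \<le> \<delta>" for s
  proof -
    have "isCont H (y + s *\<^sub>R ?e)"
      using contB B(1) near[of y s] that \<delta> by (simp add: continuous_on_eq_continuous_at)
    then show ?thesis by (rule isCont_o2[where f = "\<lambda>q. q + s *\<^sub>R ?e" and g = H, rotated]) simp
  qed
  have "\<forall>\<^sub>F q in nhds y. H (q - \<delta> *\<^sub>R ?e) < 0"
    using isC[of "- \<delta>"] neg \<delta>
    by (intro order_tendstoD(2)[OF tendsto_at_iff_tendsto_nhds[THEN iffD1, OF isCont_def[THEN iffD1]]]) auto
  moreover have "\<forall>\<^sub>F q in nhds y. 0 < H (q + \<delta> *\<^sub>R ?e)"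
    using isC[of \<delta>] pos \<delta>
    by (intro order_tendstoD(1)[OF tendsto_at_iff_tendsto_nhds[THEN iffD1, OF isCont_def[THEN iffD1]]]) auto
  moreover have "\<forall>\<^sub>F q in nhds y. dist q y < \<delta>"
    using \<delta> by (auto simp: eventually_nhds_metric)
  ultimately have "\<forall>\<^sub>F q in nhds y. mveval h q = 0"
  proof eventually_elim
    case (elim q)
    have "continuous_on {- \<delta>..\<delta>} (\<lambda>s. H (q + s *\<^sub>R ?e))"
      by (rule continuous_on_compose2[OF contB]) (use near[OF elim(3)] in \<open>auto intro!: continuous_intros\<close>)
    then obtain s where s: "- \<delta> \<le> s" "s \<le> \<delta>" "H (q + s *\<^sub>R ?e) = 0"
      using IVT'[of "\<lambda>s. H (q + s *\<^sub>R ?e)" "- \<delta>" 0 \<delta>] elim \<delta> by auto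
    then have "q + s *\<^sub>R ?e \<in> B" using near[OF elim(3)] by auto
    then have "mveval h (q + s *\<^sub>R ?e) = 0" using h(2) H(2) B(2) s(3) by blast
    then show ?case using mveval_shift_free[OF h(1)] by metis
  qed
  then obtain W where "open W" "y \<in> W" "\<forall>q\<in>W. mveval h q = 0" by (auto simp: eventually_nhds)
  then show ?thesis using mveval_vanish_open by blast
qed

subsection \<open>Each ray meets a smooth slowness surface once\<close>

text \<open>By persistence the ray through \<open>x - s v\<close> meets \<open>M\<close> at some
  \<open>t (x - s v)\<close> with \<open>t\<close> near 1. From this zero of \<open>H\<close> the
  displacement by \<open>t s v\<close> leads to \<open>t x\<close>, where \<open>H\<close> is
  therefore positive.\<close>

lemma ray_no_local_max:
  fixes H :: "'a::euclidean_space \<Rightarrow> real"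
  assumes R: "0 < R"
    and M: "\<And>x. x \<in> ball p R \<Longrightarrow> x \<in> M \<longleftrightarrow> H x = 0"
    and mono: "\<And>x s. 0 < s \<Longrightarrow> x \<in> ball p R \<Longrightarrow> x + s *\<^sub>R v \<in> ball p R \<Longrightarrow> H x < H (x + s *\<^sub>R v)"
    and persist: "\<And>x e. x \<in> M \<Longrightarrow> 0 < e \<Longrightarrow> \<forall>\<^sub>F q in nhds x. \<exists>t. \<bar>t - 1\<bar> < e \<and> t *\<^sub>R q \<in> M"
    and x: "x \<in> M" "x \<in> ball p R" and e: "0 < e"
  shows "\<exists>t. \<bar>t - 1\<bar> < e \<and> 0 < H (t *\<^sub>R x)"
proof (rule ccontr)
  assume "\<not> ?thesis"
  then have le: "H (t *\<^sub>R x) \<le> 0" if "\<bar>t - 1\<bar> < e" for t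
    using that \<open>\<not> _\<close> by (meson not_less)
  have "((\<lambda>(t, s). t *\<^sub>R (x - s *\<^sub>R v)) \<longlongrightarrow> 1 *\<^sub>R (x - 0 *\<^sub>R v)) (nhds (1, 0 :: real))"
    unfolding split_beta by (intro tendsto_intros) (auto intro!: tendsto_eq_intros simp: nhds_prod filterlim_fst filterlim_snd)
  then have "\<forall>\<^sub>F z in nhds (1, 0 :: real). (case z of (t, s) \<Rightarrow> t *\<^sub>R (x - s *\<^sub>R v)) \<in> ball p R"
    using x by (intro topological_tendstoD) auto
  then obtain \<rho> where \<rho>: "\<rho> > 0" "\<And>t s. dist (t, s) (1, 0 :: real) < \<rho> \<Longrightarrow> t *\<^sub>R (x - s *\<^sub>R v) \<in> ball p R"
    unfolding eventually_nhds_metric by fastforce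
  have inb: "t *\<^sub>R (x - s *\<^sub>R v) \<in> ball p R" if "\<bar>t - 1\<bar> < \<rho> / 2" "\<bar>s\<bar> < \<rho> / 2" for t s
  proof (rule \<rho>(2))
    have "dist (t, s) (1, 0 :: real) \<le> dist t 1 + dist s 0"
      unfolding dist_prod_def fst_conv snd_conv by (rule sqrt_sum_squares_le_sum) auto
    then show "dist (t, s) (1, 0) < \<rho>" using that by (simp add: dist_real_def)
  qed
  \<comment> \<open>The bound 1 keeps \<open>t\<close> positive, so that \<open>t s v\<close> points
    in the direction of \<open>v\<close>; the bound \<open>\<rho> / 2\<close> keeps the points in
    the ball.\<close>
  define e' where "e' = min e (min (\<rho> / 2) 1)"
  have e': "e' > 0" using e \<rho> by (simp add: e'_def)
  have "((\<lambda>s. x - s *\<^sub>R v) \<longlongrightarrow> x - 0 *\<^sub>R v) (at_right (0::real))"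
    by (intro tendsto_intros)
  then have "\<forall>\<^sub>F s in at_right 0. \<exists>t. \<bar>t - 1\<bar> < e' \<and> t *\<^sub>R (x - s *\<^sub>R v) \<in> M"
    by (intro eventually_compose_filterlim[OF persist[OF x(1) e']]) simp
  moreover have "\<forall>\<^sub>F s in at_right (0::real). s < \<rho> / 2" "\<forall>\<^sub>F s in at_right (0::real). 0 < s"
    using \<rho> by (auto simp: eventually_at_right_less intro!: eventually_at_rightI[of 0 "\<rho> / 2"])
  ultimately have "\<forall>\<^sub>F s in at_right (0::real). False"
  proof eventually_elim
    case (elim s)
    then obtain t where t: "\<bar>t - 1\<bar> < e'" "t *\<^sub>R (x - s *\<^sub>R v) \<in> M" by blast
    have t0: "0 < t" using t by (auto simp: e'_def)
    have b: "t *\<^sub>R (x - s *\<^sub>R v) \<in> ball p R" "t *\<^sub>R (x - 0 *\<^sub>R v) \<in> ball p R"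
      using t elim \<rho> by (intro inb; auto simp: e'_def)+
    have eq: "t *\<^sub>R (x - s *\<^sub>R v) + (t * s) *\<^sub>R v = t *\<^sub>R x" by (simp add: algebra_simps)
    have "H (t *\<^sub>R (x - s *\<^sub>R v)) < H (t *\<^sub>R x)"
      using mono[of "t * s" "t *\<^sub>R (x - s *\<^sub>R v)"] b t0 elim by (simp add: eq)
    moreover have "H (t *\<^sub>R (x - s *\<^sub>R v)) = 0" using M b t by blast
    moreover have "H (t *\<^sub>R x) \<le> 0" using le t by (simp add: e'_def)
    ultimately show False by simp
  qed
  then show False by (simp add: trivial_limit_at_right_real)
qed

text \<open>If \<open>H\<close> were positive somewhere between two zeros on a ray, move the ray against \<open>v\<close> until
  the maximum of \<open>H\<close> in between drops to zero: this is a local maximum at a point of \<open>M\<close>.\<close>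

lemma ray_no_positive_bump:
  fixes H :: "'a::euclidean_space \<Rightarrow> real"
  assumes R: "0 < R" and cont: "continuous_on (ball p R) H"
    and M: "\<And>x. x \<in> ball p R \<Longrightarrow> x \<in> M \<longleftrightarrow> H x = 0"
    and mono: "\<And>x s. 0 < s \<Longrightarrow> x \<in> ball p R \<Longrightarrow> x + s *\<^sub>R v \<in> ball p R \<Longrightarrow> H x < H (x + s *\<^sub>R v)"
    and persist: "\<And>x e. x \<in> M \<Longrightarrow> 0 < e \<Longrightarrow> \<forall>\<^sub>F q in nhds x. \<exists>t. \<bar>t - 1\<bar> < e \<and> t *\<^sub>R q \<in> M"
    and t12: "0 < t1" "t1 < t" "t < t2" and s0: "0 < s0"
    and inb: "\<And>t s. t1 \<le> t \<Longrightarrow> t \<le> t2 \<Longrightarrow> 0 \<le> s \<Longrightarrow> s \<le> s0 \<Longrightarrow> t *\<^sub>R (q - s *\<^sub>R v) \<in> ball p R"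
    and neg: "\<And>t. t1 \<le> t \<Longrightarrow> t \<le> t2 \<Longrightarrow> H (t *\<^sub>R (q - s0 *\<^sub>R v)) < 0"
    and zero: "H (t1 *\<^sub>R q) = 0" "H (t2 *\<^sub>R q) = 0" and pos: "0 < H (t *\<^sub>R q)"
  shows False
proof -
  define f where "f = (\<lambda>(s, t). H (t *\<^sub>R (q - s *\<^sub>R v)))"
  define Z where "Z = {0..s0} \<times> {t1..t2}"
  have contf: "continuous_on Z f"
    unfolding f_def split_beta
    by (rule continuous_on_compose2[OF cont]) (use inb in \<open>auto simp: Z_def intro!: continuous_intros\<close>)
  have "compact Z" unfolding Z_def by (intro compact_Times compact_Icc)
  moreover have "closed (Z \<inter> f -` {0..})"
    by (rule continuous_closed_preimage[OF contf compact_imp_closed[OF \<open>compact Z\<close>] closed_atLeast])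
  ultimately have comp: "compact (Z \<inter> f -` {0..})"
    by (metis compact_Int_closed inf.left_idem)
  have "(0, t) \<in> Z \<inter> f -` {0..}" using t12 s0 pos by (auto simp: Z_def f_def)
  then have "Z \<inter> f -` {0..} \<noteq> {}" by blast
  \<comment> \<open>Among the points of the rectangle where \<open>f\<close> is nonnegative, one
    with the largest shift \<open>s\<close> is chosen.\<close>
  from continuous_attains_sup[OF comp this continuous_on_fst[OF continuous_on_id]]
  obtain z where z: "z \<in> Z \<inter> f -` {0..}" "\<And>w. w \<in> Z \<inter> f -` {0..} \<Longrightarrow> fst w \<le> fst z" by blast
  obtain s' t' where "z = (s', t')" by (cases z)
  with z(1) have st: "(s', t') \<in> Z" "0 \<le> f (s', t')" by auto
  have max: "s \<le> s'" if "(s, t) \<in> Z" "0 \<le> f (s, t)" for s t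
    using z(2)[of "(s, t)"] that \<open>z = (s', t')\<close> by simp
  \<comment> \<open>Since \<open>f\<close> is negative at the shift \<open>s0\<close>, a positive
    value would lead to a zero at a still larger shift, against the choice of
    \<open>s'\<close>.\<close>
  have not_pos: False if s: "0 \<le> s" "s \<le> s0" "t1 \<le> t" "t \<le> t2" "0 < f (s, t)" "s' \<le> s" for s t
  proof -
    have "continuous_on {s..s0} (\<lambda>s. f (s, t))"
      by (rule continuous_on_compose2[OF contf]) (use s in \<open>auto simp: Z_def intro!: continuous_intros\<close>)
    moreover have "f (s0, t) < 0" using neg s by (simp add: f_def)
    ultimately obtain s2 where s2: "s \<le> s2" "s2 \<le> s0" "f (s2, t) = 0"
      using IVT2'[of "\<lambda>s. f (s, t)" s0 0 s] s by auto
    then have "s2 \<le> s'" using max[of s2 t] s by (auto simp: Z_def)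
    then show False using s s2 by (metis order.antisym order.trans less_irrefl)
  qed
  have bd: "0 \<le> s'" "s' \<le> s0" "t1 \<le> t'" "t' \<le> t2" using st by (auto simp: Z_def)
  have le: "H (\<tau> *\<^sub>R (q - s' *\<^sub>R v)) \<le> 0" if "t1 \<le> \<tau>" "\<tau> \<le> t2" for \<tau>
    using not_pos[of s' \<tau>] that bd by (force simp: f_def)
  have s'pos: "0 < s'"
  proof (rule ccontr)
    assume "\<not> 0 < s'"
    then have "s' = 0" using bd by simp
    then show False using le[of t] t12 pos by simp
  qed
  \<comment> \<open>At both ends \<open>H\<close> is 0 for the shift 0 and strictly smaller after
    the shift, so the zero at \<open>t'\<close> lies strictly between them.\<close>
  have end_neg: "H (\<tau> *\<^sub>R (q - s' *\<^sub>R v)) < 0" if "\<tau> \<in> {t1, t2}" for \<tau>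
  proof -
    have \<tau>: "0 < \<tau>" "t1 \<le> \<tau>" "\<tau> \<le> t2" "H (\<tau> *\<^sub>R q) = 0" using that t12 zero by auto
    have eq: "\<tau> *\<^sub>R (q - s' *\<^sub>R v) + (\<tau> * s') *\<^sub>R v = \<tau> *\<^sub>R q" by (simp add: algebra_simps)
    show ?thesis
      using mono[of "\<tau> * s'" "\<tau> *\<^sub>R (q - s' *\<^sub>R v)"] inb[of \<tau> s'] inb[of \<tau> 0] \<tau> s'pos bd s0 by (simp add: eq)
  qed
  define x where "x = t' *\<^sub>R (q - s' *\<^sub>R v)"
  have Hx: "H x = 0" using le[of t'] st(2) bd by (simp add: x_def f_def)
  have "t' \<noteq> t1" "t' \<noteq> t2" using end_neg[of t'] Hx by (auto simp: x_def)
  then have t': "t1 < t'" "t' < t2" using bd by auto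
  have xb: "x \<in> ball p R" unfolding x_def using inb bd by blast
  then have "x \<in> M" using M Hx by blast
  \<comment> \<open>\<open>ray_no_local_max\<close> rescales \<open>x\<close> by a factor
    \<open>\<tau>\<close> near 1; this tolerance keeps \<open>\<tau> * t'\<close> between
    \<open>t1\<close> and \<open>t2\<close>.\<close>
  define e where "e = min (t' - t1) (t2 - t') / t'"
  have t'pos: "0 < t'" using t' t12 by simp
  have "0 < e" using t' t'pos by (simp add: e_def)
  then obtain \<tau> where \<tau>: "\<bar>\<tau> - 1\<bar> < e" "0 < H (\<tau> *\<^sub>R x)"
    using ray_no_local_max[OF R M mono persist \<open>x \<in> M\<close> xb] by blast
  have "\<bar>\<tau> * t' - t'\<bar> = \<bar>\<tau> - 1\<bar> * t'"
    using t'pos by (metis abs_mult abs_of_pos left_diff_distrib mult_1)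
  also have "\<dots> < e * t'" using \<tau> t'pos by simp
  also have "\<dots> = min (t' - t1) (t2 - t')" using t'pos by (simp add: e_def)
  finally have "t1 \<le> \<tau> * t'" "\<tau> * t' \<le> t2" by auto
  then show False using le[of "\<tau> * t'"] \<tau> by (simp add: x_def)
qed

text \<open>Rays meet \<open>M\<close> finitely often, so between two meeting points
  \<open>H\<close> is nonzero somewhere. A positive value is excluded by
  \<open>ray_no_positive_bump\<close>, a negative one by the same lemma for \<open>- H\<close> and
  \<open>- v\<close>.\<close>

lemma ray_meets_once:
  fixes H :: "'a::euclidean_space \<Rightarrow> real"
  assumes R: "0 < R" and cont: "continuous_on (ball p R) H"
    and M: "\<And>x. x \<in> ball p R \<Longrightarrow> x \<in> M \<longleftrightarrow> H x = 0"
    and mono: "\<And>x s. 0 < s \<Longrightarrow> x \<in> ball p R \<Longrightarrow> x + s *\<^sub>R v \<in> ball p R \<Longrightarrow> H x < H (x + s *\<^sub>R v)"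
    and persist: "\<And>x e. x \<in> M \<Longrightarrow> 0 < e \<Longrightarrow> \<forall>\<^sub>F q in nhds x. \<exists>t. \<bar>t - 1\<bar> < e \<and> t *\<^sub>R q \<in> M"
    and fin: "\<And>q. finite {t. t *\<^sub>R q \<in> M}" and p: "p \<in> M"
  shows "\<exists>\<delta>>0. \<exists>\<eta>>0. \<forall>q t1 t2. dist q p < \<eta> \<longrightarrow> \<bar>t1 - 1\<bar> < \<delta> \<longrightarrow> \<bar>t2 - 1\<bar> < \<delta> \<longrightarrow>
    t1 *\<^sub>R q \<in> M \<longrightarrow> t2 *\<^sub>R q \<in> M \<longrightarrow> t1 = t2"
proof -
  \<comment> \<open>Shifts by at most \<open>s0\<close> along \<open>v\<close> move points by at
    most \<open>R / 8\<close>; the summand 1 avoids a division by zero.\<close>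
  define s0 where "s0 = R / (8 * (1 + norm v))"
  have nv: "0 < 1 + norm v" by (simp add: add_pos_nonneg)
  then have s0: "0 < s0" using R by (simp add: s0_def)
  have s0v: "s * norm v \<le> R / 8" if "s \<le> s0" for s
  proof -
    have "s * norm v \<le> s0 * (1 + norm v)"
      using that s0 by (intro mult_mono) auto
    also have "\<dots> = R / 8"
    proof -
      have *: "R / (8 * x) * x = R / 8" if "x \<noteq> 0" for x using that by simp
      show ?thesis unfolding s0_def by (rule *) (use nv in simp)
    qed
    finally show ?thesis .
  qed
  have pb: "p + s *\<^sub>R v \<in> ball p R" if "\<bar>s\<bar> \<le> s0" for s
    using s0v[OF that] R by (simp add: dist_norm)
  have Hp: "H p = 0" using M[of p] p R by simp
  have neg: "H (p + (- s0) *\<^sub>R v) < 0" and pos: "0 < H (p + s0 *\<^sub>R v)"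
    using mono[of s0 "p + (- s0) *\<^sub>R v"] mono[of s0 p] pb[of "- s0"] pb[of s0] pb[of 0] s0 Hp by auto
  have "open (ball p R \<inter> H -` {..<0})" "open (ball p R \<inter> H -` {0<..})"
    by (rule continuous_open_preimage[OF cont open_ball]; simp)+
  moreover have "p + (- s0) *\<^sub>R v \<in> ball p R \<inter> H -` {..<0}" "p + s0 *\<^sub>R v \<in> ball p R \<inter> H -` {0<..}"
    using neg pos pb[of "- s0"] pb[of s0] s0 by auto
  ultimately obtain \<rho>1 \<rho>2 where \<rho>: "\<rho>1 > 0" "\<rho>2 > 0"
    "ball (p + (- s0) *\<^sub>R v) \<rho>1 \<subseteq> ball p R \<inter> H -` {..<0}" "ball (p + s0 *\<^sub>R v) \<rho>2 \<subseteq> ball p R \<inter> H -` {0<..}"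
    by (meson openE)
  \<comment> \<open>Error budget: the deviation in \<open>est\<close> is below \<open>2 * m\<close>,
    which is at most half of \<open>\<rho>1\<close> and of \<open>\<rho>2\<close> and, with a shift
    of \<open>R / 8\<close> added, less than \<open>R\<close>.\<close>
  define m where "m = min (R / 8) (min \<rho>1 \<rho>2 / 4)"
  have m: "0 < m" "m \<le> R / 8" "m \<le> \<rho>1 / 4" "m \<le> \<rho>2 / 4" using R \<rho> by (auto simp: m_def)
  define K where "K = norm p + 1 + R"
  have K: "0 < K" using R by (simp add: K_def add_nonneg_pos)
  define \<delta> where "\<delta> = min (1 / 4) (m / K)"
  define \<eta> where "\<eta> = min 1 m"
  have \<delta>: "0 < \<delta>" "\<delta> * K \<le> m" "\<delta> \<le> 1 / 4"
  proof -
    show "0 < \<delta>" using m K by (simp add: \<delta>_def)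
    show "\<delta> \<le> 1 / 4" unfolding \<delta>_def by (rule min.cobounded1)
    have "\<delta> \<le> m / K" by (simp add: \<delta>_def)
    then show "\<delta> * K \<le> m" using K by (simp add: pos_le_divide_eq)
  qed
  have \<eta>: "0 < \<eta>" using m by (simp add: \<eta>_def)
  have est: "dist (t *\<^sub>R (q + s *\<^sub>R v)) (p + s *\<^sub>R v) < 2 * m"
    if "dist q p < \<eta>" "\<bar>t - 1\<bar> < \<delta>" "\<bar>s\<bar> \<le> s0" for q t s
  proof -
    have "norm (q + s *\<^sub>R v) \<le> norm p + norm (q - p) + norm (s *\<^sub>R v)"
      by (metis add.commute add_diff_cancel_left' diff_add_cancel norm_triangle_ineq norm_triangle_le add_mono_thms_linordered_semiring(3))
    also have "\<dots> \<le> K"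
      using that s0v[OF that(3)] R by (simp add: K_def \<eta>_def dist_norm)
    finally have "\<bar>t - 1\<bar> * norm (q + s *\<^sub>R v) \<le> \<delta> * K"
      using that K \<delta> by (intro mult_mono) auto
    then have "\<bar>t - 1\<bar> * norm (q + s *\<^sub>R v) \<le> m" using \<delta> by simp
    moreover have "t *\<^sub>R (q + s *\<^sub>R v) - (p + s *\<^sub>R v) = (t - 1) *\<^sub>R (q + s *\<^sub>R v) + (q - p)"
      by (simp add: algebra_simps)
    then have "dist (t *\<^sub>R (q + s *\<^sub>R v)) (p + s *\<^sub>R v) \<le> \<bar>t - 1\<bar> * norm (q + s *\<^sub>R v) + norm (q - p)"
      unfolding dist_norm by (metis norm_scaleR norm_triangle_ineq)
    moreover have "norm (q - p) < m" using that by (simp add: \<eta>_def dist_norm)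
    ultimately show ?thesis by linarith
  qed
  have inb: "t *\<^sub>R (q + s *\<^sub>R v) \<in> ball p R" if "dist q p < \<eta>" "\<bar>t - 1\<bar> < \<delta>" "\<bar>s\<bar> \<le> s0" for q t s
  proof -
    have "dist (t *\<^sub>R (q + s *\<^sub>R v)) p \<le> dist (t *\<^sub>R (q + s *\<^sub>R v)) (p + s *\<^sub>R v) + dist (p + s *\<^sub>R v) p"
      by (rule dist_triangle)
    also have "dist (p + s *\<^sub>R v) p \<le> R / 8" using s0v[OF that(3)] by (simp add: dist_norm)
    finally show ?thesis using est[OF that] m R by (simp add: dist_commute)
  qed
  have False if q: "dist q p < \<eta>" and t: "\<bar>t1 - 1\<bar> < \<delta>" "\<bar>t2 - 1\<bar> < \<delta>" "t1 < t2"
    and hit: "t1 *\<^sub>R q \<in> M" "t2 *\<^sub>R q \<in> M" for q t1 t2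
  proof -
    have tq: "\<bar>t - 1\<bar> < \<delta>" if "t1 \<le> t" "t \<le> t2" for t using t that by linarith
    have inb': "t *\<^sub>R (q + s *\<^sub>R v) \<in> ball p R" if "t1 \<le> t" "t \<le> t2" "\<bar>s\<bar> \<le> s0" for t s
      using inb[OF q tq[OF that(1,2)] that(3)] .
    have inq: "t *\<^sub>R q \<in> ball p R" if "t1 \<le> t" "t \<le> t2" for t
      using inb'[OF that, of 0] s0 by simp
    have zero: "H (t1 *\<^sub>R q) = 0" "H (t2 *\<^sub>R q) = 0" using M inq t hit by auto
    have t1pos: "0 < t1" using t \<delta> by linarith
    have negq: "H (t *\<^sub>R (q + (- s0) *\<^sub>R v)) < 0" if "t1 \<le> t" "t \<le> t2" for t
    proof -
      have "t *\<^sub>R (q + (- s0) *\<^sub>R v) \<in> ball (p + (- s0) *\<^sub>R v) \<rho>1"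
        using est[OF q tq[OF that], of "- s0"] m s0 by (simp add: dist_commute)
      then show ?thesis using \<rho> by blast
    qed
    have posq: "0 < H (t *\<^sub>R (q + s0 *\<^sub>R v))" if "t1 \<le> t" "t \<le> t2" for t
    proof -
      have "t *\<^sub>R (q + s0 *\<^sub>R v) \<in> ball (p + s0 *\<^sub>R v) \<rho>2"
        using est[OF q tq[OF that], of s0] m s0 by (simp add: dist_commute)
      then show ?thesis using \<rho> by blast
    qed
    have "infinite ({t1<..<t2} - {t. t *\<^sub>R q \<in> M})"
      using fin t by (intro Diff_infinite_finite infinite_Ioo) auto
    then obtain t where tt: "t1 < t" "t < t2" "t *\<^sub>R q \<notin> M"
      by (metis (no_types, lifting) DiffE finite.emptyI greaterThanLessThan_iff mem_Collect_eq ex_in_conv)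
    then have "H (t *\<^sub>R q) \<noteq> 0" using M inq by auto
    then consider "0 < H (t *\<^sub>R q)" | "H (t *\<^sub>R q) < 0" by linarith
    then show False
    proof cases
      case 1
      show False
      proof (rule ray_no_positive_bump[OF R cont M mono persist t1pos tt(1,2) s0 _ _ zero 1])
        show "t *\<^sub>R (q - s *\<^sub>R v) \<in> ball p R" if "t1 \<le> t" "t \<le> t2" "0 \<le> s" "s \<le> s0" for t s
          using inb'[of t "- s"] that by simp
        show "H (t *\<^sub>R (q - s0 *\<^sub>R v)) < 0" if "t1 \<le> t" "t \<le> t2" for t
          using negq[OF that] by simp
      qed
    next
      case 2
      show False
      proof (rule ray_no_positive_bump[where H = "\<lambda>x. - H x" and v = "- v", OF R _ _ _ persist t1pos tt(1,2) s0])
        show "continuous_on (ball p R) (\<lambda>x. - H x)" using cont by (rule continuous_on_minus)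
        show "x \<in> M \<longleftrightarrow> - H x = 0" if "x \<in> ball p R" for x using M[OF that] by simp
        show "- H x < - H (x + s *\<^sub>R (- v))" if "0 < s" "x \<in> ball p R" "x + s *\<^sub>R (- v) \<in> ball p R" for x s
          using mono[of s "x + s *\<^sub>R (- v)"] that by simp
        show "t *\<^sub>R (q - s *\<^sub>R (- v)) \<in> ball p R" if "t1 \<le> t" "t \<le> t2" "0 \<le> s" "s \<le> s0" for t s
          using inb'[of t s] that by simp
        show "- H (t *\<^sub>R (q - s0 *\<^sub>R (- v))) < 0" if "t1 \<le> t" "t \<le> t2" for t
          using posq[OF that] by simp
        show "- H (t1 *\<^sub>R q) = 0" "- H (t2 *\<^sub>R q) = 0" using zero by auto
        show "0 < - H (t *\<^sub>R q)" using 2 by simp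
      qed
    qed
  qed
  then show ?thesis
    using \<delta>(1) \<eta> by (metis linorder_neqE_linordered_idom)
qed

text \<open>If the dimension were smaller, the cone over the surface would be the smooth image of a
  negligible set, but it has interior points.\<close>

lemma ray_hypersurface_dim:
  fixes M :: "(real ^ 'n) set"
  assumes M: "smooth_submanifold d M" and p: "p \<in> M"
    and persist: "\<And>e. 0 < e \<Longrightarrow> \<forall>\<^sub>F q in nhds p. \<exists>t. \<bar>t - 1\<bar> < e \<and> t *\<^sub>R q \<in> M"
    and fin: "finite {t. t *\<^sub>R p \<in> M}"
  shows "d = CARD('n) - 1"
proof -
  obtain U V \<phi> \<psi> and S :: "(real ^ 'n) set" where ch: "open U" "p \<in> U" "open V" "homeomorphism U V \<phi> \<psi>"
    "smooth_on U \<phi>" "smooth_on V \<psi>" "subspace S" "dim S = d" "\<phi> ` (U \<inter> M) = V \<inter> S"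
    using M[unfolded smooth_submanifold_def, rule_format, OF p] by (elim exE conjE) (rule that)
  have "d \<le> CARD('n)" using dim_subset_UNIV[of S] ch by simp
  \<comment> \<open>In full dimension \<open>M\<close> would contain a neighbourhood of
    \<open>p\<close>, and with it infinitely many points of the ray through
    \<open>p\<close>.\<close>
  moreover have "d \<noteq> CARD('n)"
  proof
    assume that: "d = CARD('n)"
    have "S = UNIV" using that ch by (metis DIM_cart DIM_real dim_eq_full mult.right_neutral span_eq_iff)
    have "U \<subseteq> M"
    proof
      fix x assume "x \<in> U"
      have "\<phi> x \<in> V" using ch(4) \<open>x \<in> U\<close> by (auto simp: homeomorphism_def)
      then have "\<phi> x \<in> \<phi> ` (U \<inter> M)" unfolding ch(9) \<open>S = UNIV\<close> by simp
      then obtain x' where x': "x' \<in> U" "x' \<in> M" "\<phi> x = \<phi> x'" by (auto elim: imageE)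
      have "x = \<psi> (\<phi> x)" by (rule homeomorphism_apply1[OF ch(4) \<open>x \<in> U\<close>, symmetric])
      also have "\<dots> = \<psi> (\<phi> x')" by (simp only: x'(3))
      also have "\<dots> = x'" by (rule homeomorphism_apply1[OF ch(4) x'(1)])
      finally show "x \<in> M" using x'(2) by (simp only:)
    qed
    have "((\<lambda>t::real. t *\<^sub>R p) \<longlongrightarrow> 1 *\<^sub>R p) (at 1)" by (intro tendsto_intros)
    then have "\<forall>\<^sub>F t::real in at 1. t *\<^sub>R p \<in> U"
      using ch by (intro topological_tendstoD) auto
    then have "\<forall>\<^sub>F t::real in at 1. t *\<^sub>R p \<in> M"
      using \<open>U \<subseteq> M\<close> by (auto elim: eventually_mono)
    then obtain e where e: "e > 0" "\<And>t::real. t \<noteq> 1 \<Longrightarrow> dist t 1 < e \<Longrightarrow> t *\<^sub>R p \<in> M"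
      unfolding eventually_at by auto
    have "{1<..<1 + e} \<subseteq> {t. t *\<^sub>R p \<in> M}" using e(2) by (auto simp: dist_real_def)
    then show False using e(1) infinite_Ioo[of 1 "1 + e"] finite_subset[OF _ fin] by simp
  qed
  moreover have "\<not> d < CARD('n) - 1"
  proof
    assume that: "d < CARD('n) - 1"
    have "dim S < DIM(real ^ 'n)" using that ch by simp
    then obtain e where e: "e \<noteq> 0" "\<And>y. y \<in> span S \<Longrightarrow> orthogonal e y"
      using orthogonal_to_subspace_exists by metis
    \<comment> \<open>A point \<open>y\<close> of \<open>T\<close> codes a chart point
      \<open>s = y - pr y *\<^sub>R e\<close> in \<open>S\<close> together with a factor
      \<open>pr y\<close>; \<open>G\<close> sends it to that multiple of the surface point
      \<open>\<psi> s\<close>. The span has dimension at most \<open>d + 1\<close>, which is below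
      the dimension of the space.\<close>
    define pr where "pr = (\<lambda>y. (y \<bullet> e) / (e \<bullet> e))"
    define T where "T = span (insert e S) \<inter> (\<lambda>y. y - pr y *\<^sub>R e) -` V"
    define G where "G = (\<lambda>y. pr y *\<^sub>R \<psi> (y - pr y *\<^sub>R e))"
    have "dim (insert e S) < DIM(real ^ 'n)"
      using that ch(8) by (simp add: dim_insert) linarith
    then have "dim (span (insert e S)) < DIM(real ^ 'n)" by simp
    then have "negligible T"
      using negligible_lowdim negligible_subset unfolding T_def by (metis inf_le1)
    moreover have "G differentiable_on T"
      unfolding differentiable_on_def
    proof
      fix y assume y: "y \<in> T"
      have pr: "pr differentiable (at y)"
        unfolding pr_def by (intro derivative_intros) (use e in auto)
      have "Ck_on (Suc 0) V \<psi>" using ch by (auto simp: smooth_on_def simp del: Ck_on.simps)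
      then have "\<psi> differentiable (at (y - pr y *\<^sub>R e))"
        using y Ck_on_Suc_has_derivative unfolding T_def differentiable_def by blast
      then have "(\<lambda>y. \<psi> (y - pr y *\<^sub>R e)) differentiable (at y)"
        using pr differentiable_chain_at[of "\<lambda>y. y - pr y *\<^sub>R e" y \<psi>] by (simp add: o_def)
      then have "G differentiable (at y)"
        unfolding G_def using pr by (intro differentiable_scaleR)
      then show "G differentiable (at y within T)" by (rule differentiable_at_withinI)
    qed
    ultimately have neg: "negligible (G ` T)"
      by (intro negligible_differentiable_image_negligible) auto
    obtain \<epsilon> where \<epsilon>: "0 < \<epsilon>" "ball p \<epsilon> \<subseteq> U" using ch by (meson openE)
    \<comment> \<open>The bound 1 keeps the factor \<open>t\<close> away from 0; the other one
      limits \<open>\<bar>t - 1\<bar> * norm q\<close> to half of \<open>\<epsilon>\<close>.\<close>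
    define r where "r = min 1 (\<epsilon> / (2 * (norm p + 1)))"
    have np: "0 < norm p + 1" by (simp add: add_nonneg_pos)
    have r: "0 < r" "r * (norm p + 1) \<le> \<epsilon> / 2"
    proof -
      show "0 < r" using \<epsilon> np by (simp add: r_def)
      have "r * (norm p + 1) \<le> \<epsilon> / (2 * (norm p + 1)) * (norm p + 1)"
        using np by (intro mult_right_mono) (auto simp: r_def)
      also have "\<dots> = \<epsilon> / 2"
      proof -
        have *: "\<epsilon> / (2 * x) * x = \<epsilon> / 2" if "x \<noteq> 0" for x using that by simp
        show ?thesis by (rule *) (use np in simp)
      qed
      finally show "r * (norm p + 1) \<le> \<epsilon> / 2" .
    qed
    have "\<forall>\<^sub>F q in nhds p. dist q p < min 1 (\<epsilon> / 2)"
      using \<epsilon> unfolding eventually_nhds_metric by (intro exI[of _ "min 1 (\<epsilon> / 2)"]) auto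
    with persist[OF r(1)] have "\<forall>\<^sub>F q in nhds p. q \<in> G ` T"
    proof eventually_elim
      case (elim q)
      then obtain t where t: "\<bar>t - 1\<bar> < r" "t *\<^sub>R q \<in> M" by blast
      have t0: "t \<noteq> 0" using t by (auto simp: r_def)
      have "dist (t *\<^sub>R q) p \<le> \<bar>t - 1\<bar> * norm q + dist q p"
      proof -
        have "t *\<^sub>R q - p = (t - 1) *\<^sub>R q + (q - p)" by (simp add: algebra_simps)
        then show ?thesis unfolding dist_norm by (metis norm_scaleR norm_triangle_ineq)
      qed
      also have "\<bar>t - 1\<bar> * norm q \<le> r * (norm p + 1)"
      proof (intro mult_mono)
        have "norm q \<le> norm p + norm (q - p)" by (metis add.commute diff_add_cancel norm_triangle_ineq)
        then show "norm q \<le> norm p + 1" using elim by (simp add: dist_norm)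
      qed (use t r in auto)
      finally have "dist (t *\<^sub>R q) p < \<epsilon>" using r elim by simp
      then have tU: "t *\<^sub>R q \<in> U" using \<epsilon> by (auto simp: dist_commute)
      define s where "s = \<phi> (t *\<^sub>R q)"
      have s: "s \<in> V" "s \<in> S" "\<psi> s = t *\<^sub>R q"
        using tU t(2) ch(4,9) unfolding s_def homeomorphism_def by blast+
      \<comment> \<open>The coded factor is \<open>1 / t\<close>, since \<open>q\<close> is that
        multiple of the surface point \<open>t *\<^sub>R q\<close>.\<close>
      define y where "y = s + (1 / t) *\<^sub>R e"
      have "e \<bullet> s = 0" using e(2)[of s] s(2) by (simp add: span_base orthogonal_def)
      then have pry: "pr y = 1 / t" using e(1) by (simp add: pr_def y_def inner_add_left inner_commute[of s e])
      then have "y - pr y *\<^sub>R e = s" by (simp add: y_def)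
      moreover have "y \<in> span (insert e S)"
        unfolding y_def using s by (intro span_add span_scale span_base) auto
      ultimately have "y \<in> T" "G y = q" using s pry t0 by (auto simp: T_def G_def)
      then show ?case by blast
    qed
    then obtain W where "open W" "p \<in> W" "W \<subseteq> G ` T" by (auto simp: eventually_nhds)
    then show False using neg negligible_subset open_not_negligible by blast
  qed
  ultimately show ?thesis by linarith
qed

section \<open>The radical\<close>

lemma prime_elem_dvd_prod_finite:
  assumes "finite A" "prime_elem p" "p dvd prod f A"
  shows "\<exists>x\<in>A. p dvd f x"
  using assms(1,3)
proof (induction A rule: finite_induct)
  case empty
  then show ?case using prime_elem_not_unit[OF assms(2)] by simp
next
  case (insert x A)
  then show ?case using prime_elem_dvd_multD[OF assms(2)] by auto
qed

lemma is_radical_mveval_eq_0_iff: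
  assumes "is_radical f r"
  shows "mveval r p = 0 \<longleftrightarrow> mveval f p = 0"
  using assms by (auto simp: is_radical_def)

lemma is_radical_dvd:
  assumes "is_radical f r"
  shows "r dvd f"
proof -
  obtain a Q m where *: "finite Q" "\<forall>q\<in>Q. irreducible q \<and> 0 < (m q :: nat)"
    "f = Const a * (\<Prod>q\<in>Q. q ^ m q)" "r = (\<Prod>q\<in>Q. q)"
    using assms unfolding is_radical_def by blast
  have "(\<Prod>q\<in>Q. q) dvd (\<Prod>q\<in>Q. q ^ m q)"
    using *(2) by (intro prod_dvd_prod dvd_power) auto
  then show ?thesis using * by simp
qed

lemma singular_point_mult:
  assumes "singular_point r p"
  shows "singular_point (r * g) p"
  using assms by (auto simp: singular_point_iff line_poly_mult pderiv_mult)

text \<open>The radical divides \<open>f\<close>, and by the product rule a singular point of a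
  factor is singular for every multiple of it.\<close>

lemma smooth_as_scheme_imp_variety:
  fixes f :: "'n::finite mvpoly"
  assumes "f \<noteq> 0" "smooth_as_scheme f"
  shows "smooth_as_variety f"
  using is_radical_dvd[OF is_radical_rad[OF assms(1)]] assms(2) singular_point_mult
  unfolding smooth_as_variety_def smooth_as_scheme_def dvd_def by metis

lemma squarefree_imp_associated_radical:
  fixes f :: "'n::finite mvpoly"
  assumes "squarefree f" "is_radical f r"
  obtains a where "a \<noteq> 0" "f = Const a * r"
proof -
  obtain a Q m where *: "a \<noteq> 0" "finite Q" "\<forall>q\<in>Q. irreducible q \<and> 0 < (m q :: nat)"
    "f = Const a * (\<Prod>q\<in>Q. q ^ m q)" "r = (\<Prod>q\<in>Q. q)"
    using assms(2) unfolding is_radical_def by blast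
  have "m q = 1" if "q \<in> Q" for q
  proof (rule ccontr)
    assume "m q \<noteq> 1"
    then have "2 \<le> m q" using *(3) that by fastforce
    then have "q ^ 2 dvd q ^ m q" by (rule le_imp_power_dvd)
    also have "q ^ m q dvd (\<Prod>q\<in>Q. q ^ m q)" using *(2) that by (rule dvd_prodI)
    also have "\<dots> dvd f" using * by simp
    finally have "q dvd 1" using assms(1) squarefreeD by blast
    then show False using *(3) that by (auto simp: irreducible_def)
  qed
  then have "f = Const a * r" using * by simp
  with *(1) that show thesis by blast
qed

lemma squarefree_smooth_iff:
  fixes f :: "'n::finite mvpoly"
  assumes "f \<noteq> 0" "squarefree f"
  shows "smooth_as_scheme f \<longleftrightarrow> smooth_as_variety f"
proof
  assume v: "smooth_as_variety f"
  obtain a where a: "a \<noteq> 0" "f = Const a * rad f"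
    using squarefree_imp_associated_radical[OF assms(2) is_radical_rad[OF assms(1)]] by blast
  have "rad f = (Const (inverse a) * Const a) * rad f" using a(1) by simp
  also have "\<dots> = f * Const (inverse a)" by (subst (2) a(2)) (simp only: ac_simps)
  finally show "smooth_as_scheme f"
    using v singular_point_mult unfolding smooth_as_variety_def smooth_as_scheme_def by metis
qed (use assms smooth_as_scheme_imp_variety in blast)

text \<open>Either \<open>q\<close> vanishes on all of \<open>N\<close> in \<open>B\<close>, or
  \<open>B\<close> shrinks to the part where \<open>q\<close> is nonzero, on which the remaining
  members of \<open>Q\<close> cover \<open>N\<close>.\<close>

lemma covered_by_one_zero_set:
  fixes N :: "(real ^ 'n) set"
  assumes "finite Q" "open B" "y \<in> B \<inter> N" "\<And>x. x \<in> B \<inter> N \<Longrightarrow> \<exists>q\<in>Q. mveval q x = 0"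
  shows "\<exists>q\<in>Q. \<exists>B' y'. open B' \<and> B' \<subseteq> B \<and> y' \<in> B' \<inter> N \<and> (\<forall>x\<in>B' \<inter> N. mveval q x = 0)"
  using assms
proof (induction Q arbitrary: B y rule: finite_induct)
  case (insert q Q)
  show ?case
  proof (cases "\<forall>x\<in>B \<inter> N. mveval q x = 0")
    case True
    then show ?thesis using insert.prems by blast
  next
    case False
    then obtain x where x: "x \<in> B \<inter> N" "mveval q x \<noteq> 0" by blast
    define B2 where "B2 = B \<inter> {z. mveval q z \<noteq> 0}"
    have "open B2"
      unfolding B2_def using insert.prems(1)
      by (intro open_Int open_Collect_neq continuous_on_mveval continuous_on_id continuous_on_const)
    moreover have "x \<in> B2 \<inter> N" using x by (auto simp: B2_def)
    moreover have "\<exists>q\<in>Q. mveval q z = 0" if "z \<in> B2 \<inter> N" for z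
      using insert.prems(3)[of z] that by (auto simp: B2_def)
    ultimately have "\<exists>q\<in>Q. \<exists>B' y'. open B' \<and> B' \<subseteq> B2 \<and> y' \<in> B' \<inter> N \<and> (\<forall>x\<in>B' \<inter> N. mveval q x = 0)"
      by (rule insert.IH)
    then show ?thesis unfolding B2_def by blast
  qed
qed auto

section \<open>Smooth varieties and smooth real manifolds\<close>

lemma smooth_as_variety_imp_manifold:
  fixes f :: "'n::finite mvpoly"
  assumes "f \<noteq> 0" "smooth_as_variety f"
  shows "smooth_real_manifold (zero_set f)"
proof -
  have "smooth_submanifold (CARD('n) - 1) (zero_set f)"
    unfolding smooth_submanifold_def
  proof
    fix p assume "p \<in> zero_set f"
    then have "mveval (rad f) p = 0"
      by (simp add: zero_set_def is_radical_mveval_eq_0_iff[OF is_radical_rad[OF assms(1)]])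
    moreover have "\<not> singular_point (rad f) p"
      using assms(2) by (simp add: smooth_as_variety_def smooth_as_scheme_def)
    moreover have "x \<in> zero_set f \<longleftrightarrow> mveval (rad f) x = 0" for x
      by (simp add: zero_set_def is_radical_mveval_eq_0_iff[OF is_radical_rad[OF assms(1)]])
    ultimately show "\<exists>U V (\<phi> :: real ^ 'n \<Rightarrow> real ^ 'n) \<psi> S.
     open U \<and> p \<in> U \<and> open V \<and> homeomorphism U V \<phi> \<psi> \<and>
     smooth_on U \<phi> \<and> smooth_on V \<psi> \<and>
     subspace S \<and> dim S = CARD('n) - 1 \<and> \<phi> ` (U \<inter> zero_set f) = V \<inter> S"
      by (rule regular_zero_set_chart)
  qed
  then show ?thesis unfolding smooth_real_manifold_def by blast
qed

lemma manifold_imp_smooth_as_variety: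
  fixes c :: "'n::finite tensor4"
  assumes c: "stiffness_tensor c" "positive_definite c"
    and mf: "smooth_real_manifold (slowness_surface c)"
  shows "smooth_as_variety (slowness_poly c)"
  unfolding smooth_as_variety_def smooth_as_scheme_def
proof
  define f where "f = slowness_poly c"
  define r where "r = rad f"
  define M where "M = slowness_surface c"
  have f0: "f \<noteq> 0" "mveval f 0 \<noteq> 0" using slowness_poly_neq_0 slowness_poly_0 by (auto simp: f_def)
  have rad: "is_radical f r" unfolding r_def using f0 by (intro is_radical_rad)
  have memM: "x \<in> M \<longleftrightarrow> mveval f x = 0" for x
    by (simp add: M_def slowness_surface_def zero_set_def f_def)
  assume "\<exists>p. singular_point (rad (slowness_poly c)) p"
  then obtain p where "singular_point r p" by (auto simp: r_def f_def)
  then have rp: "mveval r p = 0" "mveval (euler_op r) p = 0"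
    by (auto simp: singular_point_iff mveval_euler_op_eq_deriv)
  have memMr: "x \<in> M \<longleftrightarrow> mveval r x = 0" for x
    using is_radical_mveval_eq_0_iff[OF rad] memM by blast
  then have pM: "p \<in> M" using rp by blast
  \<comment> \<open>The trivial factorization of \<open>f\<close> with cofactor 1 gives persistence
    for the surface itself.\<close>
  have persist: "\<forall>\<^sub>F q in nhds x. \<exists>t. \<bar>t - 1\<bar> < e \<and> t *\<^sub>R q \<in> M" if "x \<in> M" "0 < e" for x e
    using ray_root_persists[OF c, of f 1 x e] that by (simp add: memM f_def)
  have fin: "finite {t. t *\<^sub>R q \<in> M}" for q
  proof -
    have "line_poly 0 q f \<noteq> 0"
      using f0(2) by (metis poly_line_poly poly_0 add_0 scaleR_zero_left)
    then have "finite {t. poly (line_poly 0 q f) t = 0}" by (rule poly_roots_finite)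
    then show ?thesis by (simp add: memM)
  qed
  obtain d where d: "smooth_submanifold d M" using mf by (auto simp: smooth_real_manifold_def M_def)
  then have "d = CARD('n) - 1" using ray_hypersurface_dim[OF _ pM persist[OF pM] fin] by blast
  with d obtain k R H where H: "0 < R" "continuous_on (ball p R) H" "\<And>x. x \<in> ball p R \<Longrightarrow> x \<in> M \<longleftrightarrow> H x = 0"
    "\<And>x s. 0 < s \<Longrightarrow> x \<in> ball p R \<Longrightarrow> x + s *\<^sub>R axis k 1 \<in> ball p R \<Longrightarrow> H x < (H (x + s *\<^sub>R axis k 1) :: real)"
    using hypersurface_defining_function[OF _ pM] by metis
  have "\<exists>\<delta>>0. \<exists>\<eta>>0. \<forall>q t1 t2. dist q p < \<eta> \<longrightarrow> \<bar>t1 - 1\<bar> < \<delta> \<longrightarrow> \<bar>t2 - 1\<bar> < \<delta> \<longrightarrow>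
    t1 *\<^sub>R q \<in> M \<longrightarrow> t2 *\<^sub>R q \<in> M \<longrightarrow> t1 = t2"
    by (rule ray_meets_once[of R p H M "axis k 1"]) (fact H persist fin pM)+
  then obtain \<delta> \<eta> where once: "0 < \<delta>" "0 < \<eta>"
    "\<And>q t1 t2. dist q p < \<eta> \<Longrightarrow> \<bar>t1 - 1\<bar> < \<delta> \<Longrightarrow> \<bar>t2 - 1\<bar> < \<delta> \<Longrightarrow> t1 *\<^sub>R q \<in> M \<Longrightarrow> t2 *\<^sub>R q \<in> M \<Longrightarrow> t1 = t2"
    by blast
  obtain h where h: "slowness_poly c = r * h" using is_radical_dvd[OF rad] by (auto simp: f_def elim: dvdE)
  have "\<forall>\<^sub>F q in nhds p. dist q p < \<eta>" using once(2) by (auto simp: eventually_nhds_metric)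
  with double_ray_root_persists[OF c h rp once(1)]
  have "\<forall>\<^sub>F q in nhds p. q \<in> M \<longrightarrow> mveval (euler_op r) q = 0"
  proof eventually_elim
    case (elim q)
    then obtain t1 t2 where t: "\<bar>t1 - 1\<bar> < \<delta>" "\<bar>t2 - 1\<bar> < \<delta>" "t1 *\<^sub>R q \<in> M" "t2 *\<^sub>R q \<in> M"
      "t1 = t2 \<longrightarrow> poly (pderiv (line_poly 0 q r)) t1 = 0" using memMr by blast
    show ?case
    proof
      \<comment> \<open>Now \<open>t = 1\<close> is a meeting point as well, so uniqueness makes
        \<open>t1\<close> and \<open>t2\<close> both 1, and the double root lies at \<open>q\<close>
        itself.\<close>
      assume "q \<in> M"
      then have "t1 = 1" using once(3)[OF elim(2) t(1) _ t(3), of 1] once(1) by simp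
      moreover have "t1 = t2" using once(3)[OF elim(2) t(1-4)] .
      ultimately show "mveval (euler_op r) q = 0" using t(5) by (simp add: mveval_euler_op)
    qed
  qed
  then obtain W where W: "open W" "p \<in> W" "\<And>x. x \<in> W \<Longrightarrow> x \<in> M \<Longrightarrow> mveval (euler_op r) x = 0"
    by (auto simp: eventually_nhds)
  obtain a Q m where Q: "finite Q" "\<forall>q\<in>Q. irreducible q \<and> 0 < (m q :: nat)"
    "\<forall>q\<in>Q. \<forall>q'\<in>Q. q \<noteq> q' \<longrightarrow> \<not> q dvd q'" "f = Const a * (\<Prod>q\<in>Q. q ^ m q)" "r = (\<Prod>q\<in>Q. q)"
    using rad unfolding is_radical_def by blast
  have cover: "\<exists>q\<in>Q. mveval q x = 0" if "x \<in> (W \<inter> ball p R) \<inter> M" for x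
    using that memMr Q(1,5) by auto
  have "open (W \<inter> ball p R)" "p \<in> (W \<inter> ball p R) \<inter> M" using W H(1) pM by auto
  then have "\<exists>q\<in>Q. \<exists>B y. open B \<and> B \<subseteq> W \<inter> ball p R \<and> y \<in> B \<inter> M \<and> (\<forall>x\<in>B \<inter> M. mveval q x = 0)"
    by (rule covered_by_one_zero_set[OF Q(1)]) (rule cover)
  then obtain q B y where q: "q \<in> Q" and B: "open B" "B \<subseteq> W \<inter> ball p R" "y \<in> B \<inter> M"
    "\<forall>x\<in>B \<inter> M. mveval q x = 0"
    by (elim exE bexE conjE) (rule that)
  have prime: "prime_elem q" using q Q(2) irreducible_imp_prime_elem_mvpoly by blast
  \<comment> \<open>The Euler operator is a derivation, so where \<open>q\<close> vanishes,
    \<open>euler_op r\<close> takes the values of \<open>euler_op q * s\<close> with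
    \<open>s\<close> the product of the other factors.\<close>
  define s where "s = (\<Prod>q\<in>Q - {q}. q)"
  have rs: "r = q * s" using Q(1,5) q by (simp add: s_def prod.remove)
  have "mveval (euler_op q * s) x = 0" if "x \<in> B \<inter> M" for x
  proof -
    have "mveval (euler_op r) x = 0" using W(3) B(2) that by blast
    moreover have "mveval (euler_op r) x = mveval (euler_op q) x * mveval s x + mveval q x * mveval (euler_op s) x"
      by (simp add: mveval_euler_op rs line_poly_mult pderiv_mult algebra_simps)
    ultimately show ?thesis using B(4) that by simp
  qed
  moreover have "g = 0" if "deg_less k 1 g" "\<forall>x\<in>B \<inter> M. mveval g x = 0" for g
    using hypersurface_thick[OF H(2-4) B(1) _ _ _ that] B by blast
  ultimately have "q dvd euler_op q * s"
    using prime_dvd_if_vanish[OF prime, of k "B \<inter> M"] B(4) by blast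
  then have "q dvd euler_op q \<or> q dvd s" using prime_elem_dvd_multD[OF prime] by blast
  moreover have "mveval q 0 \<noteq> 0"
  proof
    assume "mveval q 0 = 0"
    then have "mveval r 0 = 0" by (simp add: rs)
    then show False using f0(2) is_radical_mveval_eq_0_iff[OF rad] by blast
  qed
  then have "\<not> q dvd euler_op q" using irreducible_not_dvd_euler_op q Q(2) by blast
  moreover have "\<not> q dvd s"
  proof
    assume "q dvd s"
    then obtain q' where "q' \<in> Q - {q}" "q dvd q'"
      using prime_elem_dvd_prod_finite[OF _ prime, of "Q - {q}" "\<lambda>x. x"] Q(1) by (auto simp: s_def)
    then show False using Q(3) q by auto
  qed
  ultimately show False by blast
qed

text \<open>Scaling keeps a point degenerate but may take it off the surface, so (4) appears in two
  forms: for the eigenvalue 1, which ties the degeneracy to the surface, and for all nonzero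
  degeneracy points, which form the cone over the singular points.\<close>

theorem proposition8:
  fixes c :: "'n::finite tensor4"
  assumes "stiffness_tensor c" and "positive_definite c"
  shows "(smooth_as_scheme (slowness_poly c) \<longrightarrow> smooth_as_variety (slowness_poly c))
    \<and> (squarefree (slowness_poly c) \<longrightarrow>
         (smooth_as_scheme (slowness_poly c) \<longleftrightarrow> smooth_as_variety (slowness_poly c)))
    \<and> (smooth_real_manifold (slowness_surface c) \<longleftrightarrow> smooth_as_variety (slowness_poly c))
    \<and> (\<forall>p. singular_point (slowness_poly c) p \<longleftrightarrow> multiple_eigenvalue (christoffel c p) 1)
    \<and> degeneracy_points c - {0} =
        {t *\<^sub>R p | t p. 0 < t \<and> singular_point (slowness_poly c) p}"
  using smooth_as_scheme_imp_variety[OF slowness_poly_neq_0]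
    squarefree_smooth_iff[OF slowness_poly_neq_0]
    smooth_as_variety_imp_manifold[OF slowness_poly_neq_0[of c]]
    manifold_imp_smooth_as_variety[OF assms]
    singular_point_slowness_iff[OF assms(1)] degeneracy_points_eq[OF assms]
  unfolding slowness_surface_def by blast

end
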